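(* Let $G$ be the groupoid arising from a contracting self-similar group action, with singular ideal $J\trianglelefteq C^*_r(G)$ and algebraic singular ideal $J_{\mathbb{C}}=J\cap\mathbb{C}G$. Then $J_{\mathbb{C}}$ is dense in $J$.
   Context: Self-similar groups: let $A$ be a finite non-empty alphabet, $A^*$ the set of finite words and $A^\omega$ the space of right-infinite words with the product topology. A self-similar group action is a faithful action of a group $\Gamma$ on $A^*$ by length-preserving bijections such that for all $g\in\Gamma$ and $a\in A$ there are $a'\in A$ and $g|_a\in\Gamma$ with $g(aw)=a'\,(g|_a)(w)$ for all $w\in A^*$ (here $a'=g(a)$ and $g|_a$ is uniquely determined by faithfulness). For words put $g|_{a_1\cdots a_n}=(\cdots(g|_{a_1})|_{a_2}\cdots)|_{a_n}$. The action extends to $A^\omega$ by homeomorphisms. The action is contracting if there is a finite set $\mathcal{N}\subseteq\Gamma$ such that for every $g\in\Gamma$ there is $m\in\mathbb{N}$ with $g|_v\in\mathcal{N}$ for all words $v$ of length at least $m$. The associated groupoid $G$ is the étale (ample) groupoid of germs of the inverse semigroup of partial homeomorphisms of $A^\omega$ generated by the homeomorphisms $uA^\omega\to vA^\omega$, $uw\mapsto v\,g(w)$, for $u,v\in A^*$ and $g\in\Gamma$: its elements are classes $[T,\xi]$ with $T$ in the inverse semigroup and $\xi\in\mathrm{dom}(T)$, where $[T,\xi]=[T',\xi]$ iff $T$ and $T'$ agree on a neighbourhood of $\xi$; $s([T,\xi])=\xi$, $r([T,\xi])=T\xi$, and the sets $\{[T,\xi]:\xi\in O\}$, $O\subseteq\mathrm{dom}(T)$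 open, form a basis of the topology. The unit space is $A^\omega$. Algebras: $G_x=s^{-1}(x)$. An open bisection is an open $U\subseteq G$ on which $r$ and $s$ restrict to homeomorphisms onto $r(U)$, $s(U)$. The complex Steinberg algebra is $\mathbb{C}G:=\mathrm{span}\{\mathbbm{1}_U: U\subseteq G\text{ a compact open bisection}\}$. Connes' algebra $\mathscr{C}_c(G)$ is the linear span of functions $f\colon G\to\mathbb{C}$ for which there is an open bisection $U$ with $f|_U\in C_c(U)$, $f|_{G\setminus U}=0$, with convolution product $(f_1*f_2)(g)=\sum_{h\in G_{s(g)}}f_1(gh^{-1})f_2(h)$ and $f^*(g)=\overline{f(g^{-1})}$. $C^*_r(G)$ is the completion of $\mathscr{C}_c(G)$ in the norm $\sup_x\|\lambda_x(f)\|$, where $\lambda_x(f)\xi=f*\xi$ on $\ell^2(G_x)$; its elements are viewed as functions on $G$ via $a(g)=\langle\lambda_{s(g)}(a)\delta_{s(g)},\delta_g\rangle$. The singular ideal is $J=\{a\in C^*_r(G): \{g: a(g)\neq0\}\text{ has empty interior}\}$. *)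

theory Defs
  imports
    "HOL-Analysis.Analysis"
    "HOL-Algebra.Group_Action"
    "HOL-Library.Omega_Words_Fun"
begin

section \<open>Topological groupoids\<close>

text \<open>
  Source and range take values in a separate type of objects, carrying its own topology;
  \<open>unit_at\<close> identifies the objects with the unit arrows.
\<close>

record ('g, 'x) top_groupoid =
  arrows  :: "'g topology"
  objects :: "'x topology"
  src     :: "'g \<Rightarrow> 'x"
  rng     :: "'g \<Rightarrow> 'x"
  unit_at :: "'x \<Rightarrow> 'g"
  gmult   :: "'g \<Rightarrow> 'g \<Rightarrow> 'g"
  ginv    :: "'g \<Rightarrow> 'g"

definition fiber :: "('g, 'x) top_groupoid \<Rightarrow> 'x \<Rightarrow> 'g set" where
  "fiber G x = {g \<in> topspace (arrows G). src G g = x}"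

definition open_bisection :: "('g, 'x) top_groupoid \<Rightarrow> 'g set \<Rightarrow> bool" where
  "open_bisection G U \<longleftrightarrow>
     openin (arrows G) U \<and>
     homeomorphic_map (subtopology (arrows G) U) (subtopology (objects G) (rng G ` U)) (rng G) \<and>
     homeomorphic_map (subtopology (arrows G) U) (subtopology (objects G) (src G ` U)) (src G)"


section \<open>The Steinberg algebra and Connes' algebra\<close>

text \<open>
  Functions on a groupoid are total functions on the type of arrows that vanish outside
  the set of arrows.
\<close>

definition cspan :: "('g \<Rightarrow> complex) set \<Rightarrow> ('g \<Rightarrow> complex) set" where
  "cspan S = {(\<lambda>g. \<Sum>f\<in>F. c f * f g) | F c. finite F \<and> F \<subseteq> S}"

definition steinberg_algebra :: "('g, 'x) top_groupoid \<Rightarrow> ('g \<Rightarrow> complex) set" where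
  "steinberg_algebra G =
     cspan {indicator U | U. open_bisection G U \<and> compactin (arrows G) U}"

definition Cc_on :: "'g topology \<Rightarrow> ('g \<Rightarrow> complex) set" where
  "Cc_on X = {f. continuous_map X euclidean f \<and>
                 compactin X (X closure_of {g \<in> topspace X. f g \<noteq> 0})}"

text \<open>
  The groupoid need not be Hausdorff, so compactness of the support is required inside the
  bisection, and the extension of the function by zero need not be continuous.
\<close>

definition connes_algebra :: "('g, 'x) top_groupoid \<Rightarrow> ('g \<Rightarrow> complex) set" where
  "connes_algebra G =
     cspan {f. \<exists>U. open_bisection G U \<and> f \<in> Cc_on (subtopology (arrows G) U) \<and>
                   (\<forall>g. g \<notin> U \<longrightarrow> f g = 0)}"

definition convol ::
  "('g, 'x) top_groupoid \<Rightarrow> ('g \<Rightarrow> complex) \<Rightarrow> ('g \<Rightarrow> complex) \<Rightarrow> 'g \<Rightarrow> complex" where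
  "convol G f1 f2 g =
     (if g \<in> topspace (arrows G)
      then \<Sum>\<^sub>\<infinity>h\<in>fiber G (src G g). f1 (gmult G g (ginv G h)) * f2 h
      else 0)"


section \<open>The reduced C*-algebra\<close>

definition l2 :: "('g, 'x) top_groupoid \<Rightarrow> 'x \<Rightarrow> ('g \<Rightarrow> complex) set" where
  "l2 G x = {\<xi>. (\<forall>g. g \<notin> fiber G x \<longrightarrow> \<xi> g = 0) \<and>
                (\<lambda>g. (cmod (\<xi> g))\<^sup>2) summable_on fiber G x}"

definition l2_norm :: "('g, 'x) top_groupoid \<Rightarrow> 'x \<Rightarrow> ('g \<Rightarrow> complex) \<Rightarrow> real" where
  "l2_norm G x \<xi> = sqrt (\<Sum>\<^sub>\<infinity>g\<in>fiber G x. (cmod (\<xi> g))\<^sup>2)"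

definition l2_inner ::
  "('g, 'x) top_groupoid \<Rightarrow> 'x \<Rightarrow> ('g \<Rightarrow> complex) \<Rightarrow> ('g \<Rightarrow> complex) \<Rightarrow> complex" where
  "l2_inner G x \<xi> \<eta> = (\<Sum>\<^sub>\<infinity>g\<in>fiber G x. \<xi> g * cnj (\<eta> g))"

definition bounded_operators ::
  "('g, 'x) top_groupoid \<Rightarrow> 'x \<Rightarrow> (('g \<Rightarrow> complex) \<Rightarrow> ('g \<Rightarrow> complex)) set" where
  "bounded_operators G x = {T \<in> l2 G x \<rightarrow>\<^sub>E l2 G x.
     (\<forall>\<xi>\<in>l2 G x. \<forall>\<eta>\<in>l2 G x. \<forall>c d.
        T (\<lambda>g. c * \<xi> g + d * \<eta> g) = (\<lambda>g. c * T \<xi> g + d * T \<eta> g)) \<and>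
     (\<exists>C. \<forall>\<xi>\<in>l2 G x. l2_norm G x (T \<xi>) \<le> C * l2_norm G x \<xi>)}"

definition operator_norm ::
  "('g, 'x) top_groupoid \<Rightarrow> 'x \<Rightarrow> (('g \<Rightarrow> complex) \<Rightarrow> ('g \<Rightarrow> complex)) \<Rightarrow> ennreal" where
  "operator_norm G x T =
     (SUP \<xi>\<in>{\<xi> \<in> l2 G x. l2_norm G x \<xi> \<le> 1}. ennreal (l2_norm G x (T \<xi>)))"

text \<open>Operator families \<open>a\<close> assign to every object \<open>x\<close> an operator \<open>a x\<close> on \<open>l2 G x\<close>.\<close>

type_synonym ('g, 'x) operator_family = "'x \<Rightarrow> ('g \<Rightarrow> complex) \<Rightarrow> ('g \<Rightarrow> complex)"

definition reduced_norm :: "('g, 'x) top_groupoid \<Rightarrow> ('g, 'x) operator_family \<Rightarrow> ennreal" where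
  "reduced_norm G a = (SUP x\<in>topspace (objects G). operator_norm G x (a x))"

definition regular_rep ::
  "('g, 'x) top_groupoid \<Rightarrow> ('g \<Rightarrow> complex) \<Rightarrow> ('g, 'x) operator_family" where
  "regular_rep G f = (\<lambda>x\<in>topspace (objects G). \<lambda>\<xi>\<in>l2 G x. convol G f \<xi>)"

text \<open>
  The completion of Connes' algebra in the norm \<open>reduced_norm G (regular_rep G f)\<close> is realised
  as the closure of its image under \<open>regular_rep G\<close>, which is isometric by definition of the
  norm, inside the product of the algebras of bounded operators on the spaces \<open>l2 G x\<close>, which is
  complete. The component \<open>a x\<close> is then the image of \<open>a\<close> under the continuous extension of the
  regular representation at \<open>x\<close> to the completion.
\<close>

definition reduced_algebra :: "('g, 'x) top_groupoid \<Rightarrow> ('g, 'x) operator_family set" where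
  "reduced_algebra G = {a \<in> (\<Pi>\<^sub>E x\<in>topspace (objects G). bounded_operators G x).
     \<forall>\<epsilon>>0. \<exists>f\<in>connes_algebra G. reduced_norm G (a - regular_rep G f) < ennreal \<epsilon>}"

definition value_at ::
  "('g, 'x) top_groupoid \<Rightarrow> ('g, 'x) operator_family \<Rightarrow> 'g \<Rightarrow> complex" where
  "value_at G a g =
     (let x = src G g in l2_inner G x (a x (indicator {unit_at G x})) (indicator {g}))"

definition singular_ideal :: "('g, 'x) top_groupoid \<Rightarrow> ('g, 'x) operator_family set" where
  "singular_ideal G = {a \<in> reduced_algebra G.
     arrows G interior_of {g \<in> topspace (arrows G). value_at G a g \<noteq> 0} = {}}"

definition algebraic_singular_ideal ::
  "('g, 'x) top_groupoid \<Rightarrow> ('g, 'x) operator_family set" where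
  "algebraic_singular_ideal G = singular_ideal G \<inter> regular_rep G ` steinberg_algebra G"

definition norm_dense_in ::
  "('g, 'x) top_groupoid \<Rightarrow> ('g, 'x) operator_family set \<Rightarrow> ('g, 'x) operator_family set \<Rightarrow> bool"
  where
  "norm_dense_in G B A \<longleftrightarrow>
     B \<subseteq> A \<and> (\<forall>a\<in>A. \<forall>\<epsilon>>0. \<exists>b\<in>B. reduced_norm G (a - b) < ennreal \<epsilon>)"


section \<open>Self-similar actions\<close>

locale self_similar_action = faithful_action \<Gamma> "UNIV :: 'a::finite list set" \<phi>
  for \<Gamma> :: "('c, 'm) monoid_scheme" and \<phi> :: "'c \<Rightarrow> 'a::finite list \<Rightarrow> 'a list" +
  assumes length_preserving: "g \<in> carrier \<Gamma> \<Longrightarrow> length (\<phi> g w) = length w"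
    and self_similar:
      "g \<in> carrier \<Gamma> \<Longrightarrow> \<exists>a'. \<exists>h\<in>carrier \<Gamma>. \<forall>w. \<phi> g (a # w) = a' # \<phi> h w"

definition letter_section ::
  "('c, 'm) monoid_scheme \<Rightarrow> ('c \<Rightarrow> 'a list \<Rightarrow> 'a list) \<Rightarrow> 'c \<Rightarrow> 'a \<Rightarrow> 'c" where
  "letter_section \<Gamma> \<phi> g a =
     (THE h. h \<in> carrier \<Gamma> \<and> (\<exists>a'. \<forall>w. \<phi> g (a # w) = a' # \<phi> h w))"

definition word_section ::
  "('c, 'm) monoid_scheme \<Rightarrow> ('c \<Rightarrow> 'a list \<Rightarrow> 'a list) \<Rightarrow> 'c \<Rightarrow> 'a list \<Rightarrow> 'c" where
  "word_section \<Gamma> \<phi> = foldl (letter_section \<Gamma> \<phi>)"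

locale contracting_self_similar_action = self_similar_action +
  assumes contracting:
    "\<exists>N. finite N \<and> N \<subseteq> carrier \<Gamma> \<and>
         (\<forall>g\<in>carrier \<Gamma>. \<exists>m. \<forall>v. length v \<ge> m \<longrightarrow> word_section \<Gamma> \<phi> g v \<in> N)"


section \<open>The groupoid of germs\<close>

text \<open>
  Infinite words are functions \<open>nat \<Rightarrow> 'a\<close>, with \<open>u \<frown> \<xi>\<close>, \<open>prefix\<close> and \<open>suffix\<close> from
  \<^theory>\<open>HOL-Library.Omega_Words_Fun\<close>. Partial maps are option-valued, so equality of the
  values \<open>T \<eta>\<close> and \<open>T' \<eta>\<close> includes equality of definedness.
\<close>

definition word_topology :: "'a word topology" where
  "word_topology = product_topology (\<lambda>_. discrete_topology UNIV) UNIV"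

definition act_word :: "('c \<Rightarrow> 'a list \<Rightarrow> 'a list) \<Rightarrow> 'c \<Rightarrow> 'a word \<Rightarrow> 'a word" where
  "act_word \<phi> g \<xi> = (\<lambda>n. \<phi> g (prefix (Suc n) \<xi>) ! n)"

definition cylinder_map ::
  "('c \<Rightarrow> 'a list \<Rightarrow> 'a list) \<Rightarrow> 'a list \<Rightarrow> 'c \<Rightarrow> 'a list \<Rightarrow> 'a word \<rightharpoonup> 'a word" where
  "cylinder_map \<phi> u g v \<zeta> =
     (if \<zeta> \<in> range (\<lambda>\<xi>. u \<frown> \<xi>) then Some (v \<frown> act_word \<phi> g (suffix (length u) \<zeta>)) else None)"

definition partial_inverse :: "('x \<rightharpoonup> 'x) \<Rightarrow> ('x \<rightharpoonup> 'x)" where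
  "partial_inverse T y = (if y \<in> ran T then Some (THE x. T x = Some y) else None)"

inductive_set inverse_semigroup ::
  "('c, 'm) monoid_scheme \<Rightarrow> ('c \<Rightarrow> 'a list \<Rightarrow> 'a list) \<Rightarrow> ('a word \<rightharpoonup> 'a word) set"
  for \<Gamma> :: "('c, 'm) monoid_scheme" and \<phi> :: "'c \<Rightarrow> 'a list \<Rightarrow> 'a list"
  where
    generator: "g \<in> carrier \<Gamma> \<Longrightarrow> cylinder_map \<phi> u g v \<in> inverse_semigroup \<Gamma> \<phi>"
  | composition: "T \<in> inverse_semigroup \<Gamma> \<phi> \<Longrightarrow> T' \<in> inverse_semigroup \<Gamma> \<phi> \<Longrightarrow>
      T \<circ>\<^sub>m T' \<in> inverse_semigroup \<Gamma> \<phi>"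
  | inversion: "T \<in> inverse_semigroup \<Gamma> \<phi> \<Longrightarrow> partial_inverse T \<in> inverse_semigroup \<Gamma> \<phi>"

type_synonym 'a germ = "(('a word \<rightharpoonup> 'a word) \<times> 'a word) set"

definition pointed_maps ::
  "('c, 'm) monoid_scheme \<Rightarrow> ('c \<Rightarrow> 'a list \<Rightarrow> 'a list) \<Rightarrow> (('a word \<rightharpoonup> 'a word) \<times> 'a word) set"
  where
  "pointed_maps \<Gamma> \<phi> = {(T, \<xi>). T \<in> inverse_semigroup \<Gamma> \<phi> \<and> \<xi> \<in> dom T}"

definition germ_relation ::
  "('c, 'm) monoid_scheme \<Rightarrow> ('c \<Rightarrow> 'a list \<Rightarrow> 'a list) \<Rightarrow> (('a word \<rightharpoonup> 'a word) \<times> 'a word) rel"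
  where
  "germ_relation \<Gamma> \<phi> = {((T, \<xi>), (T', \<xi>')).
     (T, \<xi>) \<in> pointed_maps \<Gamma> \<phi> \<and> (T', \<xi>') \<in> pointed_maps \<Gamma> \<phi> \<and> \<xi> = \<xi>' \<and>
     (\<exists>V. openin word_topology V \<and> \<xi> \<in> V \<and> (\<forall>\<eta>\<in>V. T \<eta> = T' \<eta>))}"

definition germ ::
  "('c, 'm) monoid_scheme \<Rightarrow> ('c \<Rightarrow> 'a list \<Rightarrow> 'a list) \<Rightarrow>
   ('a word \<rightharpoonup> 'a word) \<Rightarrow> 'a word \<Rightarrow> 'a germ" where
  "germ \<Gamma> \<phi> T \<xi> = germ_relation \<Gamma> \<phi> `` {(T, \<xi>)}"

text \<open>
  The operations are defined on representatives; for product and inverse the union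
  is taken over germs that all coincide.
\<close>

definition germ_groupoid ::
  "('c, 'm) monoid_scheme \<Rightarrow> ('c \<Rightarrow> 'a list \<Rightarrow> 'a list) \<Rightarrow> ('a germ, 'a word) top_groupoid" where
  "germ_groupoid \<Gamma> \<phi> = \<lparr>
     arrows = topology_generated_by
       {{germ \<Gamma> \<phi> T \<xi> | \<xi>. \<xi> \<in> V} | T V.
          T \<in> inverse_semigroup \<Gamma> \<phi> \<and> openin word_topology V \<and> V \<subseteq> dom T},
     objects = word_topology,
     src = (\<lambda>\<gamma>. THE \<xi>. \<exists>T. (T, \<xi>) \<in> \<gamma>),
     rng = (\<lambda>\<gamma>. THE \<eta>. \<exists>T \<xi>. (T, \<xi>) \<in> \<gamma> \<and> T \<xi> = Some \<eta>),
     unit_at = germ \<Gamma> \<phi> Some,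
     gmult = (\<lambda>\<gamma> \<delta>. \<Union>{germ \<Gamma> \<phi> (T \<circ>\<^sub>m T') \<xi> | T T' \<xi>.
                       (T', \<xi>) \<in> \<delta> \<and> (T, the (T' \<xi>)) \<in> \<gamma>}),
     ginv = (\<lambda>\<gamma>. \<Union>{germ \<Gamma> \<phi> (partial_inverse T) (the (T \<xi>)) | T \<xi>. (T, \<xi>) \<in> \<gamma>})\<rparr>"

end

theory Submission
  imports Defs
begin

text \<open>
  Call an infinite word regular if any two maps of the inverse semigroup that agree at it agree near
  it. The semigroup is countable, so regular words are dense by Baire's theorem, and an element of the
  reduced algebra is singular exactly when it vanishes at all arrows with regular source.

  Let \<open>a\<close> be singular and \<open>f\<close> a combination of indicators of the bisections \<open>(u, g, v)\<close>, sending
  \<open>u w\<close> to \<open>v (g w)\<close>, with \<open>f\<close> close to \<open>a\<close>. Once \<open>u\<close> is long enough all \<open>g\<close> may be taken in the finite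
  set \<open>N\<close> of the contraction property, so for long words \<open>u, v\<close> the function \<open>f (v \<cdot> u\<^sup>-\<^sup>1)\<close> agrees, at germs of
  group elements over regular words, with an element of the span of the finitely many indicators of
  germs of elements of \<open>N\<close>. Elements of this span are recovered on regular words by interpolation from
  finitely many arrows \<open>p\<close>, with coefficients that do not depend on \<open>f\<close>. The numbers \<open>f (v p u\<^sup>-\<^sup>1)\<close> form a
  submatrix of the operator of \<open>f - a\<close>, because \<open>a\<close> vanishes at these arrows; hence the interpolant is
  small. To treat all degrees \<open>|v| - |u|\<close> at once, \<open>u\<close> and \<open>v\<close> range over all words with lengths in a window
  of size \<open>L\<close> and the result is divided by \<open>L\<close>. This multiplies the part of degree \<open>k\<close> by a Fejer weight
  close to \<open>1 - |k| / L\<close>, and for large \<open>L\<close> the reweighted \<open>f\<close> minus its interpolant is a combination of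
  indicators close to \<open>a\<close> that vanishes over regular words.
\<close>

text \<open>The correction must be small in operator norm, and pointwise smallness at regular arrows
  would not give this. Hence whole matrices of values are sampled and fed back as scalar matrices
  against the elements of \<open>N\<close>. The order of choices makes this work: \<open>N\<close>,
  the sample points and the interpolation coefficients come from the action alone, so the total size
  \<open>C\<close> of the coefficients is known before \<open>f\<close> is chosen, and
  \<open>f\<close> can be taken within \<epsilon> / (3 + C) of \<open>a\<close>. The error is then
  one such unit for \<open>f\<close>, one for the reweighting and \<open>C\<close> units for the
  interpolant. The window takes the place of a splitting of \<open>f\<close> into homogeneous
  degrees: words of one length have disjoint cylinders, so a matrix over them acts without overlap,
  while over \<open>L\<close> lengths every arrow is met up to \<open>L\<close> times, which the
  factor 1 / L undoes. The weights depend on the degree, which is attached to a germ only if the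
  alphabet has at least two letters.\<close>

section \<open>Prefixes and cylinder sets\<close>

lemma prefix_eqD: "prefix n x = prefix n y \<Longrightarrow> i < n \<Longrightarrow> x i = y i"
  by (metis add.left_neutral diff_zero subsequence_nth)

lemma word_eq_prefixI: "(\<And>n. prefix n \<xi> = prefix n \<eta>) \<Longrightarrow> \<xi> = (\<eta> :: 'a word)"
  by (rule ext) (rule prefix_eqD[where n = "Suc _"], auto)

lemma prefix_eq_iff: "prefix n x = prefix n y \<longleftrightarrow> (\<forall>i<n. x i = y i)"
  by (auto dest: prefix_eqD simp: list_eq_iff_nth_eq)

lemma prefix_mono_eq: "prefix n x = prefix n y \<Longrightarrow> m \<le> n \<Longrightarrow> prefix m x = prefix m y"
  by (auto simp: prefix_eq_iff)

abbreviation cyl :: "'a list \<Rightarrow> 'a word set" where "cyl u \<equiv> range (\<lambda>\<xi>. u \<frown> \<xi>)"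

lemma in_cyl_iff: "\<zeta> \<in> cyl u \<longleftrightarrow> prefix (length u) \<zeta> = u"
  by (metis prefix_conc_length prefix_suffix rangeE range_eqI)

lemma conc_inj: "u \<frown> \<xi> = u \<frown> \<eta> \<longleftrightarrow> \<xi> = \<eta>"
  by simp

text \<open>Lengthens a domain word along a given point; this brings bisections with domain words of
  different lengths to one common length.\<close>

lemma cyl_extend:
  assumes "\<xi> \<in> cyl u" "length u \<le> l"
  obtains w where "length u + length w = l" "\<xi> \<in> cyl (u @ w)"
proof
  let ?w = "drop (length u) (prefix l \<xi>)"
  show len: "length u + length ?w = l" using assms(2) by simp
  have "take (length u) (prefix l \<xi>) = u" using assms by (simp add: in_cyl_iff min_absorb1)
  then have "u @ ?w = prefix l \<xi>" by (metis append_take_drop_id)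
  then show "\<xi> \<in> cyl (u @ ?w)" unfolding in_cyl_iff length_append len by simp
qed

lemma cyl_append_iff: "u \<frown> \<xi> \<in> cyl (u @ w) \<longleftrightarrow> \<xi> \<in> cyl w"
  by (auto simp: in_cyl_iff)

lemma cyl_append_subset: "cyl (u @ w) \<subseteq> cyl u"
  by (auto simp: in_cyl_iff)

lemma cyl_comparable:
  assumes "u \<frown> \<xi> = v \<frown> \<eta>" "length u \<le> length v"
  shows "v = u @ drop (length u) v" "\<xi> = drop (length u) v \<frown> \<eta>"
proof -
  have "prefix (length u) (u \<frown> \<xi>) = prefix (length u) (v \<frown> \<eta>)" using assms by simp
  then have "u = take (length u) v" using assms(2) by simp
  then show *: "v = u @ drop (length u) v" by (metis append_take_drop_id)
  show "\<xi> = drop (length u) v \<frown> \<eta>"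
    by (metis assms(1) * conc_conc conc_inj)
qed

subsection \<open>The space of infinite words\<close>

lemma topspace_word [simp]: "topspace word_topology = UNIV"
  by (simp add: word_topology_def)

text \<open>A basic open set of the product constrains finitely many letters, hence only a prefix.
  The elementary openness proofs below use this form.\<close>

lemma openin_word_iff:
  "openin word_topology V \<longleftrightarrow> (\<forall>x\<in>V. \<exists>n. \<forall>y. prefix n y = prefix n x \<longrightarrow> y \<in> V)"
  unfolding word_topology_def openin_product_topology_alt
proof (intro iffI conjI ballI)
  fix x assume "\<forall>x\<in>V. \<exists>U. finite {i \<in> UNIV. U i \<noteq> topspace (discrete_topology UNIV)} \<and>
      (\<forall>i\<in>UNIV. openin (discrete_topology UNIV) (U i)) \<and> x \<in> Pi\<^sub>E UNIV U \<and> Pi\<^sub>E UNIV U \<subseteq> V"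
    and "x \<in> V"
  then obtain U where "finite {i \<in> UNIV. U i \<noteq> topspace (discrete_topology UNIV)}"
      and U: "x \<in> Pi\<^sub>E UNIV U" "Pi\<^sub>E UNIV U \<subseteq> V"
    by blast
  then have fin: "finite {i. U i \<noteq> UNIV}" by simp
  then obtain n where n: "\<forall>i\<in>{i. U i \<noteq> UNIV}. i < n"
    using fin finite_nat_set_iff_bounded[of "{i. U i \<noteq> UNIV}"] by blast
  have "y \<in> V" if "prefix n y = prefix n x" for y
  proof -
    have "y \<in> Pi\<^sub>E UNIV U"
    proof (rule PiE_I)
      fix i show "y i \<in> U i" using n U(1) that by (cases "U i = UNIV") (auto simp: prefix_eq_iff)
    qed auto
    then show ?thesis using U(2) by blast
  qed
  then show "\<exists>n. \<forall>y. prefix n y = prefix n x \<longrightarrow> y \<in> V" by blast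
next
  fix x assume R: "\<forall>x\<in>V. \<exists>n. \<forall>y. prefix n y = prefix n x \<longrightarrow> y \<in> V" and "x \<in> V"
  then obtain n where n: "\<And>y. prefix n y = prefix n x \<Longrightarrow> y \<in> V" by blast
  let ?U = "\<lambda>i. if i < n then {x i} else UNIV"
  have a: "finite {i \<in> UNIV. ?U i \<noteq> topspace (discrete_topology UNIV)}"
    by (rule finite_subset[of _ "{..<n}"]) (auto split: if_splits)
  have b: "Pi\<^sub>E UNIV ?U \<subseteq> V"
  proof
    fix y assume y: "y \<in> Pi\<^sub>E UNIV ?U"
    have "y i = x i" if "i < n" for i using PiE_mem[OF y, of i] that by simp
    then show "y \<in> V" by (intro n) (simp add: prefix_eq_iff)
  qed
  have c: "x \<in> Pi\<^sub>E UNIV ?U" by (simp add: PiE_iff)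
  have d: "\<forall>i\<in>UNIV. openin (discrete_topology UNIV) (?U i)" by simp
  show "\<exists>U. finite {i \<in> UNIV. U i \<noteq> topspace (discrete_topology UNIV)} \<and>
      (\<forall>i\<in>UNIV. openin (discrete_topology UNIV) (U i)) \<and> x \<in> Pi\<^sub>E UNIV U \<and> Pi\<^sub>E UNIV U \<subseteq> V"
    by (rule exI[of _ ?U]) (intro conjI a b c d)
qed

lemma compact_space_word: "compact_space (word_topology :: 'a::finite word topology)"
  unfolding word_topology_def
  by (simp add: compact_space_product_topology compact_space_discrete_topology)

lemma Hausdorff_space_word: "Hausdorff_space (word_topology :: 'a word topology)"
  unfolding word_topology_def
  by (simp add: Hausdorff_space_product_topology)

lemma openin_cyl: "openin word_topology (cyl u)"
  unfolding openin_word_iff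
  by (metis in_cyl_iff)

lemma openin_compl_cyl: "openin word_topology (- cyl u)"
  unfolding openin_word_iff
  by (metis in_cyl_iff Compl_iff)

lemma closedin_cyl: "closedin word_topology (cyl u)"
  unfolding closedin_def using openin_compl_cyl by (simp add: Compl_eq_Diff_UNIV)

lemma openin_nonempty_cyl:
  assumes "openin word_topology V" "\<xi> \<in> V"
  obtains n where "\<And>m. m \<ge> n \<Longrightarrow> cyl (prefix m \<xi>) \<subseteq> V"
proof -
  obtain n where n: "\<And>y. prefix n y = prefix n \<xi> \<Longrightarrow> y \<in> V"
    using assms unfolding openin_word_iff by blast
  show ?thesis
  proof (rule that)
    fix m :: nat assume "m \<ge> n"
    then show "cyl (prefix m \<xi>) \<subseteq> V"
      by (intro subsetI n) (simp add: in_cyl_iff prefix_eq_iff)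
  qed
qed

subsection \<open>Sections\<close>

context self_similar_action
begin

sublocale gr: group \<Gamma>
  using group_hom group_hom.axioms(1) by blast

abbreviation sect where
  "sect \<equiv> word_section \<Gamma> \<phi>"

abbreviation cmap where "cmap \<equiv> cylinder_map \<phi>"
abbreviation act where "act \<equiv> act_word \<phi>"

lemma phi_mult: "g \<in> carrier \<Gamma> \<Longrightarrow> h \<in> carrier \<Gamma> \<Longrightarrow> \<phi> (g \<otimes>\<^bsub>\<Gamma>\<^esub> h) w = \<phi> g (\<phi> h w)"
  by (rule composition_rule) auto

lemma phi_one [simp]: "\<phi> \<one>\<^bsub>\<Gamma>\<^esub> w = w"
  by (metis UNIV_I id_eq_one restrict_apply)

lemma phi_inv [simp]:
  assumes "g \<in> carrier \<Gamma>"
  shows "\<phi> (inv\<^bsub>\<Gamma>\<^esub> g) (\<phi> g w) = w" "\<phi> g (\<phi> (inv\<^bsub>\<Gamma>\<^esub> g) w) = w"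
  using assms by (simp_all flip: phi_mult)

lemma phi_eqI:
  assumes "g \<in> carrier \<Gamma>" "h \<in> carrier \<Gamma>" "\<And>w. \<phi> g w = \<phi> h w"
  shows "g = h"
  using faithful assms unfolding inj_on_def by blast

lemma phi_Nil [simp]: "g \<in> carrier \<Gamma> \<Longrightarrow> \<phi> g [] = []"
  using length_preserving[of g "[]"] by simp

text \<open>Faithfulness makes the element selected by \<open>THE\<close> unique: two candidates act
  alike on all words.\<close>

lemma letter_section:
  assumes "g \<in> carrier \<Gamma>"
  shows "letter_section \<Gamma> \<phi> g a \<in> carrier \<Gamma>"
    "\<exists>a'. \<forall>w. \<phi> g (a # w) = a' # \<phi> (letter_section \<Gamma> \<phi> g a) w"
proof -
  obtain a' h where h: "h \<in> carrier \<Gamma>" "\<And>w. \<phi> g (a # w) = a' # \<phi> h w"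
    using self_similar[OF assms] by metis
  have "letter_section \<Gamma> \<phi> g a \<in> carrier \<Gamma> \<and> (\<exists>a'. \<forall>w. \<phi> g (a # w) = a' # \<phi> (letter_section \<Gamma> \<phi> g a) w)"
    unfolding letter_section_def
  proof (rule theI)
    show "h \<in> carrier \<Gamma> \<and> (\<exists>a'. \<forall>w. \<phi> g (a # w) = a' # \<phi> h w)" using h by blast
    fix k assume "k \<in> carrier \<Gamma> \<and> (\<exists>a'. \<forall>w. \<phi> g (a # w) = a' # \<phi> k w)"
    then show "k = h" using h by (intro phi_eqI) auto
  qed
  then show "letter_section \<Gamma> \<phi> g a \<in> carrier \<Gamma>"
    "\<exists>a'. \<forall>w. \<phi> g (a # w) = a' # \<phi> (letter_section \<Gamma> \<phi> g a) w" by auto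
qed

lemma sect_closed [simp]: "g \<in> carrier \<Gamma> \<Longrightarrow> sect g u \<in> carrier \<Gamma>"
  unfolding word_section_def by (induction u arbitrary: g) (auto simp: letter_section)

lemma phi_append: "g \<in> carrier \<Gamma> \<Longrightarrow> \<phi> g (u @ w) = \<phi> g u @ \<phi> (sect g u) w"
proof (induction u arbitrary: g)
  case Nil then show ?case by (simp add: word_section_def)
next
  case (Cons a u)
  obtain a' where a': "\<And>w. \<phi> g (a # w) = a' # \<phi> (letter_section \<Gamma> \<phi> g a) w"
    using letter_section(2)[OF Cons.prems] by blast
  have "sect g (a # u) = sect (letter_section \<Gamma> \<phi> g a) u" by (simp add: word_section_def)
  then show ?case using a' Cons.IH[of "letter_section \<Gamma> \<phi> g a"] letter_section(1)[OF Cons.prems] by simp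
qed

lemma length_phi [simp]: "g \<in> carrier \<Gamma> \<Longrightarrow> length (\<phi> g w) = length w"
  by (rule length_preserving)

text \<open>\<open>act_word\<close> reads its letter \<open>n\<close> from the image of a prefix of
  length \<open>n + 1\<close>. These readings are consistent because images of longer prefixes
  extend images of shorter ones, by \<open>phi_append\<close>.\<close>

lemma prefix_act:
  assumes "g \<in> carrier \<Gamma>"
  shows "prefix n (act g \<xi>) = \<phi> g (prefix n \<xi>)"
proof (rule nth_equalityI)
  show "length (prefix n (act g \<xi>)) = length (\<phi> g (prefix n \<xi>))" using assms by simp
  fix i assume "i < length (prefix n (act g \<xi>))"
  then have i: "i < n" by simp
  have "prefix n \<xi> = prefix (Suc i) \<xi> @ \<xi> [Suc i \<rightarrow> n]"
    using subsequence_append[of \<xi> "Suc i" "n - Suc i"] i by simp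
  then have "\<phi> g (prefix n \<xi>) = \<phi> g (prefix (Suc i) \<xi>) @ \<phi> (sect g (prefix (Suc i) \<xi>)) (\<xi> [Suc i \<rightarrow> n])"
    using phi_append[OF assms] by metis
  then have "\<phi> g (prefix n \<xi>) ! i = \<phi> g (prefix (Suc i) \<xi>) ! i"
    using assms by (simp add: nth_append)
  then show "prefix n (act g \<xi>) ! i = \<phi> g (prefix n \<xi>) ! i"
    using i by (simp add: act_word_def)
qed

lemma act_conc:
  assumes "g \<in> carrier \<Gamma>"
  shows "act g (u \<frown> \<xi>) = \<phi> g u \<frown> act (sect g u) \<xi>"
proof (rule word_eq_prefixI)
  fix n
  \<comment> \<open>The first \<open>n\<close> letters may end inside \<open>u\<close>; the longer
    prefix avoids this case and is cut back afterwards.\<close>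
  have "prefix (length u + n) (act g (u \<frown> \<xi>)) = prefix (length u + n) (\<phi> g u \<frown> act (sect g u) \<xi>)"
    using assms by (simp add: prefix_act phi_append)
  then show "prefix n (act g (u \<frown> \<xi>)) = prefix n (\<phi> g u \<frown> act (sect g u) \<xi>)"
    by (rule prefix_mono_eq) simp
qed

lemma act_mult: "g \<in> carrier \<Gamma> \<Longrightarrow> h \<in> carrier \<Gamma> \<Longrightarrow> act (g \<otimes>\<^bsub>\<Gamma>\<^esub> h) \<xi> = act g (act h \<xi>)"
  by (rule word_eq_prefixI) (simp add: prefix_act phi_mult)

lemma act_one [simp]: "act \<one>\<^bsub>\<Gamma>\<^esub> \<xi> = \<xi>"
  by (rule word_eq_prefixI) (simp add: prefix_act)

lemma act_inv [simp]:
  assumes "g \<in> carrier \<Gamma>"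
  shows "act (inv\<^bsub>\<Gamma>\<^esub> g) (act g \<xi>) = \<xi>" "act g (act (inv\<^bsub>\<Gamma>\<^esub> g) \<xi>) = \<xi>"
  using assms by (simp_all flip: act_mult)

subsection \<open>The inverse semigroup\<close>

lemma cmap_conc [simp]: "cmap u g v (u \<frown> \<xi>) = Some (v \<frown> act g \<xi>)"
  by (simp add: cylinder_map_def)

lemma cmap_Nil [simp]: "cmap [] g v \<xi> = Some (v \<frown> act g \<xi>)"
  using cmap_conc[of "[]"] by simp

lemma cmap_eq_Some: "cmap u g v \<zeta> = Some \<eta> \<longleftrightarrow> (\<exists>\<xi>. \<zeta> = u \<frown> \<xi> \<and> \<eta> = v \<frown> act g \<xi>)"
  by (auto simp: cylinder_map_def)

lemma dom_cmap [simp]: "dom (cmap u g v) = cyl u"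
  by (auto simp: cylinder_map_def dom_def)

text \<open>Self-similarity for generators: having read \<open>w\<close>, the element
  \<open>g\<close> continues as its section, so shrinking the domain cylinder changes the triple but
  not the map on it.\<close>

lemma cmap_refine:
  assumes "g \<in> carrier \<Gamma>" "\<zeta> \<in> cyl (u @ w)"
  shows "cmap u g v \<zeta> = cmap (u @ w) (sect g w) (v @ \<phi> g w) \<zeta>"
proof -
  obtain \<xi> where "\<zeta> = (u @ w) \<frown> \<xi>" using assms by auto
  then show ?thesis using assms act_conc[of g w \<xi>]
    by (metis cmap_conc conc_conc)
qed

lemma Some_eq_cmap: "Some = cmap [] \<one>\<^bsub>\<Gamma>\<^esub> []"
  by (rule ext) simp

lemma ran_cmap:
  assumes g: "g \<in> carrier \<Gamma>"
  shows "ran (cmap u g v) = cyl v"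
proof (rule equalityI; rule subsetI)
  fix \<eta> assume "\<eta> \<in> cyl v"
  then obtain \<xi> where "\<eta> = v \<frown> \<xi>" by auto
  then have "cmap u g v (u \<frown> act (inv\<^bsub>\<Gamma>\<^esub> g) \<xi>) = Some \<eta>" using g by simp
  then show "\<eta> \<in> ran (cmap u g v)" unfolding ran_def by blast
qed (auto simp: ran_def cmap_eq_Some)

lemma act_inject: "g \<in> carrier \<Gamma> \<Longrightarrow> act g \<xi> = act g \<eta> \<longleftrightarrow> \<xi> = \<eta>"
  using act_inv(1) by metis

lemma cmap_inject:
  assumes "g \<in> carrier \<Gamma>" "cmap u g v \<xi> = Some \<zeta>" "cmap u g v \<eta> = Some \<zeta>"
  shows "\<xi> = \<eta>"
proof -
  obtain x y where "\<xi> = u \<frown> x" "\<zeta> = v \<frown> act g x" "\<eta> = u \<frown> y" "\<zeta> = v \<frown> act g y"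
    using assms by (auto simp: cmap_eq_Some)
  then show ?thesis using assms(1) by (simp add: act_inject)
qed

lemma partial_inverse_cmap:
  assumes "g \<in> carrier \<Gamma>"
  shows "partial_inverse (cmap u g v) = cmap v (inv\<^bsub>\<Gamma>\<^esub> g) u"
proof
  fix \<eta>
  show "partial_inverse (cmap u g v) \<eta> = cmap v (inv\<^bsub>\<Gamma>\<^esub> g) u \<eta>"
  proof (cases "\<eta> \<in> cyl v")
    case True
    then obtain \<xi> where \<eta>: "\<eta> = v \<frown> \<xi>" by auto
    have *: "cmap u g v (u \<frown> act (inv\<^bsub>\<Gamma>\<^esub> g) \<xi>) = Some \<eta>" using assms \<eta> by simp
    have "(THE x. cmap u g v x = Some \<eta>) = u \<frown> act (inv\<^bsub>\<Gamma>\<^esub> g) \<xi>"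
      by (rule the_equality, rule *) (rule cmap_inject[OF assms _ *])
    then show ?thesis using \<eta> True assms by (simp add: partial_inverse_def ran_cmap)
  next
    case False
    then show ?thesis using assms unfolding partial_inverse_def by (auto simp: ran_cmap cylinder_map_def)
  qed
qed

lemma partial_inverse_empty: "partial_inverse Map.empty = Map.empty"
  by (rule ext) (simp add: partial_inverse_def)

text \<open>The outer domain lies inside the inner range. The points sent into it are exactly those
  that start with \<open>u\<close> followed by the preimage of \<open>w\<close> under
  \<open>g\<close>.\<close>

lemma cmap_comp_shrink:
  assumes g: "g \<in> carrier \<Gamma>" and h: "h \<in> carrier \<Gamma>"
  shows "cmap (v @ w) h v' \<circ>\<^sub>m cmap u g v =
    cmap (u @ \<phi> (inv\<^bsub>\<Gamma>\<^esub> g) w) (h \<otimes>\<^bsub>\<Gamma>\<^esub> sect g (\<phi> (inv\<^bsub>\<Gamma>\<^esub> g) w)) v'"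
    (is "?L = cmap ?u ?k v'")
proof
  fix \<zeta>
  let ?w = "\<phi> (inv\<^bsub>\<Gamma>\<^esub> g) w"
  show "?L \<zeta> = cmap ?u ?k v' \<zeta>"
  proof (cases "\<zeta> \<in> cyl ?u")
    case True
    then obtain \<xi> where \<zeta>: "\<zeta> = ?u \<frown> \<xi>" by auto
    have "cmap u g v \<zeta> = cmap ?u (sect g ?w) (v @ \<phi> g ?w) \<zeta>"
      using cmap_refine[OF g True] .
    also have "\<dots> = Some ((v @ w) \<frown> act (sect g ?w) \<xi>)" using \<zeta> g by simp
    finally show ?thesis using \<zeta> g h by (simp add: map_comp_def act_mult)
  next
    case F: False
    have "cmap (v @ w) h v' \<eta> = None" if Some: "cmap u g v \<zeta> = Some \<eta>" for \<eta>
    proof (rule ccontr)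
      assume "cmap (v @ w) h v' \<eta> \<noteq> None"
      then have "\<eta> \<in> cyl (v @ w)" by (auto simp: cylinder_map_def split: if_splits)
      moreover obtain \<xi> where \<xi>: "\<zeta> = u \<frown> \<xi>" "\<eta> = v \<frown> act g \<xi>"
        using Some by (auto simp: cmap_eq_Some)
      ultimately have "act g \<xi> \<in> cyl w" by (simp only: cyl_append_iff)
      then have "\<phi> g (prefix (length w) \<xi>) = w" using g by (simp add: in_cyl_iff prefix_act)
      then have "\<xi> \<in> cyl ?w" using g phi_inv(1) by (metis in_cyl_iff length_phi gr.inv_closed)
      then have "\<zeta> \<in> cyl ?u" unfolding \<xi>(1) by (simp only: cyl_append_iff)
      then show False using F by simp
    qed
    moreover have "cmap ?u ?k v' \<zeta> = None" using F by (simp add: cylinder_map_def)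
    ultimately show ?thesis by (auto simp: map_comp_def split: option.split)
  qed
qed

text \<open>The opposite case: the inner range lies inside the outer domain, so the domain stays and
  the outer map contributes its section along \<open>w\<close>.\<close>

lemma cmap_comp_extend:
  assumes g: "g \<in> carrier \<Gamma>" and h: "h \<in> carrier \<Gamma>"
  shows "cmap u' h v' \<circ>\<^sub>m cmap u g (u' @ w) = cmap u (sect h w \<otimes>\<^bsub>\<Gamma>\<^esub> g) (v' @ \<phi> h w)"
proof
  fix \<zeta>
  show "(cmap u' h v' \<circ>\<^sub>m cmap u g (u' @ w)) \<zeta> = cmap u (sect h w \<otimes>\<^bsub>\<Gamma>\<^esub> g) (v' @ \<phi> h w) \<zeta>"
  proof (cases "\<zeta> \<in> cyl u")
    case True
    then obtain \<xi> where \<zeta>: "\<zeta> = u \<frown> \<xi>" by auto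
    have "cmap u' h v' ((u' @ w) \<frown> act g \<xi>) = Some ((v' @ \<phi> h w) \<frown> act (sect h w) (act g \<xi>))"
      using cmap_refine[OF h, of "(u' @ w) \<frown> act g \<xi>" u' w v'] by simp
    then show ?thesis using \<zeta> g h by (simp add: map_comp_def act_mult)
  next
    case False
    then show ?thesis by (auto simp: map_comp_def cylinder_map_def)
  qed
qed

lemma cmap_comp_empty:
  assumes "\<nexists>w. u' = v @ w" "\<nexists>w. v = u' @ w"
  shows "cmap u' h v' \<circ>\<^sub>m cmap u g v = Map.empty"
proof -
  have "cmap u' h v' \<eta> = None" if Some: "cmap u g v \<zeta> = Some \<eta>" for \<zeta> \<eta>
  proof (rule ccontr)
    assume "cmap u' h v' \<eta> \<noteq> None"
    then obtain \<theta> where 1: "\<eta> = u' \<frown> \<theta>" by (auto simp: cylinder_map_def split: if_splits)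
    obtain \<xi> where 2: "\<eta> = v \<frown> act g \<xi>" using Some by (auto simp: cmap_eq_Some)
    show False using cyl_comparable(1)[of u' \<theta> v "act g \<xi>"] cyl_comparable(1)[of v "act g \<xi>" u' \<theta>] 1 2 assms
      by (metis linear)
  qed
  then show ?thesis by (auto simp: map_comp_def fun_eq_iff split: option.split)
qed

abbreviation IS where "IS \<equiv> inverse_semigroup \<Gamma> \<phi>"

text \<open>Cylinders are nested or disjoint, so composing two generators gives a generator or the
  empty map. Hence every germ is represented by a triple \<open>u\<close>, \<open>g\<close>,
  \<open>v\<close>.\<close>

lemma IS_cases':
  "T \<in> IS \<Longrightarrow> T = Map.empty \<or> (\<exists>u g v. g \<in> carrier \<Gamma> \<and> T = cmap u g v)"
proof (induction rule: inverse_semigroup.induct)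
  case (generator g u v)
  then show ?case by blast
next
  case (composition T T')
  show ?case
  proof (cases "T = Map.empty \<or> T' = Map.empty")
    case True
    then have "T \<circ>\<^sub>m T' = Map.empty" by auto
    then show ?thesis by simp
  next
    case False
    with composition.IH obtain u g v u' h v' where T: "g \<in> carrier \<Gamma>" "h \<in> carrier \<Gamma>"
        "T' = cmap u g v" "T = cmap u' h v'"
      by (elim disjE exE conjE) simp_all
    consider w where "u' = v @ w" | w where "v = u' @ w" | "\<nexists>w. u' = v @ w" "\<nexists>w. v = u' @ w" by blast
    then show ?thesis
    proof cases
      case 1
      have "T \<circ>\<^sub>m T' = cmap (u @ \<phi> (inv\<^bsub>\<Gamma>\<^esub> g) w) (h \<otimes>\<^bsub>\<Gamma>\<^esub> sect g (\<phi> (inv\<^bsub>\<Gamma>\<^esub> g) w)) v'"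
        unfolding T 1 by (rule cmap_comp_shrink) (fact T)+
      moreover have "h \<otimes>\<^bsub>\<Gamma>\<^esub> sect g (\<phi> (inv\<^bsub>\<Gamma>\<^esub> g) w) \<in> carrier \<Gamma>" using T by simp
      ultimately show ?thesis by blast
    next
      case 2
      have "T \<circ>\<^sub>m T' = cmap u (sect h w \<otimes>\<^bsub>\<Gamma>\<^esub> g) (v' @ \<phi> h w)"
        unfolding T 2 by (rule cmap_comp_extend) (fact T)+
      moreover have "sect h w \<otimes>\<^bsub>\<Gamma>\<^esub> g \<in> carrier \<Gamma>" using T by simp
      ultimately show ?thesis by blast
    next
      case 3
      then have "T \<circ>\<^sub>m T' = Map.empty" unfolding T by (rule cmap_comp_empty)
      then show ?thesis by blast
    qed
  qed
next
  case (inversion T)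
  from inversion.IH show ?case
  proof
    assume "T = Map.empty" then show ?thesis by (simp add: partial_inverse_empty)
  next
    assume "\<exists>u g v. g \<in> carrier \<Gamma> \<and> T = cmap u g v"
    then obtain u g v where "g \<in> carrier \<Gamma>" "T = cmap u g v" by blast
    then have "partial_inverse T = cmap v (inv\<^bsub>\<Gamma>\<^esub> g) u" "inv\<^bsub>\<Gamma>\<^esub> g \<in> carrier \<Gamma>"
      by (auto simp: partial_inverse_cmap)
    then show ?thesis by blast
  qed
qed

lemma IS_cases:
  assumes "T \<in> IS" "\<xi> \<in> dom T"
  obtains u g v where "g \<in> carrier \<Gamma>" "T = cmap u g v"
  using IS_cases'[OF assms(1)] assms(2) by auto

lemma IS_inject: "T \<in> IS \<Longrightarrow> T \<xi> = Some \<zeta> \<Longrightarrow> T \<eta> = Some \<zeta> \<Longrightarrow> \<xi> = \<eta>"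
  by (metis IS_cases cmap_inject domI)

lemma Some_IS [simp]: "Some \<in> IS"
  using inverse_semigroup.generator[of "\<one>\<^bsub>\<Gamma>\<^esub>" \<Gamma> \<phi> "[]" "[]"] by (simp flip: Some_eq_cmap)

lemma openin_dom_IS: "T \<in> IS \<Longrightarrow> openin word_topology (dom T)"
  using IS_cases' openin_cyl by fastforce

lemma partial_inverse_IS:
  assumes "T \<in> IS"
  shows "partial_inverse T \<eta> = Some \<xi> \<longleftrightarrow> T \<xi> = Some \<eta>"
proof
  assume L: "partial_inverse T \<eta> = Some \<xi>"
  then have "\<eta> \<in> ran T" "\<xi> = (THE x. T x = Some \<eta>)" by (auto simp: partial_inverse_def split: if_splits)
  then obtain x where x: "T x = Some \<eta>" by (auto simp: ran_def)
  have "(THE x. T x = Some \<eta>) = x" by (rule the_equality, rule x) (rule IS_inject[OF assms _ x])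
  then show "T \<xi> = Some \<eta>" using x \<open>\<xi> = _\<close> by simp
next
  assume R: "T \<xi> = Some \<eta>"
  have "(THE x. T x = Some \<eta>) = \<xi>" by (rule the_equality, rule R) (rule IS_inject[OF assms _ R])
  then show "partial_inverse T \<eta> = Some \<xi>" using R by (auto simp: partial_inverse_def ran_def)
qed

lemma IS_continuous:
  assumes "T \<in> IS" "openin word_topology V"
  shows "openin word_topology {\<xi>. \<exists>\<eta>\<in>V. T \<xi> = Some \<eta>}"
  unfolding openin_word_iff
proof
  fix \<xi> assume "\<xi> \<in> {\<xi>. \<exists>\<eta>\<in>V. T \<xi> = Some \<eta>}"
  then obtain \<eta> where \<eta>: "\<eta> \<in> V" "T \<xi> = Some \<eta>" by blast
  obtain u g v where g: "g \<in> carrier \<Gamma>" and T: "T = cmap u g v" using IS_cases assms(1) \<eta>(2) by blast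
  obtain n where n: "\<And>y. prefix n y = prefix n \<eta> \<Longrightarrow> y \<in> V" using assms(2) \<eta>(1) unfolding openin_word_iff by blast
  obtain \<zeta> where \<zeta>: "\<xi> = u \<frown> \<zeta>" "\<eta> = v \<frown> act g \<zeta>" using \<eta>(2) T by (auto simp: cmap_eq_Some)
  show "\<exists>n. \<forall>y. prefix n y = prefix n \<xi> \<longrightarrow> y \<in> {\<xi>. \<exists>\<eta>\<in>V. T \<xi> = Some \<eta>}"
  proof (intro exI allI impI)
    \<comment> \<open>The first \<open>length u\<close> letters keep \<open>y\<close> in the domain,
      the next \<open>n\<close> fix the first \<open>n\<close> letters after \<open>v\<close> in its
      image.\<close>
    fix y assume y: "prefix (length u + n) y = prefix (length u + n) \<xi>"
    then have "prefix (length u) y = prefix (length u) \<xi>" by (rule prefix_mono_eq) simp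
    then have "y \<in> cyl u" using \<zeta> by (simp add: in_cyl_iff)
    then obtain z where z: "y = u \<frown> z" by auto
    have "prefix n z = prefix n \<zeta>" using y \<zeta> z by simp
    then have "prefix (length v + n) (v \<frown> act g z) = prefix (length v + n) \<eta>"
      using g \<zeta> by (simp add: prefix_act)
    then have "prefix n (v \<frown> act g z) = prefix n \<eta>" by (rule prefix_mono_eq) simp
    then show "y \<in> {\<xi>. \<exists>\<eta>\<in>V. T \<xi> = Some \<eta>}" using n z T by auto
  qed
qed

lemma IS_open_image:
  assumes "T \<in> IS" "openin word_topology V"
  shows "openin word_topology {\<eta>. \<exists>\<xi>\<in>V. T \<xi> = Some \<eta>}"
  using IS_continuous[OF inverse_semigroup.inversion[OF assms(1)] assms(2)]
  by (simp add: partial_inverse_IS assms(1))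


subsection \<open>Germs\<close>

abbreviation G where "G \<equiv> germ_groupoid \<Gamma> \<phi>"
abbreviation gm where "gm \<equiv> germ \<Gamma> \<phi>"
abbreviation arr where "arr \<equiv> topspace (arrows G)"

text \<open>The germ relation freed from membership in the semigroup and in the domains, so that it
  makes sense for arbitrary partial maps. Equality of option values includes definedness.\<close>

definition near :: "'a word \<Rightarrow> ('a word \<rightharpoonup> 'a word) \<Rightarrow> ('a word \<rightharpoonup> 'a word) \<Rightarrow> bool" where
  "near \<xi> T T' \<longleftrightarrow> (\<exists>V. openin word_topology V \<and> \<xi> \<in> V \<and> (\<forall>\<eta>\<in>V. T \<eta> = T' \<eta>))"

lemma near_refl [simp]: "near \<xi> T T"
  unfolding near_def using openin_topspace[of word_topology] by auto

lemma near_sym: "near \<xi> T T' \<Longrightarrow> near \<xi> T' T"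
  unfolding near_def by metis

lemma near_trans: "near \<xi> T T' \<Longrightarrow> near \<xi> T' T'' \<Longrightarrow> near \<xi> T T''"
proof -
  assume "near \<xi> T T'" "near \<xi> T' T''"
  then obtain V V' where "openin word_topology V" "\<xi> \<in> V" "\<forall>\<eta>\<in>V. T \<eta> = T' \<eta>"
     "openin word_topology V'" "\<xi> \<in> V'" "\<forall>\<eta>\<in>V'. T' \<eta> = T'' \<eta>"
    unfolding near_def by blast
  then show ?thesis unfolding near_def by (intro exI[of _ "V \<inter> V'"]) auto
qed

lemma near_eq: "near \<xi> T T' \<Longrightarrow> T \<xi> = T' \<xi>"
  unfolding near_def by blast

lemma openin_near: "openin word_topology {\<xi>. near \<xi> T T'}"
proof (subst openin_subopen, intro ballI)
  fix \<xi> assume "\<xi> \<in> {\<xi>. near \<xi> T T'}"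
  then obtain V where "openin word_topology V" "\<xi> \<in> V" "\<forall>\<eta>\<in>V. T \<eta> = T' \<eta>"
    unfolding near_def by blast
  then show "\<exists>V. openin word_topology V \<and> \<xi> \<in> V \<and> V \<subseteq> {\<xi>. near \<xi> T T'}"
    unfolding near_def by blast
qed

lemma near_comp_left: "near \<xi> T T' \<Longrightarrow> near \<xi> (S \<circ>\<^sub>m T) (S \<circ>\<^sub>m T')"
  unfolding near_def map_comp_def by metis

lemma near_comp_right:
  assumes "T \<in> IS" "T \<xi> = Some \<eta>" "near \<eta> S S'"
  shows "near \<xi> (S \<circ>\<^sub>m T) (S' \<circ>\<^sub>m T)"
proof -
  obtain V where V: "openin word_topology V" "\<eta> \<in> V" "\<forall>\<eta>\<in>V. S \<eta> = S' \<eta>"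
    using assms(3) unfolding near_def by blast
  show ?thesis unfolding near_def
    by (intro exI[of _ "{\<xi>. \<exists>\<eta>\<in>V. T \<xi> = Some \<eta>}"] conjI IS_continuous assms(1) V(1))
      (use V assms in \<open>auto simp: map_comp_def\<close>)
qed

lemma near_Some_inverse:
  assumes "T \<in> IS" "T \<xi> = Some \<eta>"
  shows "near \<xi> (partial_inverse T \<circ>\<^sub>m T) Some" "near \<eta> (T \<circ>\<^sub>m partial_inverse T) Some"
proof -
  have "(partial_inverse T \<circ>\<^sub>m T) x = Some x" if "T x = Some y" for x y
    using that assms(1) by (simp add: map_comp_def partial_inverse_IS)
  then show "near \<xi> (partial_inverse T \<circ>\<^sub>m T) Some"
    unfolding near_def using openin_dom_IS[OF assms(1)] assms(2) by (intro exI[of _ "dom T"]) auto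
  have "(T \<circ>\<^sub>m partial_inverse T) y = Some y" if "partial_inverse T y = Some x" for x y
    using that partial_inverse_IS[OF assms(1), THEN iffD1, OF that] by (simp add: map_comp_def)
  moreover have "\<eta> \<in> dom (partial_inverse T)"
    using assms partial_inverse_IS[OF assms(1)] by blast
  ultimately show "near \<eta> (T \<circ>\<^sub>m partial_inverse T) Some"
    unfolding near_def using openin_dom_IS[OF inverse_semigroup.inversion[OF assms(1)]]
    by (intro exI[of _ "dom (partial_inverse T)"]) auto
qed

lemma map_comp_assoc: "(R \<circ>\<^sub>m S) \<circ>\<^sub>m T = R \<circ>\<^sub>m (S \<circ>\<^sub>m T)"
  by (auto simp: map_comp_def fun_eq_iff split: option.split)

lemma map_comp_Some [simp]: "T \<circ>\<^sub>m Some = T" "Some \<circ>\<^sub>m T = T"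
  by (auto simp: map_comp_def fun_eq_iff split: option.split)

text \<open>The partial inverse of \<open>S\<close> removes \<open>S\<close> on the left. That
  \<open>T'\<close> has the same image \<eta> at \<xi> is not assumed: the composites agree at
  \<xi>, and \<open>S\<close> is injective.\<close>

lemma near_cancel_left:
  assumes "S \<in> IS" "T \<in> IS" "T' \<in> IS" "T \<xi> = Some \<eta>" "\<eta> \<in> dom S" "near \<xi> (S \<circ>\<^sub>m T) (S \<circ>\<^sub>m T')"
  shows "near \<xi> T T'"
proof -
  obtain \<zeta> where \<zeta>: "S \<eta> = Some \<zeta>" using assms(5) by blast
  have "(S \<circ>\<^sub>m T) \<xi> = Some \<zeta>" using \<zeta> assms(4) by simp
  then have "(S \<circ>\<^sub>m T') \<xi> = Some \<zeta>" using near_eq[OF assms(6)] by simp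
  then obtain \<eta>' where \<eta>': "T' \<xi> = Some \<eta>'" "S \<eta>' = Some \<zeta>" by (auto simp: map_comp_def split: option.splits)
  then have "\<eta>' = \<eta>" using IS_inject[OF assms(1) _ \<zeta>] by blast
  have "near \<xi> (partial_inverse S \<circ>\<^sub>m (S \<circ>\<^sub>m T)) (partial_inverse S \<circ>\<^sub>m (S \<circ>\<^sub>m T'))"
    by (rule near_comp_left) (rule assms)
  then have *: "near \<xi> ((partial_inverse S \<circ>\<^sub>m S) \<circ>\<^sub>m T) ((partial_inverse S \<circ>\<^sub>m S) \<circ>\<^sub>m T')"
    by (simp only: map_comp_assoc)
  have "near \<xi> ((partial_inverse S \<circ>\<^sub>m S) \<circ>\<^sub>m T) (Some \<circ>\<^sub>m T)"
    by (rule near_comp_right[OF assms(2,4)]) (rule near_Some_inverse[OF assms(1) \<zeta>])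
  moreover have "near \<xi> ((partial_inverse S \<circ>\<^sub>m S) \<circ>\<^sub>m T') (Some \<circ>\<^sub>m T')"
    by (rule near_comp_right[OF assms(3) \<eta>'(1)], unfold \<open>\<eta>' = \<eta>\<close>) (rule near_Some_inverse[OF assms(1) \<zeta>])
  ultimately show ?thesis using * near_sym near_trans map_comp_Some(2) by metis
qed

lemma near_cancel_right:
  assumes "T \<in> IS" "T \<xi> = Some \<eta>" "near \<xi> (S \<circ>\<^sub>m T) (S' \<circ>\<^sub>m T)"
  shows "near \<eta> S S'"
proof -
  have inv: "partial_inverse T \<in> IS" by (rule inverse_semigroup.inversion[OF assms(1)])
  have "partial_inverse T \<eta> = Some \<xi>" using assms partial_inverse_IS by blast
  then have "near \<eta> ((S \<circ>\<^sub>m T) \<circ>\<^sub>m partial_inverse T) ((S' \<circ>\<^sub>m T) \<circ>\<^sub>m partial_inverse T)"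
    by (rule near_comp_right[OF inv]) (rule assms)
  then have "near \<eta> (S \<circ>\<^sub>m (T \<circ>\<^sub>m partial_inverse T)) (S' \<circ>\<^sub>m (T \<circ>\<^sub>m partial_inverse T))"
    by (simp only: map_comp_assoc)
  moreover have "near \<eta> (R \<circ>\<^sub>m (T \<circ>\<^sub>m partial_inverse T)) R" for R
    using near_comp_left[OF near_Some_inverse(2)[OF assms(1,2)], of R] by simp
  ultimately show ?thesis using near_sym near_trans by metis
qed

lemma comp_IS [simp]: "S \<in> IS \<Longrightarrow> T \<in> IS \<Longrightarrow> S \<circ>\<^sub>m T \<in> IS"
  by (rule inverse_semigroup.composition)

lemma inv_IS [simp]: "T \<in> IS \<Longrightarrow> partial_inverse T \<in> IS"
  by (rule inverse_semigroup.inversion)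

lemma dom_comp: "T \<xi> = Some \<eta> \<Longrightarrow> \<eta> \<in> dom S \<Longrightarrow> \<xi> \<in> dom (S \<circ>\<^sub>m T)"
  by (auto simp: map_comp_def)

lemma germ_mem_iff:
  "(T', \<xi>') \<in> gm T \<xi> \<longleftrightarrow> T \<in> IS \<and> T' \<in> IS \<and> \<xi> \<in> dom T \<and> \<xi> \<in> dom T' \<and> \<xi>' = \<xi> \<and> near \<xi> T T'"
  unfolding germ_def germ_relation_def pointed_maps_def near_def by auto

lemma germ_eq_iff:
  assumes "T \<in> IS" "\<xi> \<in> dom T" "T' \<in> IS" "\<xi>' \<in> dom T'"
  shows "gm T \<xi> = gm T' \<xi>' \<longleftrightarrow> \<xi> = \<xi>' \<and> near \<xi> T T'"
proof
  assume "gm T \<xi> = gm T' \<xi>'"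
  moreover have "(T', \<xi>') \<in> gm T' \<xi>'" using assms by (simp add: germ_mem_iff)
  ultimately have "(T', \<xi>') \<in> gm T \<xi>" by simp
  then show "\<xi> = \<xi>' \<and> near \<xi> T T'" by (simp add: germ_mem_iff)
next
  assume "\<xi> = \<xi>' \<and> near \<xi> T T'"
  then have "(S, \<zeta>) \<in> gm T \<xi> \<longleftrightarrow> (S, \<zeta>) \<in> gm T' \<xi>'" for S \<zeta>
    using assms unfolding germ_mem_iff by (metis near_sym near_trans)
  then show "gm T \<xi> = gm T' \<xi>'" by auto
qed

lemma src_germ [simp]: "T \<in> IS \<Longrightarrow> \<xi> \<in> dom T \<Longrightarrow> src G (gm T \<xi>) = \<xi>"
  unfolding germ_groupoid_def by (auto simp: germ_mem_iff intro!: the_equality exI[of _ T])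

lemma src_germ_Some [simp]: "T \<in> IS \<Longrightarrow> T \<xi> = Some \<eta> \<Longrightarrow> src G (gm T \<xi>) = \<xi>"
  by (rule src_germ) auto

lemma rng_germ [simp]:
  assumes "T \<in> IS" "T \<xi> = Some \<eta>"
  shows "rng G (gm T \<xi>) = \<eta>"
proof -
  have "(THE \<eta>. \<exists>T' \<xi>'. (T', \<xi>') \<in> gm T \<xi> \<and> T' \<xi>' = Some \<eta>) = \<eta>"
  proof (rule the_equality)
    show "\<exists>T' \<xi>'. (T', \<xi>') \<in> gm T \<xi> \<and> T' \<xi>' = Some \<eta>"
      using assms by (intro exI[of _ T] exI[of _ \<xi>]) (auto simp: germ_mem_iff)
    fix \<zeta> assume "\<exists>T' \<xi>'. (T', \<xi>') \<in> gm T \<xi> \<and> T' \<xi>' = Some \<zeta>"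
    then show "\<zeta> = \<eta>" using assms near_eq by (fastforce simp: germ_mem_iff)
  qed
  then show ?thesis by (simp add: germ_groupoid_def)
qed

definition bisec :: "('a word \<rightharpoonup> 'a word) \<Rightarrow> 'a germ set" where
  "bisec T = gm T ` dom T"

lemma arr_eq: "arr = {gm T \<xi> | T \<xi>. T \<in> IS \<and> \<xi> \<in> dom T}"
proof -
  have "arr = \<Union>{{gm T \<xi> | \<xi>. \<xi> \<in> V} | T V. T \<in> IS \<and> openin word_topology V \<and> V \<subseteq> dom T}"
    by (simp add: germ_groupoid_def topology_generated_by_topspace)
  also have "\<dots> = {gm T \<xi> | T \<xi>. T \<in> IS \<and> \<xi> \<in> dom T}" (is "?A = ?B")
  proof (intro subset_antisym subsetI)
    fix x assume "x \<in> ?B"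
    then obtain T \<xi> where "x = gm T \<xi>" "T \<in> IS" "\<xi> \<in> dom T" by blast
    then have "x \<in> {gm T \<xi> | \<xi>. \<xi> \<in> dom T}" "openin word_topology (dom T)"
      using openin_dom_IS by auto
    then show "x \<in> ?A" using \<open>T \<in> IS\<close> by blast
  qed blast
  finally show ?thesis .
qed

lemma germ_arr [simp]: "T \<in> IS \<Longrightarrow> \<xi> \<in> dom T \<Longrightarrow> gm T \<xi> \<in> arr"
  unfolding arr_eq by blast

lemma germ_arr_Some [simp]: "T \<in> IS \<Longrightarrow> T \<xi> = Some \<eta> \<Longrightarrow> gm T \<xi> \<in> arr"
  by (rule germ_arr) auto

lemma arrE:
  assumes "\<gamma> \<in> arr"
  obtains T \<xi> \<eta> where "T \<in> IS" "T \<xi> = Some \<eta>" "\<gamma> = gm T \<xi>" "src G \<gamma> = \<xi>" "rng G \<gamma> = \<eta>"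
proof -
  obtain T \<xi> where T: "T \<in> IS" "\<xi> \<in> dom T" "\<gamma> = gm T \<xi>" using assms unfolding arr_eq by blast
  then obtain \<eta> where "T \<xi> = Some \<eta>" by blast
  then show ?thesis using that[of T \<xi> \<eta>] T by simp
qed

lemma cmap_IS [simp]: "g \<in> carrier \<Gamma> \<Longrightarrow> cmap u g v \<in> IS"
  by (rule inverse_semigroup.generator)

lemma arr_cmapE:
  assumes "\<gamma> \<in> arr"
  obtains u g v \<xi> where "g \<in> carrier \<Gamma>" "\<gamma> = gm (cmap u g v) (u \<frown> \<xi>)"
proof -
  obtain T \<xi> \<eta> where T: "T \<in> IS" "T \<xi> = Some \<eta>" "\<gamma> = gm T \<xi>" using assms by (rule arrE)
  then obtain u g v where "g \<in> carrier \<Gamma>" "T = cmap u g v" using IS_cases[OF T(1) domI[of T]] by metis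
  then show ?thesis using that T by (auto simp: cmap_eq_Some)
qed

lemma bisec_subset: "T \<in> IS \<Longrightarrow> bisec T \<subseteq> arr"
  unfolding bisec_def by auto

lemma germ_in_bisec:
  assumes "T \<in> IS" "\<xi> \<in> dom T" "S \<in> IS"
  shows "gm T \<xi> \<in> bisec S \<longleftrightarrow> \<xi> \<in> dom S \<and> near \<xi> T S"
  unfolding bisec_def using germ_eq_iff[OF assms(1,2) assms(3)] by blast

lemma near_dom: "near \<xi> T S \<Longrightarrow> \<xi> \<in> dom T \<longleftrightarrow> \<xi> \<in> dom S"
  by (simp add: near_eq domIff)

subsection \<open>Topology of the arrow space\<close>

text \<open>The generating sets are images of open sets of words under the sections sending \<xi> to
  \<open>gm T \<xi>\<close>. Two sections overlap over the open set where the maps are near each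
  other, so the generated topology is the final one for these sections, and openness of arrows
  reduces to openness of words.\<close>

lemma openin_arrows_iff:
  "openin (arrows G) U \<longleftrightarrow> U \<subseteq> arr \<and> (\<forall>T\<in>IS. openin word_topology {\<xi> \<in> dom T. gm T \<xi> \<in> U})"
proof (intro iffI conjI ballI)
  assume "openin (arrows G) U"
  then show "U \<subseteq> arr" by (rule openin_subset)
next
  let ?B = "{{gm T \<xi> | \<xi>. \<xi> \<in> V} | T V. T \<in> IS \<and> openin word_topology V \<and> V \<subseteq> dom T}"
  fix T assume T: "T \<in> IS" and "openin (arrows G) U"
  then have "generate_topology_on ?B U"
    by (simp add: germ_groupoid_def openin_topology_generated_by_iff)
  then show "openin word_topology {\<xi> \<in> dom T. gm T \<xi> \<in> U}"
  proof induction
    case Empty then show ?case by simp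
  next
    case (Int a b)
    have "{\<xi> \<in> dom T. gm T \<xi> \<in> a \<inter> b} = {\<xi> \<in> dom T. gm T \<xi> \<in> a} \<inter> {\<xi> \<in> dom T. gm T \<xi> \<in> b}" by auto
    then show ?case using Int.IH by (simp only: openin_Int)
  next
    case (UN K)
    have "{\<xi> \<in> dom T. gm T \<xi> \<in> \<Union>K} = (\<Union>k\<in>K. {\<xi> \<in> dom T. gm T \<xi> \<in> k})" by auto
    then show ?case using UN.IH by auto
  next
    case (Basis s)
    then obtain S V where S: "s = {gm S \<xi> | \<xi>. \<xi> \<in> V}" "S \<in> IS" "openin word_topology V" "V \<subseteq> dom S" by blast
    have "{\<xi> \<in> dom T. gm T \<xi> \<in> s} = dom T \<inter> V \<inter> {\<xi>. near \<xi> T S}"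
    proof (rule Set.set_eqI)
      fix \<xi> show "\<xi> \<in> {\<xi> \<in> dom T. gm T \<xi> \<in> s} \<longleftrightarrow> \<xi> \<in> dom T \<inter> V \<inter> {\<xi>. near \<xi> T S}"
        unfolding S(1) using germ_eq_iff[OF T _ S(2), of \<xi>] S(4) by blast
    qed
    then show ?case using openin_near openin_dom_IS[OF T] S(3) by auto
  qed
next
  assume R: "U \<subseteq> arr \<and> (\<forall>T\<in>IS. openin word_topology {\<xi> \<in> dom T. gm T \<xi> \<in> U})"
  let ?B = "{{gm T \<xi> | \<xi>. \<xi> \<in> V} | T V. T \<in> IS \<and> openin word_topology V \<and> V \<subseteq> dom T}"
  let ?W = "\<lambda>T. {gm T \<xi> | \<xi>. \<xi> \<in> {\<xi> \<in> dom T. gm T \<xi> \<in> U}}"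
  have "U = (\<Union>T\<in>IS. ?W T)" using R unfolding arr_eq by blast
  moreover have "openin (arrows G) (?W T)" if "T \<in> IS" for T
  proof -
    have "?W T \<in> ?B" using that R by blast
    then show ?thesis unfolding germ_groupoid_def by (auto intro!: topology_generated_by_Basis)
  qed
  ultimately show "openin (arrows G) U" by (metis (no_types, lifting) openin_clauses(3) imageE)
qed

lemma objects_G [simp]: "objects G = word_topology"
  by (simp add: germ_groupoid_def)

lemma openin_bisec_restrict:
  assumes "T \<in> IS" "openin word_topology V"
  shows "openin (arrows G) (gm T ` (V \<inter> dom T))"
  unfolding openin_arrows_iff
proof (intro conjI ballI)
  show "gm T ` (V \<inter> dom T) \<subseteq> arr" using assms by auto
  fix S assume S: "S \<in> IS"
  have "{\<xi> \<in> dom S. gm S \<xi> \<in> gm T ` (V \<inter> dom T)} = dom S \<inter> V \<inter> dom T \<inter> {\<xi>. near \<xi> S T}"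
    using germ_eq_iff[OF S _ assms(1)] by blast
  then show "openin word_topology {\<xi> \<in> dom S. gm S \<xi> \<in> gm T ` (V \<inter> dom T)}"
    using openin_near openin_dom_IS S assms by (auto intro!: openin_Int)
qed

lemma openin_bisec: "T \<in> IS \<Longrightarrow> openin (arrows G) (bisec T)"
  using openin_bisec_restrict[of T UNIV] openin_topspace[of word_topology] by (simp add: bisec_def)

lemma continuous_src: "continuous_map (arrows G) word_topology (src G)"
  unfolding continuous_map
proof (intro conjI allI impI)
  fix V :: "'a word set" assume V: "openin word_topology V"
  show "openin (arrows G) {\<gamma> \<in> arr. src G \<gamma> \<in> V}"
    unfolding openin_arrows_iff
  proof (intro conjI ballI)
    fix T assume T: "T \<in> IS"
    then have "{\<xi> \<in> dom T. gm T \<xi> \<in> {\<gamma> \<in> arr. src G \<gamma> \<in> V}} = dom T \<inter> V" by auto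
    then show "openin word_topology {\<xi> \<in> dom T. gm T \<xi> \<in> {\<gamma> \<in> arr. src G \<gamma> \<in> V}}"
      using V openin_dom_IS[OF T] by auto
  qed auto
qed simp

lemma continuous_rng: "continuous_map (arrows G) word_topology (rng G)"
  unfolding continuous_map
proof (intro conjI allI impI)
  fix V :: "'a word set" assume V: "openin word_topology V"
  show "openin (arrows G) {\<gamma> \<in> arr. rng G \<gamma> \<in> V}"
    unfolding openin_arrows_iff
  proof (intro conjI ballI)
    fix T assume T: "T \<in> IS"
    then have "{\<xi> \<in> dom T. gm T \<xi> \<in> {\<gamma> \<in> arr. rng G \<gamma> \<in> V}} = {\<xi>. \<exists>\<eta>\<in>V. T \<xi> = Some \<eta>}" by auto
    then show "openin word_topology {\<xi> \<in> dom T. gm T \<xi> \<in> {\<gamma> \<in> arr. rng G \<gamma> \<in> V}}"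
      using IS_continuous[OF T V] by simp
  qed auto
qed simp

lemma open_src: 
  assumes "openin (arrows G) U"
  shows "openin word_topology (src G ` U)"
proof -
  have "src G ` U = (\<Union>T\<in>IS. {\<xi> \<in> dom T. gm T \<xi> \<in> U})" (is "_ = ?R")
  proof (intro subset_antisym subsetI)
    fix x assume "x \<in> src G ` U"
    then obtain \<gamma> where \<gamma>: "\<gamma> \<in> U" "x = src G \<gamma>" by blast
    then have "\<gamma> \<in> arr" using assms openin_subset by blast
    then show "x \<in> ?R" using \<gamma> by (elim arrE) auto
  next
    fix x assume "x \<in> ?R"
    then obtain T where "T \<in> IS" "x \<in> dom T" "gm T x \<in> U" by blast
    then show "x \<in> src G ` U" by (intro image_eqI[of _ _ "gm T x"]) simp_all
  qed
  then show ?thesis using assms unfolding openin_arrows_iff by auto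
qed

lemma open_rng: 
  assumes "openin (arrows G) U"
  shows "openin word_topology (rng G ` U)"
proof -
  have "rng G ` U = (\<Union>T\<in>IS. {\<eta>. \<exists>\<xi>\<in>{\<xi> \<in> dom T. gm T \<xi> \<in> U}. T \<xi> = Some \<eta>})" (is "_ = ?R")
  proof (intro subset_antisym subsetI)
    fix x assume "x \<in> rng G ` U"
    then obtain \<gamma> where \<gamma>: "\<gamma> \<in> U" "x = rng G \<gamma>" by blast
    then have "\<gamma> \<in> arr" using assms openin_subset by blast
    then show "x \<in> ?R" using \<gamma> by (elim arrE) auto
  next
    fix x assume "x \<in> ?R"
    then obtain T \<xi> where "T \<in> IS" "T \<xi> = Some x" "gm T \<xi> \<in> U" by blast
    then show "x \<in> rng G ` U" by (intro image_eqI[of _ _ "gm T \<xi>"]) simp_all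
  qed
  moreover have "openin word_topology ?R"
    by (rule openin_Union, elim imageE, simp only:, rule IS_open_image)
      (use assms in \<open>auto simp: openin_arrows_iff\<close>)
  ultimately show ?thesis by (simp only:)
qed

lemma homeomorphic_map_restrict:
  assumes "continuous_map X Y f" "openin X U" "inj_on f U"
    and "\<And>W. openin X W \<Longrightarrow> openin Y (f ` W)"
  shows "homeomorphic_map (subtopology X U) (subtopology Y (f ` U)) f"
proof (rule bijective_open_imp_homeomorphic_map)
  have U: "U \<subseteq> topspace X" "f ` U \<subseteq> topspace Y"
    using assms(2,4) openin_subset by blast+
  show "continuous_map (subtopology X U) (subtopology Y (f ` U)) f"
    using assms(1) by (auto simp: continuous_map_in_subtopology continuous_map_from_subtopology)
  show "open_map (subtopology X U) (subtopology Y (f ` U)) f"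
    unfolding open_map_def
  proof (intro allI impI)
    fix W assume "openin (subtopology X U) W"
    then have "openin X W" "W \<subseteq> U" using assms(2) by (auto simp: openin_open_subtopology)
    then show "openin (subtopology Y (f ` U)) (f ` W)"
      using assms(4)[OF \<open>openin X W\<close>] assms(4)[OF assms(2)] by (auto simp: openin_open_subtopology)
  qed
  show "f ` topspace (subtopology X U) = topspace (subtopology Y (f ` U))" using U by (auto simp: Int_absorb1)
  show "inj_on f (topspace (subtopology X U))" using assms(3) by (rule inj_on_subset) auto
qed

lemma open_bisection_bisec:
  assumes "T \<in> IS"
  shows "open_bisection G (bisec T)"
  unfolding open_bisection_def objects_G
proof (intro conjI openin_bisec assms homeomorphic_map_restrict continuous_rng continuous_src open_rng open_src)
  show "inj_on (src G) (bisec T)" using assms by (auto simp: inj_on_def bisec_def)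
  show "inj_on (rng G) (bisec T)"
  proof (rule inj_onI)
    fix x y assume xy: "x \<in> bisec T" "y \<in> bisec T" "rng G x = rng G y"
    then obtain \<xi> \<eta> \<xi>' \<eta>' where "x = gm T \<xi>" "T \<xi> = Some \<xi>'" "y = gm T \<eta>" "T \<eta> = Some \<eta>'"
      unfolding bisec_def by blast
    then show "x = y" using xy(3) assms IS_inject[OF assms, of \<xi> \<xi>' \<eta>] by simp
  qed
qed

text \<open>The section of the generator is continuous and maps the compact cylinder onto the
  bisection; no separation property of the arrow space enters.\<close>

lemma compactin_bisec:
  assumes "g \<in> carrier \<Gamma>"
  shows "compactin (arrows G) (bisec (cmap u g v))"
proof -
  let ?T = "cmap u g v" and ?X = "subtopology word_topology (cyl u) :: 'a word topology"
  have T: "?T \<in> IS" using assms by simp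
  have "compactin word_topology (cyl u)"
    by (rule closedin_compact_space[OF compact_space_word closedin_cyl])
  then have "compactin ?X (cyl u)" by (simp add: compactin_subtopology)
  moreover have "continuous_map ?X (arrows G) (gm ?T)"
    unfolding continuous_map
  proof (intro conjI allI impI)
    show "gm ?T ` topspace ?X \<subseteq> arr" using T by auto
    fix U assume "openin (arrows G) U"
    then have "openin word_topology {\<xi> \<in> dom ?T. gm ?T \<xi> \<in> U}" using T unfolding openin_arrows_iff by blast
    then show "openin ?X {x \<in> topspace ?X. gm ?T x \<in> U}"
      by (auto simp: openin_open_subtopology openin_cyl)
  qed
  ultimately have "compactin (arrows G) (gm ?T ` cyl u)" by (rule image_compactin)
  then show ?thesis by (simp add: bisec_def)
qed

subsection \<open>Products\<close>

text \<open>Replacing either representative by a near one changes the composite only up to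
  \<open>near\<close>, so the union in \<open>gmult\<close> is over a single germ.\<close>

lemma gmult_germ:
  assumes "T \<in> IS" "T' \<in> IS" "T' \<xi> = Some \<eta>" "\<eta> \<in> dom T"
  shows "gmult G (gm T \<eta>) (gm T' \<xi>) = gm (T \<circ>\<^sub>m T') \<xi>"
proof -
  let ?A = "{gm (S \<circ>\<^sub>m S') \<zeta> | S S' \<zeta>. (S', \<zeta>) \<in> gm T' \<xi> \<and> (S, the (S' \<zeta>)) \<in> gm T \<eta>}"
  have "?A = {gm (T \<circ>\<^sub>m T') \<xi>}"
  proof (intro subset_antisym subsetI)
    fix x assume "x \<in> ?A"
    then obtain S S' \<zeta> where x: "x = gm (S \<circ>\<^sub>m S') \<zeta>"
      and S: "(S', \<zeta>) \<in> gm T' \<xi>" "(S, the (S' \<zeta>)) \<in> gm T \<eta>" by blast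
    have S': "S' \<in> IS" "\<zeta> = \<xi>" "near \<xi> T' S'" and S1: "S \<in> IS" "near \<eta> T S" "\<eta> \<in> dom S"
      using S unfolding germ_mem_iff by auto
    have "S' \<xi> = Some \<eta>" using near_eq[OF S'(3)] assms(3) by simp
    have "near \<xi> (T \<circ>\<^sub>m T') (T \<circ>\<^sub>m S')" by (rule near_comp_left[OF S'(3)])
    moreover have "near \<xi> (T \<circ>\<^sub>m S') (S \<circ>\<^sub>m S')"
      by (rule near_comp_right[OF S'(1) \<open>S' \<xi> = Some \<eta>\<close> S1(2)])
    ultimately have "near \<xi> (T \<circ>\<^sub>m T') (S \<circ>\<^sub>m S')" by (rule near_trans)
    then have "gm (T \<circ>\<^sub>m T') \<xi> = gm (S \<circ>\<^sub>m S') \<xi>"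
      using assms S' S1 \<open>S' \<xi> = Some \<eta>\<close>
      by (subst germ_eq_iff) (simp_all add: dom_comp)
    then show "x \<in> {gm (T \<circ>\<^sub>m T') \<xi>}" using x S' by simp
  next
    fix x assume "x \<in> {gm (T \<circ>\<^sub>m T') \<xi>}"
    then show "x \<in> ?A" using assms
      by (intro CollectI exI[of _ T] exI[of _ T'] exI[of _ \<xi>]) (auto simp: germ_mem_iff)
  qed
  then show ?thesis by (simp add: germ_groupoid_def)
qed

lemma ginv_germ:
  assumes "T \<in> IS" "T \<xi> = Some \<eta>"
  shows "ginv G (gm T \<xi>) = gm (partial_inverse T) \<eta>"
proof -
  let ?A = "{gm (partial_inverse S) (the (S \<zeta>)) | S \<zeta>. (S, \<zeta>) \<in> gm T \<xi>}"
  have "?A = {gm (partial_inverse T) \<eta>}"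
  proof (intro subset_antisym subsetI)
    fix x assume "x \<in> ?A"
    then obtain S \<zeta> where x: "x = gm (partial_inverse S) (the (S \<zeta>))" and "(S, \<zeta>) \<in> gm T \<xi>" by blast
    then have S: "S \<in> IS" "\<zeta> = \<xi>" "near \<xi> T S" unfolding germ_mem_iff by auto
    have S\<xi>: "S \<xi> = Some \<eta>" using near_eq[OF S(3)] assms(2) by simp
    have "near \<eta> (partial_inverse T) (partial_inverse S)"
    proof (rule near_cancel_right[OF assms])
      have "near \<xi> (partial_inverse S \<circ>\<^sub>m T) (partial_inverse S \<circ>\<^sub>m S)" by (rule near_comp_left[OF S(3)])
      then show "near \<xi> (partial_inverse T \<circ>\<^sub>m T) (partial_inverse S \<circ>\<^sub>m T)"
        using near_Some_inverse(1)[OF assms] near_Some_inverse(1)[OF S(1) S\<xi>] by (metis near_sym near_trans)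
    qed
    moreover have "\<eta> \<in> dom (partial_inverse T)" "\<eta> \<in> dom (partial_inverse S)"
      using partial_inverse_IS assms S S\<xi> by blast+
    ultimately have "gm (partial_inverse T) \<eta> = gm (partial_inverse S) \<eta>"
      using assms S by (subst germ_eq_iff) (auto simp: inverse_semigroup.inversion)
    then show "x \<in> {gm (partial_inverse T) \<eta>}" using x S S\<xi> by simp
  next
    fix x assume "x \<in> {gm (partial_inverse T) \<eta>}"
    then show "x \<in> ?A" using assms
      by (intro CollectI exI[of _ T] exI[of _ \<xi>]) (auto simp: germ_mem_iff)
  qed
  then show ?thesis by (simp add: germ_groupoid_def)
qed

text \<open>The kernel of convolution by \<open>f\<close> on a fibre has the entry
  \<open>f (gdiv \<delta> h)\<close> in row \<delta> and column \<open>h\<close>.\<close>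

definition gdiv :: "'a germ \<Rightarrow> 'a germ \<Rightarrow> 'a germ" where
  "gdiv \<delta> h = gmult G \<delta> (ginv G h)"

text \<open>Left translation by the germ of \<open>S\<close> at the range of the arrow, meaningful
  when that range lies in the domain of \<open>S\<close>. The source, hence the fibre, is
  kept.\<close>

definition tr :: "('a word \<rightharpoonup> 'a word) \<Rightarrow> 'a germ \<Rightarrow> 'a germ" where
  "tr S \<gamma> = gmult G (gm S (rng G \<gamma>)) \<gamma>"


lemma gdiv_germ:
  assumes "T \<in> IS" "T' \<in> IS" "\<xi> \<in> dom T" "T' \<xi> = Some \<eta>"
  shows "gdiv (gm T \<xi>) (gm T' \<xi>) = gm (T \<circ>\<^sub>m partial_inverse T') \<eta>"
    and "\<eta> \<in> dom (T \<circ>\<^sub>m partial_inverse T')"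
proof -
  have "partial_inverse T' \<eta> = Some \<xi>" using assms partial_inverse_IS by blast
  then show "gdiv (gm T \<xi>) (gm T' \<xi>) = gm (T \<circ>\<^sub>m partial_inverse T') \<eta>"
    using assms unfolding gdiv_def by (simp add: ginv_germ gmult_germ)
  show "\<eta> \<in> dom (T \<circ>\<^sub>m partial_inverse T')"
    using \<open>partial_inverse T' \<eta> = Some \<xi>\<close> assms(3) by (auto simp: map_comp_def)
qed

lemma tr_germ:
  assumes "S \<in> IS" "T \<in> IS" "T \<xi> = Some \<eta>" "\<eta> \<in> dom S"
  shows "tr S (gm T \<xi>) = gm (S \<circ>\<^sub>m T) \<xi>"
  using assms unfolding tr_def by (simp add: gmult_germ)

lemma tr_props:
  assumes "S \<in> IS" "\<gamma> \<in> arr" "S (rng G \<gamma>) = Some \<zeta>"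
  shows "tr S \<gamma> \<in> arr" "src G (tr S \<gamma>) = src G \<gamma>" "rng G (tr S \<gamma>) = \<zeta>"
proof -
  obtain T \<xi> \<eta> where T: "T \<in> IS" "T \<xi> = Some \<eta>" "\<gamma> = gm T \<xi>" "src G \<gamma> = \<xi>" "rng G \<gamma> = \<eta>"
    using assms(2) by (rule arrE)
  have "\<eta> \<in> dom S" using T assms by auto
  then have *: "tr S \<gamma> = gm (S \<circ>\<^sub>m T) \<xi>" unfolding T(3) by (rule tr_germ[OF assms(1) T(1,2)])
  have "(S \<circ>\<^sub>m T) \<xi> = Some \<zeta>" using T assms by simp
  then show "tr S \<gamma> \<in> arr" "src G (tr S \<gamma>) = src G \<gamma>" "rng G (tr S \<gamma>) = \<zeta>"
    unfolding * using T assms by auto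
qed

lemma tr_tr:
  assumes "S \<in> IS" "R \<in> IS" "\<gamma> \<in> arr" "S (rng G \<gamma>) = Some \<zeta>" "\<zeta> \<in> dom R"
  shows "tr R (tr S \<gamma>) = tr (R \<circ>\<^sub>m S) \<gamma>"
proof -
  obtain T \<xi> \<eta> where T: "T \<in> IS" "T \<xi> = Some \<eta>" "\<gamma> = gm T \<xi>" "src G \<gamma> = \<xi>" "rng G \<gamma> = \<eta>"
    using assms(3) by (rule arrE)
  have 1: "(S \<circ>\<^sub>m T) \<xi> = Some \<zeta>" using T assms by simp
  have 2: "\<eta> \<in> dom (R \<circ>\<^sub>m S)" using T assms by (auto simp: map_comp_def)
  have "tr R (tr S \<gamma>) = gm (R \<circ>\<^sub>m (S \<circ>\<^sub>m T)) \<xi>"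
    unfolding T(3) using tr_germ[OF assms(1) T(1,2)] tr_germ[OF assms(2) comp_IS[OF assms(1) T(1)] 1 assms(5)] T(5) assms(4)
    by (simp add: domI)
  also have "\<dots> = tr (R \<circ>\<^sub>m S) \<gamma>"
    unfolding T(3) using tr_germ[OF comp_IS[OF assms(2,1)] T(1,2) 2] by (simp add: map_comp_assoc)
  finally show ?thesis .
qed

lemma tr_inject:
  assumes "S \<in> IS" "\<gamma> \<in> arr" "\<gamma>' \<in> arr" "rng G \<gamma> \<in> dom S" "rng G \<gamma>' \<in> dom S" "tr S \<gamma> = tr S \<gamma>'"
  shows "\<gamma> = \<gamma>'"
proof -
  obtain T \<xi> \<eta> where T: "T \<in> IS" "T \<xi> = Some \<eta>" "\<gamma> = gm T \<xi>" "src G \<gamma> = \<xi>" "rng G \<gamma> = \<eta>"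
    using assms(2) by (rule arrE)
  obtain T' \<xi>' \<eta>' where T': "T' \<in> IS" "T' \<xi>' = Some \<eta>'" "\<gamma>' = gm T' \<xi>'" "src G \<gamma>' = \<xi>'" "rng G \<gamma>' = \<eta>'"
    using assms(3) by (rule arrE)
  have "\<eta> \<in> dom S" "\<eta>' \<in> dom S" using assms T T' by auto
  have "gm (S \<circ>\<^sub>m T) \<xi> = gm (S \<circ>\<^sub>m T') \<xi>'"
    using assms(6) unfolding T(3) T'(3) using tr_germ[OF assms(1) T(1,2)] tr_germ[OF assms(1) T'(1,2)]
      \<open>\<eta> \<in> dom S\<close> \<open>\<eta>' \<in> dom S\<close> by simp
  moreover have "\<xi> \<in> dom (S \<circ>\<^sub>m T)" "\<xi>' \<in> dom (S \<circ>\<^sub>m T')"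
    using T T' \<open>\<eta> \<in> dom S\<close> \<open>\<eta>' \<in> dom S\<close> by (auto simp: map_comp_def)
  ultimately have *: "\<xi> = \<xi>'" "near \<xi> (S \<circ>\<^sub>m T) (S \<circ>\<^sub>m T')"
    using germ_eq_iff assms(1) T(1) T'(1) comp_IS by blast+
  then have "near \<xi> T T'"
    using near_cancel_left[OF assms(1) T(1) T'(1) T(2) \<open>\<eta> \<in> dom S\<close>] by blast
  then show ?thesis unfolding T(3) T'(3) using * T T' by (subst germ_eq_iff) auto
qed

text \<open>Cancellation of \<open>h\<close> on the right. It identifies the kernel of the indicator
  of \<open>bisec S\<close> with the graph of the partial translation \<open>tr S\<close> on each
  fibre.\<close>

lemma gdiv_in_bisec:
  assumes "\<delta> \<in> arr" "h \<in> arr" "src G \<delta> = src G h" "S \<in> IS"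
  shows "gdiv \<delta> h \<in> bisec S \<longleftrightarrow> rng G h \<in> dom S \<and> \<delta> = tr S h"
proof -
  obtain T \<xi> \<eta> where T: "T \<in> IS" "T \<xi> = Some \<eta>" "\<delta> = gm T \<xi>" "src G \<delta> = \<xi>" "rng G \<delta> = \<eta>"
    using assms(1) by (rule arrE)
  obtain T' \<xi>' \<eta>' where T': "T' \<in> IS" "T' \<xi>' = Some \<eta>'" "h = gm T' \<xi>'" "src G h = \<xi>'" "rng G h = \<eta>'"
    using assms(2) by (rule arrE)
  have [simp]: "\<xi>' = \<xi>" using assms(3) T T' by simp
  have div: "gdiv \<delta> h = gm (T \<circ>\<^sub>m partial_inverse T') \<eta>'" "\<eta>' \<in> dom (T \<circ>\<^sub>m partial_inverse T')"
    using gdiv_germ[of T T' \<xi> \<eta>'] T T' by auto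
  have pi: "near \<xi> (R \<circ>\<^sub>m (partial_inverse T' \<circ>\<^sub>m T')) R" for R
    using near_comp_left[OF near_Some_inverse(1)[OF T'(1,2)], of R] by simp
  have "near \<eta>' (T \<circ>\<^sub>m partial_inverse T') S \<longleftrightarrow> near \<xi> T (S \<circ>\<^sub>m T')"
  proof
    assume "near \<eta>' (T \<circ>\<^sub>m partial_inverse T') S"
    then have "near \<xi> ((T \<circ>\<^sub>m partial_inverse T') \<circ>\<^sub>m T') (S \<circ>\<^sub>m T')"
      using near_comp_right[OF T'(1,2)] by simp
    then show "near \<xi> T (S \<circ>\<^sub>m T')" unfolding map_comp_assoc by (metis pi near_sym near_trans)
  next
    assume "near \<xi> T (S \<circ>\<^sub>m T')"
    then have "near \<xi> ((T \<circ>\<^sub>m partial_inverse T') \<circ>\<^sub>m T') (S \<circ>\<^sub>m T')"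
      unfolding map_comp_assoc by (metis pi near_trans)
    then show "near \<eta>' (T \<circ>\<^sub>m partial_inverse T') S" using near_cancel_right[OF T'(1,2)] by simp
  qed
  moreover have "gdiv \<delta> h \<in> bisec S \<longleftrightarrow> \<eta>' \<in> dom S \<and> near \<eta>' (T \<circ>\<^sub>m partial_inverse T') S"
    unfolding div(1) using div(2) T T' assms by (intro germ_in_bisec) auto
  moreover have "\<delta> = tr S h \<longleftrightarrow> near \<xi> T (S \<circ>\<^sub>m T')" if "\<eta>' \<in> dom S"
  proof -
    have "tr S h = gm (S \<circ>\<^sub>m T') \<xi>" unfolding T'(3) using tr_germ[OF assms(4) T'(1,2) that] by simp
    moreover have "\<xi> \<in> dom (S \<circ>\<^sub>m T')" using T'(2) that by (auto simp: map_comp_def)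
    ultimately show ?thesis unfolding T(3) using T T' assms(4) germ_eq_iff[of T \<xi> "S \<circ>\<^sub>m T'" \<xi>] by auto
  qed
  ultimately show ?thesis using T' by blast
qed

lemma gdiv_props:
  assumes "\<delta> \<in> arr" "h \<in> arr" "src G \<delta> = src G h"
  shows "gdiv \<delta> h \<in> arr" "src G (gdiv \<delta> h) = rng G h" "rng G (gdiv \<delta> h) = rng G \<delta>"
proof -
  obtain T \<xi> \<eta> where T: "T \<in> IS" "T \<xi> = Some \<eta>" "\<delta> = gm T \<xi>" "src G \<delta> = \<xi>" "rng G \<delta> = \<eta>"
    using assms(1) by (rule arrE)
  obtain T' \<xi>' \<eta>' where T': "T' \<in> IS" "T' \<xi>' = Some \<eta>'" "h = gm T' \<xi>'" "src G h = \<xi>'" "rng G h = \<eta>'"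
    using assms(2) by (rule arrE)
  have [simp]: "\<xi>' = \<xi>" using assms(3) T T' by simp
  have div: "gdiv \<delta> h = gm (T \<circ>\<^sub>m partial_inverse T') \<eta>'" "\<eta>' \<in> dom (T \<circ>\<^sub>m partial_inverse T')"
    using gdiv_germ[of T T' \<xi> \<eta>'] T T' by auto
  have "(T \<circ>\<^sub>m partial_inverse T') \<eta>' = Some \<eta>"
    using T T' partial_inverse_IS[OF T'(1), of \<eta>' \<xi>] by simp
  then show "gdiv \<delta> h \<in> arr" "src G (gdiv \<delta> h) = rng G h" "rng G (gdiv \<delta> h) = rng G \<delta>"
    unfolding div using T T' by auto
qed

text \<open>A common quotient is the germ of a single \<open>S\<close>, which translates
  \<open>h\<close> to \<delta> and \<open>h'\<close> to \<open>\<delta>'\<close>; translation is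
  injective where it is defined.\<close>

lemma gdiv_inject:
  assumes "\<delta> \<in> arr" "h \<in> arr" "src G \<delta> = src G h" "\<delta>' \<in> arr" "h' \<in> arr" "src G \<delta>' = src G h'"
    "src G h' = src G h"
    "gdiv \<delta> h = gdiv \<delta>' h'"
  shows "\<delta> = \<delta>' \<longleftrightarrow> h = h'"
proof -
  obtain S \<zeta> where S: "S \<in> IS" "\<zeta> \<in> dom S" "gdiv \<delta> h = gm S \<zeta>" using gdiv_props(1)[OF assms(1-3)] unfolding arr_eq by blast
  then have b: "gdiv \<delta> h \<in> bisec S" "gdiv \<delta>' h' \<in> bisec S" using assms(8) by (auto simp: bisec_def)
  then have "rng G h \<in> dom S" "\<delta> = tr S h" "rng G h' \<in> dom S" "\<delta>' = tr S h'"
    using gdiv_in_bisec S(1) assms by blast+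
  then show ?thesis using tr_inject[OF S(1) assms(2,5)] by blast
qed


subsection \<open>Degree and refinement\<close>

text \<open>If \<open>q'\<close> were longer than \<open>q\<close>, the letter at position
  \<open>length q\<close> would be prescribed on the right, while on the left it is the first letter
  of \<open>act k \<zeta>\<close>, which can be made any letter.\<close>

lemma act_eq_length_le:
  assumes "2 \<le> CARD('a)" "k \<in> carrier \<Gamma>" "\<And>\<zeta>. q \<frown> act k \<zeta> = q' \<frown> act k' \<zeta>"
  shows "length q' \<le> length q"
proof (rule ccontr)
  assume "\<not> length q' \<le> length q"
  then have l: "length q < length q'" by simp
  have "UNIV \<noteq> {q' ! length q}" using assms(1)
    by (metis One_nat_def Suc_1 card.empty card.insert finite.emptyI empty_iff not_less_eq_eq order_refl)
  then obtain a where a: "a \<noteq> q' ! length q" by blast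
  \<comment> \<open>Chosen so that \<open>act k ?\<zeta>\<close> is the constant word with letter
    \<open>a\<close>.\<close>
  let ?\<zeta> = "act (inv\<^bsub>\<Gamma>\<^esub> k) (\<lambda>_. a)"
  have "(q \<frown> act k ?\<zeta>) (length q) = (q' \<frown> act k' ?\<zeta>) (length q)" using assms(3) by simp
  then show False using l a assms(2) by simp
qed

text \<open>The degree, the length of \<open>v\<close> minus that of \<open>u\<close>, belongs to
  the germ and not to the triple: refining both triples to a common domain word gives maps equal on
  a whole cylinder, and their range words then have equal length.\<close>

lemma near_degree:
  assumes "2 \<le> CARD('a)" "g \<in> carrier \<Gamma>" "h \<in> carrier \<Gamma>"
    and "near \<xi> (cmap u g v) (cmap u' h v')" "\<xi> \<in> cyl u"
  shows "length v + length u' = length v' + length u"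
proof -
  obtain V where V: "openin word_topology V" "\<xi> \<in> V" "\<And>\<eta>. \<eta> \<in> V \<Longrightarrow> cmap u g v \<eta> = cmap u' h v' \<eta>"
    using assms(4) unfolding near_def by blast
  have u': "\<xi> \<in> cyl u'" using near_dom[OF assms(4)] assms(5) by simp
  obtain n where n: "\<And>m. m \<ge> n \<Longrightarrow> cyl (prefix m \<xi>) \<subseteq> V"
    using openin_nonempty_cyl[OF V(1,2)] by blast
  \<comment> \<open>Long enough for the cylinder of \<open>p\<close> to lie in \<open>V\<close> and
    for \<open>p\<close> to extend both \<open>u\<close> and \<open>u'\<close>.\<close>
  define m where "m = max n (max (length u) (length u'))"
  define p where "p = prefix m \<xi>"
  have "prefix (length u) \<xi> = u" "prefix (length u') \<xi> = u'" using assms(5) u' by (simp_all only: in_cyl_iff)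
  moreover have "length u \<le> m" "length u' \<le> m" by (simp_all add: m_def)
  ultimately have "take (length u) p = u" "take (length u') p = u'" by (simp_all add: p_def min_absorb1)
  then obtain w w' where w: "p = u @ w" "p = u' @ w'" by (metis append_take_drop_id)
  have eq: "(v @ \<phi> g w) \<frown> act (sect g w) \<zeta> = (v' @ \<phi> h w') \<frown> act (sect h w') \<zeta>" for \<zeta>
  proof -
    have "p \<frown> \<zeta> \<in> V" using n[of m] unfolding p_def m_def by auto
    then have "cmap u g v (p \<frown> \<zeta>) = cmap u' h v' (p \<frown> \<zeta>)" by (rule V(3))
    moreover have "cmap u g v (p \<frown> \<zeta>) = Some ((v @ \<phi> g w) \<frown> act (sect g w) \<zeta>)"
      using cmap_refine[OF assms(2), of "p \<frown> \<zeta>" u w v] by (simp add: w(1))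
    moreover have "cmap u' h v' (p \<frown> \<zeta>) = Some ((v' @ \<phi> h w') \<frown> act (sect h w') \<zeta>)"
      using cmap_refine[OF assms(3), of "p \<frown> \<zeta>" u' w' v'] by (simp add: w(2))
    ultimately show ?thesis by simp
  qed
  have "length (v' @ \<phi> h w') \<le> length (v @ \<phi> g w)"
    by (rule act_eq_length_le[OF assms(1) _ eq]) (use assms in simp)
  moreover have "length (v @ \<phi> g w) \<le> length (v' @ \<phi> h w')"
    by (rule act_eq_length_le[OF assms(1) _ eq[symmetric]]) (use assms in simp)
  moreover have "length u + length w = length u' + length w'" using w by (metis length_append)
  ultimately show ?thesis using assms(2,3) by simp
qed

lemma bisec_degree:
  assumes "2 \<le> CARD('a)" "g \<in> carrier \<Gamma>" "h \<in> carrier \<Gamma>"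
    and "\<gamma> \<in> bisec (cmap u g v)" "\<gamma> \<in> bisec (cmap u' h v')"
  shows "length v + length u' = length v' + length u"
proof -
  obtain \<xi> where \<xi>: "\<xi> \<in> cyl u" "\<gamma> = gm (cmap u g v) \<xi>" using assms(4) by (auto simp: bisec_def)
  have "near \<xi> (cmap u g v) (cmap u' h v')"
    using assms \<xi> germ_in_bisec[of "cmap u g v" \<xi> "cmap u' h v'"] by simp
  then show ?thesis using near_degree assms \<xi> by blast
qed

lemma near_refine:
  assumes "g \<in> carrier \<Gamma>" "\<xi> \<in> cyl (u @ w)"
  shows "near \<xi> (cmap u g v) (cmap (u @ w) (sect g w) (v @ \<phi> g w))"
  unfolding near_def
  by (rule exI[of _ "cyl (u @ w)"], intro conjI ballI openin_cyl assms(2) cmap_refine[OF assms(1)])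

lemma in_bisec_src:
  assumes "T \<in> IS" "\<gamma> \<in> bisec T"
  shows "src G \<gamma> \<in> dom T" "\<gamma> = gm T (src G \<gamma>)"
  using assms by (auto simp: bisec_def)

text \<open>Maps that agree on an open cylinder have the same germs there, so refinement only cuts
  down the sources.\<close>

lemma bisec_refine:
  assumes "g \<in> carrier \<Gamma>"
  shows "\<gamma> \<in> bisec (cmap (u @ w) (sect g w) (v @ \<phi> g w)) \<longleftrightarrow>
    \<gamma> \<in> bisec (cmap u g v) \<and> src G \<gamma> \<in> cyl (u @ w)"
    (is "\<gamma> \<in> bisec ?S \<longleftrightarrow> \<gamma> \<in> bisec ?T \<and> ?\<xi> \<in> _")
proof -
  have IS: "?S \<in> IS" "?T \<in> IS" using assms by simp_all
  have *: "gm ?T ?\<xi> = gm ?S ?\<xi>" if "?\<xi> \<in> cyl (u @ w)"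
    using IS near_refine[OF assms that] that cyl_append_subset[of u w]
    by (subst germ_eq_iff) (auto simp del: conc_conc)
  show ?thesis
  proof
    assume L: "\<gamma> \<in> bisec ?S"
    then have "?\<xi> \<in> cyl (u @ w)" "\<gamma> = gm ?S ?\<xi>" using in_bisec_src[OF IS(1)] by simp_all
    then have "\<gamma> = gm ?T ?\<xi>" "?\<xi> \<in> cyl u" using * cyl_append_subset[of u w] by blast+
    then have "\<gamma> \<in> bisec ?T" unfolding bisec_def dom_cmap by (intro image_eqI[of \<gamma> _ ?\<xi>])
    then show "\<gamma> \<in> bisec ?T \<and> ?\<xi> \<in> cyl (u @ w)" using \<open>?\<xi> \<in> cyl (u @ w)\<close> by (rule conjI)
  next
    assume R: "\<gamma> \<in> bisec ?T \<and> ?\<xi> \<in> cyl (u @ w)"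
    then have "\<gamma> = gm ?T ?\<xi>" by (intro in_bisec_src(2)[OF IS(2)] conjunct1[OF R])
    also have "\<dots> = gm ?S ?\<xi>" by (rule *[OF conjunct2[OF R]])
    finally show "\<gamma> \<in> bisec ?S" unfolding bisec_def dom_cmap by (rule image_eqI[OF _ conjunct2[OF R]])
  qed
qed

text \<open>Removing \<open>u\<close>, acting and prepending \<open>v\<close> as separate steps lets
  the cancellation lemmas strip both words from a comparison of germs.\<close>

lemma cmap_factor:
  assumes "g \<in> carrier \<Gamma>"
  shows "cmap u g v = (cmap [] \<one>\<^bsub>\<Gamma>\<^esub> v \<circ>\<^sub>m cmap [] g []) \<circ>\<^sub>m cmap u \<one>\<^bsub>\<Gamma>\<^esub> []"
proof
  fix \<zeta> show "cmap u g v \<zeta> = ((cmap [] \<one>\<^bsub>\<Gamma>\<^esub> v \<circ>\<^sub>m cmap [] g []) \<circ>\<^sub>m cmap u \<one>\<^bsub>\<Gamma>\<^esub> []) \<zeta>"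
  proof (cases "\<zeta> \<in> cyl u")
    case True then show ?thesis by (auto simp: map_comp_def)
  next
    case False then show ?thesis by (simp add: map_comp_def cylinder_map_def)
  qed
qed

text \<open>The degree forces \<open>v\<close> and \<open>v'\<close> to have equal length, and the
  common value at the point then makes them equal. After cancelling the words only germs of group
  elements are compared.\<close>

lemma near_cmap_iff:
  assumes "2 \<le> CARD('a)" "g \<in> carrier \<Gamma>" "h \<in> carrier \<Gamma>"
  shows "near (u \<frown> \<xi>) (cmap u g v) (cmap u h v') \<longleftrightarrow>
    v = v' \<and> near \<xi> (cmap [] g []) (cmap [] h [])"
proof -
  have *: "near (u \<frown> \<xi>) (cmap u g v) (cmap u h v) \<longleftrightarrow> near \<xi> (cmap [] g []) (cmap [] h [])"
  proof
    assume "near (u \<frown> \<xi>) (cmap u g v) (cmap u h v)"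
    then have "near \<xi> (cmap [] \<one>\<^bsub>\<Gamma>\<^esub> v \<circ>\<^sub>m cmap [] g []) (cmap [] \<one>\<^bsub>\<Gamma>\<^esub> v \<circ>\<^sub>m cmap [] h [])"
      unfolding cmap_factor[OF assms(2), of u v] cmap_factor[OF assms(3), of u v]
      by (rule near_cancel_right[rotated 2]) simp_all
    then show "near \<xi> (cmap [] g []) (cmap [] h [])"
      by (rule near_cancel_left[rotated 5]) (use assms in \<open>simp_all\<close>)
  next
    assume R: "near \<xi> (cmap [] g []) (cmap [] h [])"
    show "near (u \<frown> \<xi>) (cmap u g v) (cmap u h v)"
      unfolding cmap_factor[OF assms(2), of u v] cmap_factor[OF assms(3), of u v]
      by (rule near_comp_right[of _ _ \<xi>], simp, simp, rule near_comp_left, rule R)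
  qed
  show ?thesis
  proof (cases "v = v'")
    case True then show ?thesis using * by simp
  next
    case False
    have "\<not> near (u \<frown> \<xi>) (cmap u g v) (cmap u h v')"
    proof
      assume n: "near (u \<frown> \<xi>) (cmap u g v) (cmap u h v')"
      then have "length v = length v'" using near_degree[OF assms n] by simp
      moreover have "v \<frown> act g \<xi> = v' \<frown> act h \<xi>" using near_eq[OF n] by simp
      ultimately show False using False by simp
    qed
    then show ?thesis using False by simp
  qed
qed

lemma germ_cmap_eq_iff:
  assumes "2 \<le> CARD('a)" "g \<in> carrier \<Gamma>" "h \<in> carrier \<Gamma>"
  shows "gm (cmap u g v) (u \<frown> \<xi>) \<in> bisec (cmap u h v') \<longleftrightarrow>
    v = v' \<and> near \<xi> (cmap [] g []) (cmap [] h [])"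
  using assms near_cmap_iff[OF assms] germ_in_bisec[of "cmap u g v" "u \<frown> \<xi>" "cmap u h v'"] by simp

subsection \<open>Regular points\<close>

definition regular :: "'a word \<Rightarrow> bool" where
  "regular \<xi> \<longleftrightarrow> (\<forall>T\<in>IS. \<forall>S\<in>IS. \<xi> \<in> dom T \<longrightarrow> T \<xi> = S \<xi> \<longrightarrow> near \<xi> T S)"

text \<open>Precompose with \<open>R\<close>, use regularity of \<xi>, cancel \<open>R\<close>:
  regularity is a property of whole orbits.\<close>

lemma regular_IS:
  assumes "regular \<xi>" "R \<in> IS" "R \<xi> = Some \<eta>"
  shows "regular \<eta>"
  unfolding regular_def
proof (intro ballI impI)
  fix T S assume TS: "T \<in> IS" "S \<in> IS" "\<eta> \<in> dom T" "T \<eta> = S \<eta>"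
  then have "\<xi> \<in> dom (T \<circ>\<^sub>m R)" "(T \<circ>\<^sub>m R) \<xi> = (S \<circ>\<^sub>m R) \<xi>"
    using assms dom_comp[of R \<xi> \<eta> T] by simp_all
  then have "near \<xi> (T \<circ>\<^sub>m R) (S \<circ>\<^sub>m R)"
    using assms TS comp_IS unfolding regular_def by blast
  then show "near \<eta> T S" by (rule near_cancel_right[OF assms(2,3)])
qed

lemma openin_compl_dom: "T \<in> IS \<Longrightarrow> openin word_topology (- dom T)"
  using IS_cases'[of T] openin_compl_cyl openin_topspace[of word_topology] by auto

lemma openin_neq:
  assumes "T \<in> IS" "S \<in> IS"
  shows "openin word_topology {\<xi> \<in> dom T. T \<xi> \<noteq> S \<xi>}"
proof (subst openin_subopen, intro ballI)
  fix \<xi> assume "\<xi> \<in> {\<xi> \<in> dom T. T \<xi> \<noteq> S \<xi>}"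
  then obtain \<eta> where \<eta>: "T \<xi> = Some \<eta>" "T \<xi> \<noteq> S \<xi>" by blast
  show "\<exists>V. openin word_topology V \<and> \<xi> \<in> V \<and> V \<subseteq> {\<xi> \<in> dom T. T \<xi> \<noteq> S \<xi>}"
  proof (cases "S \<xi>")
    case None
    then show ?thesis using \<eta> openin_compl_dom[OF assms(2)] openin_dom_IS[OF assms(1)]
      by (intro exI[of _ "dom T \<inter> - dom S"]) (auto intro!: openin_Int)
  next
    case (Some \<zeta>)
    then have "\<eta> \<noteq> \<zeta>" using \<eta> by auto
    then obtain U V where UV: "openin word_topology U" "openin word_topology V" "\<eta> \<in> U" "\<zeta> \<in> V" "disjnt U V"
      using Hausdorff_space_word unfolding Hausdorff_space_def by (metis UNIV_I topspace_word)
    show ?thesis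
      by (intro exI[of _ "{\<xi>. \<exists>\<eta>\<in>U. T \<xi> = Some \<eta>} \<inter> {\<xi>. \<exists>\<eta>\<in>V. S \<xi> = Some \<eta>}"] conjI openin_Int
          IS_continuous assms UV)
        (use UV \<eta> Some in \<open>auto simp: disjnt_iff\<close>)
  qed
qed

text \<open>Arrows fail to be separated where maps agree at a point but not near it. At a regular
  source either the germs agree or the values differ, and differing values differ nearby.\<close>

lemma bisec_locally_constant:
  assumes "\<gamma> \<in> arr" "regular (src G \<gamma>)" "S \<in> IS"
  shows "\<exists>U. openin (arrows G) U \<and> \<gamma> \<in> U \<and> (\<forall>\<gamma>'\<in>U. \<gamma>' \<in> bisec S \<longleftrightarrow> \<gamma> \<in> bisec S)"
proof (cases "\<gamma> \<in> bisec S")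
  case True then show ?thesis using openin_bisec[OF assms(3)] by blast
next
  case False
  obtain T \<xi> \<eta> where T: "T \<in> IS" "T \<xi> = Some \<eta>" "\<gamma> = gm T \<xi>" "src G \<gamma> = \<xi>" "rng G \<gamma> = \<eta>"
    using assms(1) by (rule arrE)
  have \<xi>: "\<xi> \<in> dom T" using T(2) by blast
  have "T \<xi> \<noteq> S \<xi>"
  proof
    assume eq: "T \<xi> = S \<xi>"
    have "regular \<xi>" using assms(2) T(4) by simp
    from this[unfolded regular_def, rule_format, OF T(1) assms(3) \<xi> eq] have n: "near \<xi> T S" .
    then have "\<gamma> \<in> bisec S"
      unfolding T(3) germ_in_bisec[OF T(1) \<xi> assms(3)] using near_dom[OF n] \<xi> by (intro conjI) simp_all
    then show False using False by simp
  qed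
  show ?thesis
  proof (intro exI conjI ballI)
    show "openin (arrows G) (gm T ` ({\<xi> \<in> dom T. T \<xi> \<noteq> S \<xi>} \<inter> dom T))"
      by (rule openin_bisec_restrict[OF T(1) openin_neq[OF T(1) assms(3)]])
    show "\<gamma> \<in> gm T ` ({\<xi> \<in> dom T. T \<xi> \<noteq> S \<xi>} \<inter> dom T)" using T \<open>T \<xi> \<noteq> S \<xi>\<close> by auto
    fix \<gamma>' assume "\<gamma>' \<in> gm T ` ({\<xi> \<in> dom T. T \<xi> \<noteq> S \<xi>} \<inter> dom T)"
    then obtain \<xi>' where \<xi>': "\<xi>' \<in> dom T" "T \<xi>' \<noteq> S \<xi>'" "\<gamma>' = gm T \<xi>'" by blast
    then have "\<gamma>' \<notin> bisec S" unfolding \<xi>'(3) germ_in_bisec[OF T(1) \<xi>'(1) assms(3)]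
      using near_eq[of \<xi>' T S] by blast
    then show "\<gamma>' \<in> bisec S \<longleftrightarrow> \<gamma> \<in> bisec S" using False by simp
  qed
qed

lemma bisec_locally_constant_finite:
  assumes "\<gamma> \<in> arr" "regular (src G \<gamma>)" "finite F" "F \<subseteq> IS"
  shows "\<exists>U. openin (arrows G) U \<and> \<gamma> \<in> U \<and> (\<forall>S\<in>F. \<forall>\<gamma>'\<in>U. \<gamma>' \<in> bisec S \<longleftrightarrow> \<gamma> \<in> bisec S)"
  using assms(3,4)
proof (induction F)
  case empty
  then show ?case using assms(1) openin_topspace[of "arrows G"] by blast
next
  case (insert S F)
  then obtain U where U: "openin (arrows G) U" "\<gamma> \<in> U" "\<forall>S\<in>F. \<forall>\<gamma>'\<in>U. \<gamma>' \<in> bisec S \<longleftrightarrow> \<gamma> \<in> bisec S" by auto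
  obtain U' where U': "openin (arrows G) U'" "\<gamma> \<in> U'" "\<forall>\<gamma>'\<in>U'. \<gamma>' \<in> bisec S \<longleftrightarrow> \<gamma> \<in> bisec S"
    using bisec_locally_constant[OF assms(1,2), of S] insert.prems by auto
  show ?case
  proof (intro exI[of _ "U \<inter> U'"] conjI ballI)
    show "openin (arrows G) (U \<inter> U')" using U(1) U'(1) by (rule openin_Int)
    show "\<gamma> \<in> U \<inter> U'" using U(2) U'(2) by (rule IntI)
    fix R \<gamma>' assume "R \<in> insert S F" "\<gamma>' \<in> U \<inter> U'"
    then show "\<gamma>' \<in> bisec R \<longleftrightarrow> \<gamma> \<in> bisec R" using U(3) U'(3) by (elim insertE IntE) simp_all
  qed
qed

text \<open>This is the boundary of the set where \<open>T\<close> and \<open>S\<close> agree: the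
  agreement set is closed and \<open>near\<close> cuts out its interior. The regular words are those
  that avoid all these boundaries.\<close>

lemma closedin_irregular:
  assumes "T \<in> IS" "S \<in> IS"
  shows "closedin word_topology ({\<xi> \<in> dom T. T \<xi> = S \<xi>} - {\<xi>. near \<xi> T S})"
proof -
  have "- ({\<xi> \<in> dom T. T \<xi> = S \<xi>} - {\<xi>. near \<xi> T S}) =
      - dom T \<union> {\<xi> \<in> dom T. T \<xi> \<noteq> S \<xi>} \<union> {\<xi>. near \<xi> T S}"
    unfolding Compl_eq by (auto simp only: mem_Collect_eq Un_iff Diff_iff)
  then have "openin word_topology (- ({\<xi> \<in> dom T. T \<xi> = S \<xi>} - {\<xi>. near \<xi> T S}))"
    using openin_compl_dom[OF assms(1)] openin_neq[OF assms] openin_near by (simp only: openin_Un)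
  then show ?thesis by (simp add: closedin_def Compl_eq_Diff_UNIV)
qed

lemma interior_irregular:
  "word_topology interior_of ({\<xi> \<in> dom T. T \<xi> = S \<xi>} - {\<xi>. near \<xi> T S}) = {}"
proof (rule ccontr)
  assume "word_topology interior_of ({\<xi> \<in> dom T. T \<xi> = S \<xi>} - {\<xi>. near \<xi> T S}) \<noteq> {}"
  then obtain x where x: "x \<in> word_topology interior_of ({\<xi> \<in> dom T. T \<xi> = S \<xi>} - {\<xi>. near \<xi> T S})" by blast
  obtain U where U: "openin word_topology U" "x \<in> U"
      "U \<subseteq> {\<xi> \<in> dom T. T \<xi> = S \<xi>} - {\<xi>. near \<xi> T S}"
    using x unfolding interior_of_def mem_Collect_eq by (elim exE conjE)
  then have "\<forall>\<eta>\<in>U. T \<eta> = S \<eta>" by blast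
  then have "near x T S" using U(1,2) unfolding near_def by (intro exI[of _ U] conjI)
  then show False using U(2,3) by blast
qed

lemma countable_IS:
  assumes "countable (carrier \<Gamma>)"
  shows "countable IS"
proof -
  have "IS \<subseteq> insert Map.empty ((\<lambda>(u, g, v). cmap u g v) ` (UNIV \<times> carrier \<Gamma> \<times> UNIV))"
  proof
    fix T assume "T \<in> IS"
    from IS_cases'[OF this] show "T \<in> insert Map.empty ((\<lambda>(u, g, v). cmap u g v) ` (UNIV \<times> carrier \<Gamma> \<times> UNIV))"
      by force
  qed
  moreover have "countable (insert Map.empty ((\<lambda>(u, g, v). cmap u g v) ` (UNIV \<times> carrier \<Gamma> \<times> UNIV)))"
    using assms by (intro countable_insert countable_image countable_SIGMA) auto
  ultimately show ?thesis by (rule countable_subset)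
qed

lemma regular_dense:
  assumes "countable (carrier \<Gamma>)" "openin word_topology V" "V \<noteq> {}"
  shows "\<exists>\<xi>\<in>V. regular \<xi>"
proof (rule ccontr)
  assume none: "\<not> ?thesis"
  let ?B = "\<lambda>(T, S). {\<xi> \<in> dom T. T \<xi> = S \<xi>} - {\<xi>. near \<xi> T S}"
  have "V \<subseteq> \<Union> (?B ` (IS \<times> IS))"
    using none unfolding regular_def by blast
  moreover have "word_topology interior_of \<Union> (?B ` (IS \<times> IS)) = {}"
  proof (rule Baire_category_alt)
    have "compact_space (word_topology :: 'a word topology)" "Hausdorff_space (word_topology :: 'a word topology)"
      by (rule compact_space_word Hausdorff_space_word)+
    then show "completely_metrizable_space (word_topology :: 'a word topology) \<or>
        locally_compact_space (word_topology :: 'a word topology) \<and> regular_space (word_topology :: 'a word topology)"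
      using compact_imp_locally_compact_space compact_Hausdorff_imp_regular_space by blast
    show "countable (?B ` (IS \<times> IS))" using countable_IS[OF assms(1)] by blast
    show "closedin word_topology T \<and> word_topology interior_of T = {}" if "T \<in> ?B ` (IS \<times> IS)" for T
      using that closedin_irregular interior_irregular by auto
  qed
  ultimately show False using assms(2,3) interior_of_maximal by blast
qed

end

section \<open>Countability of a contracting group\<close>

context contracting_self_similar_action
begin

lemma phi_eq_of_level:
  assumes "g \<in> carrier \<Gamma>" "h \<in> carrier \<Gamma>"
    and "\<And>v. length v = m \<Longrightarrow> \<phi> g v = \<phi> h v" "\<And>v. length v = m \<Longrightarrow> sect g v = sect h v"
  shows "g = h"
proof (rule phi_eqI[OF assms(1,2)])
  fix w
  show "\<phi> g w = \<phi> h w"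
  proof (cases "m \<le> length w")
    case True
    have "\<phi> k w = \<phi> k (take m w) @ \<phi> (sect k (take m w)) (drop m w)" if "k \<in> carrier \<Gamma>" for k
      using phi_append[OF that, of "take m w" "drop m w"] by simp
    then show ?thesis using assms True by (simp add: min_def)
  next
    case False
    \<comment> \<open>Words shorter than \<open>m\<close> are padded to length \<open>m\<close> with
      an arbitrary letter, and the image is truncated.\<close>
    let ?p = "replicate (m - length w) (undefined :: 'c)"
    have "\<phi> k w = take (length w) (\<phi> k (w @ ?p))" if "k \<in> carrier \<Gamma>" for k
      using that by (simp add: phi_append)
    then show ?thesis using assms(1,2) assms(3)[of "w @ ?p"] False by simp
  qed
qed

text \<open>The elements whose sections at level \<open>m\<close> all lie in \<open>N\<close> form a
  finite set \<open>K m\<close>, since an element is determined by its action on that level and its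
  sections there. Contraction says that these sets exhaust the group.\<close>

lemma countable_carrier: "countable (carrier \<Gamma>)"
proof -
  obtain N where N: "finite N" "N \<subseteq> carrier \<Gamma>"
    "\<And>g. g \<in> carrier \<Gamma> \<Longrightarrow> \<exists>m. \<forall>v. length v \<ge> m \<longrightarrow> sect g v \<in> N"
    using contracting by blast
  define K where "K m = {g \<in> carrier \<Gamma>. \<forall>v. length v = m \<longrightarrow> sect g v \<in> N}" for m
  have "finite (K m)" for m
  proof -
    let ?L = "{v :: 'c list. length v = m}"
    let ?f = "\<lambda>g. \<lambda>v\<in>?L. (\<phi> g v, sect g v)"
    have fin: "finite ?L" using finite_lists_length_eq[of "UNIV :: 'c set" m] by simp
    have "inj_on ?f (K m)"
    proof (rule inj_onI)
      fix g h assume gh: "g \<in> K m" "h \<in> K m" "?f g = ?f h"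
      have "\<phi> g v = \<phi> h v \<and> sect g v = sect h v" if "length v = m" for v
        using fun_cong[OF gh(3), of v] that by simp
      then show "g = h" using gh by (intro phi_eq_of_level[of g h m]) (auto simp: K_def)
    qed
    moreover have "?f ` K m \<subseteq> Pi\<^sub>E ?L (\<lambda>_. ?L \<times> N)"
      by (auto simp: K_def PiE_iff extensional_def split: if_splits)
    moreover have "finite (Pi\<^sub>E ?L (\<lambda>_. ?L \<times> N))"
      using fin N(1) by (intro finite_PiE) auto
    ultimately show ?thesis by (meson finite_imageD finite_subset)
  qed
  moreover have "carrier \<Gamma> \<subseteq> (\<Union>m. K m)"
  proof
    fix g assume g: "g \<in> carrier \<Gamma>"
    then obtain m where "\<forall>v. length v \<ge> m \<longrightarrow> sect g v \<in> N" using N(3) by blast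
    then have "g \<in> K m" using g by (simp add: K_def)
    then show "g \<in> (\<Union>m. K m)" by blast
  qed
  ultimately show ?thesis
    by (meson countable_UN countable_finite countable_subset countableI_type)
qed

end

section \<open>Interpolation in a finite-dimensional space of functions\<close>

text \<open>The functions \<open>F g\<close> span a space of dimension at most
  \<open>card N\<close>, so finitely many points determine its members. The sums with coefficients
  \<open>b p\<close> are the Lagrange functions of these points; their duality on \<open>P\<close>
  carries the induction.\<close>

lemma interpolation:
  fixes F :: "'g \<Rightarrow> 'y \<Rightarrow> complex"
  assumes "finite N"
  shows "\<exists>P b. finite P \<and> P \<subseteq> Y \<and>
    (\<forall>p\<in>P. \<forall>q\<in>P. (\<Sum>g\<in>N. b p g * F g q) = (if p = q then 1 else 0)) \<and>
    (\<forall>g\<in>N. \<forall>y\<in>Y. F g y = (\<Sum>p\<in>P. F g p * (\<Sum>g'\<in>N. b p g' * F g' y)))"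
  using assms
proof (induction N)
  case empty
  show ?case by (intro exI[of _ "{}"]) auto
next
  case (insert g N)
  then obtain P b where P12: "finite P" "P \<subseteq> Y" and
    P3: "\<forall>p\<in>P. \<forall>q\<in>P. (\<Sum>g\<in>N. b p g * F g q) = (if p = q then 1 else 0)" and
    P4: "\<forall>h\<in>N. \<forall>y\<in>Y. F h y = (\<Sum>p\<in>P. F h p * (\<Sum>g'\<in>N. b p g' * F g' y))"
    by blast
  note P = P12 P3[rule_format] P4[rule_format]
  define f where "f p y = (\<Sum>g'\<in>N. b p g' * F g' y)" for p y
  \<comment> \<open>The remainder of the new function after interpolation at the old points. If it
    vanishes on \<open>Y\<close>, the old points suffice; otherwise a point where it is nonzero is
    added.\<close>
  define r where "r y = F g y - (\<Sum>p\<in>P. F g p * f p y)" for y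
  have fP: "f p q = (if p = q then 1 else 0)" if "p \<in> P" "q \<in> P" for p q
    using P(3)[OF that] by (simp add: f_def)
  have rP: "r p = 0" if "p \<in> P" for p
    using that P(1) by (simp add: r_def fP if_distrib[of "\<lambda>x. _ * x"] sum.delta cong: if_cong)
  have ext: "(\<Sum>g'\<in>insert g N. (if g' = g then \<alpha> else \<beta> g') * F g' y) = \<alpha> * F g y + (\<Sum>g'\<in>N. \<beta> g' * F g' y)"
    for \<alpha> \<beta> y
  proof -
    have "(\<Sum>g'\<in>N. (if g' = g then \<alpha> else \<beta> g') * F g' y) = (\<Sum>g'\<in>N. \<beta> g' * F g' y)"
      using insert.hyps(2) by (intro sum.cong) auto
    then show ?thesis using insert.hyps by simp
  qed
  show ?case
  proof (cases "\<forall>y\<in>Y. r y = 0")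
    case True
    define b' where "b' p = (\<lambda>g'. if g' = g then 0 else b p g')" for p
    have b': "(\<Sum>g'\<in>insert g N. b' p g' * F g' y) = f p y" for p y
      unfolding b'_def ext by (simp add: f_def)
    have "F h y = (\<Sum>p\<in>P. F h p * f p y)" if "h \<in> insert g N" "y \<in> Y" for h y
      using that P(4)[of h y] True by (auto simp: f_def r_def)
    then show ?thesis unfolding b'[symmetric] using P(1,2) fP unfolding b'[symmetric]
      by (intro exI[of _ P] exI[of _ b']) auto
  next
    case False
    then obtain y0 where y0: "y0 \<in> Y" "r y0 \<noteq> 0" by blast
    then have y0P: "y0 \<notin> P" using rP by blast
    \<comment> \<open>The normalised remainder is 1 at \<open>y0\<close> and 0 on \<open>P\<close>,
      so it is the Lagrange function of \<open>y0\<close>. Subtracting multiples of it makes the old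
      Lagrange functions vanish at \<open>y0\<close>; \<epsilon> lists its coefficients.\<close>
    define e where "e y = r y / r y0" for y
    define \<epsilon> where "\<epsilon> g' = (if g' = g then 1 / r y0 else - (\<Sum>p\<in>P. F g p * b p g') / r y0)" for g'
    have \<epsilon>: "(\<Sum>g'\<in>insert g N. \<epsilon> g' * F g' y) = e y" for y
    proof -
      have "(\<Sum>g'\<in>insert g N. \<epsilon> g' * F g' y) = 1 / r y0 * F g y + (\<Sum>g'\<in>N. - (\<Sum>p\<in>P. F g p * b p g') / r y0 * F g' y)"
        unfolding \<epsilon>_def by (rule ext)
      also have "(\<Sum>g'\<in>N. - (\<Sum>p\<in>P. F g p * b p g') / r y0 * F g' y) = - (\<Sum>g'\<in>N. \<Sum>p\<in>P. F g p * b p g' * F g' y) / r y0"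
        by (simp add: sum_distrib_right sum_divide_distrib sum_negf)
      also have "(\<Sum>g'\<in>N. \<Sum>p\<in>P. F g p * b p g' * F g' y) = (\<Sum>p\<in>P. F g p * f p y)"
        unfolding f_def by (subst sum.swap) (simp add: sum_distrib_left mult.assoc)
      finally show ?thesis by (simp add: e_def r_def diff_divide_distrib)
    qed
    define b' where "b' p g' = (if p = y0 then \<epsilon> g' else (if g' = g then 0 else b p g') - f p y0 * \<epsilon> g')" for p g'
    define f' where "f' p y = (if p = y0 then e y else f p y - f p y0 * e y)" for p y
    have b': "(\<Sum>g'\<in>insert g N. b' p g' * F g' y) = f' p y" for p y
    proof (cases "p = y0")
      case True then show ?thesis by (simp add: b'_def f'_def \<epsilon>)
    next
      case False
      have "(\<Sum>g'\<in>insert g N. b' p g' * F g' y) = (\<Sum>g'\<in>insert g N. (if g' = g then 0 else b p g') * F g' y)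
          - f p y0 * (\<Sum>g'\<in>insert g N. \<epsilon> g' * F g' y)"
        using False by (simp only: b'_def if_False left_diff_distrib sum_subtractf sum_distrib_left mult.assoc)
      then show ?thesis using False unfolding \<epsilon> ext by (simp add: f'_def f_def)
    qed
    have e: "e y0 = 1" "\<And>p. p \<in> P \<Longrightarrow> e p = 0" using y0 rP by (auto simp: e_def)
    have 1: "f' p q = (if p = q then 1 else 0)" if "p \<in> insert y0 P" "q \<in> insert y0 P" for p q
      using that e fP y0P by (auto simp: f'_def)
    have 2: "F h y = (\<Sum>p\<in>insert y0 P. F h p * f' p y)" if h: "h \<in> insert g N" and y: "y \<in> Y" for h y
    proof -
      have s: "(\<Sum>p\<in>P. F h p * f' p y) = (\<Sum>p\<in>P. F h p * f p y) - (\<Sum>p\<in>P. F h p * f p y0) * e y"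
      proof -
        have "(\<Sum>p\<in>P. F h p * f' p y) = (\<Sum>p\<in>P. F h p * f p y - F h p * f p y0 * e y)"
          using y0P by (intro sum.cong) (auto simp: f'_def algebra_simps)
        then show ?thesis by (simp add: sum_subtractf sum_distrib_right)
      qed
      have main: "(\<Sum>p\<in>insert y0 P. F h p * f' p y) = F h y0 * e y + (\<Sum>p\<in>P. F h p * f p y) - (\<Sum>p\<in>P. F h p * f p y0) * e y"
        using P(1) y0P s by (simp add: f'_def)
      show ?thesis
      proof (cases "h = g")
        case True
        have "(F g y0 - (\<Sum>p\<in>P. F g p * f p y0)) * e y = r y"
          using y0(2) by (simp add: e_def flip: r_def)
        then have "F g y0 * e y - (\<Sum>p\<in>P. F g p * f p y0) * e y = r y"
          by (simp only: left_diff_distrib)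
        then show ?thesis using main True by (simp add: r_def algebra_simps)
      next
        case False
        then have "h \<in> N" using h by simp
        then have "F h y0 = (\<Sum>p\<in>P. F h p * f p y0)" "F h y = (\<Sum>p\<in>P. F h p * f p y)"
          using P(4) y y0 unfolding f_def by blast+
        then show ?thesis using main by simp
      qed
    qed
    show ?thesis using P(1,2) y0(1) 1 2 unfolding b'[symmetric]
      by (intro exI[of _ "insert y0 P"] exI[of _ b']) auto
  qed
qed

subsection \<open>Square-summable functions on a fibre\<close>

lemma l2I:
  assumes "\<And>g. g \<notin> fiber H x \<Longrightarrow> \<xi> g = 0"
    and "\<And>D. finite D \<Longrightarrow> D \<subseteq> fiber H x \<Longrightarrow> (\<Sum>g\<in>D. (cmod (\<xi> g))\<^sup>2) \<le> B\<^sup>2" and "0 \<le> B"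
  shows "\<xi> \<in> l2 H x" "l2_norm H x \<xi> \<le> B"
proof -
  have s: "(\<lambda>g. (cmod (\<xi> g))\<^sup>2) summable_on fiber H x"
    by (rule nonneg_bdd_above_summable_on) (use assms(2) in \<open>auto intro!: bdd_aboveI[of _ "B\<^sup>2"]\<close>)
  then show "\<xi> \<in> l2 H x" using assms(1) by (simp add: l2_def)
  have "(\<Sum>\<^sub>\<infinity>g\<in>fiber H x. (cmod (\<xi> g))\<^sup>2) \<le> B\<^sup>2"
    by (rule infsum_le_finite_sums[OF s]) (use assms(2) in auto)
  then have "l2_norm H x \<xi> \<le> sqrt (B\<^sup>2)" unfolding l2_norm_def by (rule real_sqrt_le_mono)
  then show "l2_norm H x \<xi> \<le> B" using assms(3) by simp
qed

lemma l2_norm_nonneg [simp]: "0 \<le> l2_norm H x \<xi>"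
  unfolding l2_norm_def by (simp add: infsum_nonneg)

lemma l2_norm_sq: "(l2_norm H x \<xi>)\<^sup>2 = (\<Sum>\<^sub>\<infinity>g\<in>fiber H x. (cmod (\<xi> g))\<^sup>2)"
  unfolding l2_norm_def by (simp add: infsum_nonneg)

lemma l2_sum_le:
  assumes "\<xi> \<in> l2 H x" "finite D" "D \<subseteq> fiber H x"
  shows "(\<Sum>g\<in>D. (cmod (\<xi> g))\<^sup>2) \<le> (l2_norm H x \<xi>)\<^sup>2"
  unfolding l2_norm_sq using assms by (intro finite_sum_le_infsum) (auto simp: l2_def)

lemma l2_L2_set_le:
  assumes "\<xi> \<in> l2 H x" "finite D" "D \<subseteq> fiber H x"
  shows "L2_set (\<lambda>g. cmod (\<xi> g)) D \<le> l2_norm H x \<xi>"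
  unfolding L2_set_def using l2_sum_le[OF assms] by (simp add: real_le_lsqrt sum_nonneg)

lemma l2_cmod_le: "\<xi> \<in> l2 H x \<Longrightarrow> g \<in> fiber H x \<Longrightarrow> cmod (\<xi> g) \<le> l2_norm H x \<xi>"
  using l2_L2_set_le[of \<xi> H x "{g}"] by (simp add: L2_set_def)

lemma l2_lincomb:
  assumes "\<xi> \<in> l2 H x" "\<eta> \<in> l2 H x"
  shows "(\<lambda>g. c * \<xi> g + d * \<eta> g) \<in> l2 H x"
    "l2_norm H x (\<lambda>g. c * \<xi> g + d * \<eta> g) \<le> cmod c * l2_norm H x \<xi> + cmod d * l2_norm H x \<eta>"
proof -
  let ?B = "cmod c * l2_norm H x \<xi> + cmod d * l2_norm H x \<eta>"
  have 1: "c * \<xi> g + d * \<eta> g = 0" if "g \<notin> fiber H x" for g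
    using that assms by (simp add: l2_def)
  have 2: "(\<Sum>g\<in>D. (cmod (c * \<xi> g + d * \<eta> g))\<^sup>2) \<le> ?B\<^sup>2" if D: "finite D" "D \<subseteq> fiber H x" for D
  proof -
    have "L2_set (\<lambda>g. cmod (c * \<xi> g + d * \<eta> g)) D \<le> L2_set (\<lambda>g. cmod c * cmod (\<xi> g) + cmod d * cmod (\<eta> g)) D"
      by (rule L2_set_mono) (auto intro: order_trans[OF norm_triangle_ineq] simp: norm_mult)
    also have "\<dots> \<le> L2_set (\<lambda>g. cmod c * cmod (\<xi> g)) D + L2_set (\<lambda>g. cmod d * cmod (\<eta> g)) D"
      by (rule L2_set_triangle_ineq)
    also have "\<dots> = cmod c * L2_set (\<lambda>g. cmod (\<xi> g)) D + cmod d * L2_set (\<lambda>g. cmod (\<eta> g)) D"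
      by (simp add: L2_set_right_distrib)
    also have "\<dots> \<le> ?B"
      by (intro add_mono mult_left_mono l2_L2_set_le assms D) auto
    finally have "(L2_set (\<lambda>g. cmod (c * \<xi> g + d * \<eta> g)) D)\<^sup>2 \<le> ?B\<^sup>2"
      by (rule power_mono) simp
    then show ?thesis by (simp add: L2_set_def sum_nonneg)
  qed
  show "(\<lambda>g. c * \<xi> g + d * \<eta> g) \<in> l2 H x" "l2_norm H x (\<lambda>g. c * \<xi> g + d * \<eta> g) \<le> ?B"
    by (rule l2I[OF 1 2]; simp)+
qed

lemma l2_zero [simp]: "(\<lambda>_. 0) \<in> l2 H x" "l2_norm H x (\<lambda>_. 0) = 0"
  by (simp_all add: l2_def l2_norm_def)

lemma l2_scale:
  assumes "\<xi> \<in> l2 H x"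
  shows "(\<lambda>g. c * \<xi> g) \<in> l2 H x" "l2_norm H x (\<lambda>g. c * \<xi> g) \<le> cmod c * l2_norm H x \<xi>"
  using l2_lincomb[OF assms assms, of c 0] by simp_all

lemma l2_diff:
  assumes "\<xi> \<in> l2 H x" "\<eta> \<in> l2 H x"
  shows "(\<lambda>g. \<xi> g - \<eta> g) \<in> l2 H x"
    "l2_norm H x (\<lambda>g. \<xi> g - \<eta> g) \<le> l2_norm H x \<xi> + l2_norm H x \<eta>"
  using l2_lincomb[OF assms, of 1 "-1"] by simp_all

lemma l2_finite_support:
  assumes "finite D" "D \<subseteq> fiber H x" "\<And>g. g \<notin> D \<Longrightarrow> \<xi> g = 0"
  shows "\<xi> \<in> l2 H x" "(l2_norm H x \<xi>)\<^sup>2 = (\<Sum>g\<in>D. (cmod (\<xi> g))\<^sup>2)"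
proof -
  have "((\<lambda>g. (cmod (\<xi> g))\<^sup>2) has_sum (\<Sum>g\<in>D. (cmod (\<xi> g))\<^sup>2)) (fiber H x)"
    by (rule has_sum_finite_neutralI) (use assms in auto)
  then show "\<xi> \<in> l2 H x" "(l2_norm H x \<xi>)\<^sup>2 = (\<Sum>g\<in>D. (cmod (\<xi> g))\<^sup>2)"
    unfolding l2_norm_sq using assms by (auto simp: l2_def has_sum_imp_summable infsumI)
qed

text \<open>Members of \<open>bounded_operators\<close> are \<open>undefined\<close> outside
  \<open>l2\<close>, and their differences need not be; this weaker notion is stable under
  differences.\<close>

definition linear_on_l2 ::
  "('g, 'x) top_groupoid \<Rightarrow> 'x \<Rightarrow> (('g \<Rightarrow> complex) \<Rightarrow> ('g \<Rightarrow> complex)) \<Rightarrow> bool" where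
  "linear_on_l2 H x T \<longleftrightarrow> (\<forall>\<xi>\<in>l2 H x. T \<xi> \<in> l2 H x) \<and>
    (\<forall>\<xi>\<in>l2 H x. \<forall>\<eta>\<in>l2 H x. \<forall>c d. T (\<lambda>g. c * \<xi> g + d * \<eta> g) = (\<lambda>g. c * T \<xi> g + d * T \<eta> g))"

lemma bounded_operators_linear: "T \<in> bounded_operators H x \<Longrightarrow> linear_on_l2 H x T"
  unfolding bounded_operators_def linear_on_l2_def by blast

lemma linear_on_l2D:
  assumes "linear_on_l2 H x T" "\<xi> \<in> l2 H x" "\<eta> \<in> l2 H x"
  shows "T (\<lambda>g. c * \<xi> g + d * \<eta> g) = (\<lambda>g. c * T \<xi> g + d * T \<eta> g)"
  using assms(1)[unfolded linear_on_l2_def, THEN conjunct2, rule_format, OF assms(2,3)] .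

lemma linear_on_l2_diff:
  assumes "linear_on_l2 H x T" "linear_on_l2 H x S"
  shows "linear_on_l2 H x (\<lambda>\<xi> g. T \<xi> g - S \<xi> g)"
  using assms unfolding linear_on_l2_def by (auto simp: l2_diff algebra_simps fun_eq_iff)

lemma linear_on_l2_zero:
  assumes "linear_on_l2 H x T"
  shows "T (\<lambda>_. 0) = (\<lambda>_. 0)"
proof -
  have "T (\<lambda>g. 0 * 0 + 0 * 0) = (\<lambda>g. 0 * T (\<lambda>_. 0) g + 0 * T (\<lambda>_. 0) g)"
    by (rule linear_on_l2D[OF assms l2_zero(1) l2_zero(1)])
  then show ?thesis by simp
qed

lemma linear_on_l2_scale:
  assumes "linear_on_l2 H x T" "\<xi> \<in> l2 H x"
  shows "T (\<lambda>g. c * \<xi> g) = (\<lambda>g. c * T \<xi> g)"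
proof -
  have "T (\<lambda>g. c * \<xi> g + 0 * \<xi> g) = (\<lambda>g. c * T \<xi> g + 0 * T \<xi> g)"
    by (rule linear_on_l2D[OF assms assms(2)])
  then show ?thesis by simp
qed

lemma linear_on_l2_sum:
  assumes "linear_on_l2 H x T" "finite I" "\<And>i. i \<in> I \<Longrightarrow> \<xi> i \<in> l2 H x"
  shows "(\<lambda>g. \<Sum>i\<in>I. c i * \<xi> i g) \<in> l2 H x \<and> T (\<lambda>g. \<Sum>i\<in>I. c i * \<xi> i g) = (\<lambda>g. \<Sum>i\<in>I. c i * T (\<xi> i) g)"
  using assms(2,3)
proof (induction I)
  case empty
  then show ?case using linear_on_l2_zero[OF assms(1)] by simp
next
  case (insert i I)
  let ?s = "\<lambda>g. \<Sum>i\<in>I. c i * \<xi> i g"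
  have s: "?s \<in> l2 H x" "T ?s = (\<lambda>g. \<Sum>i\<in>I. c i * T (\<xi> i) g)" "\<xi> i \<in> l2 H x" using insert by auto
  have eq: "(\<lambda>g. \<Sum>i\<in>insert i I. c i * \<xi> i g) = (\<lambda>g. c i * \<xi> i g + 1 * ?s g)" using insert by simp
  have "T (\<lambda>g. c i * \<xi> i g + 1 * ?s g) = (\<lambda>g. c i * T (\<xi> i) g + 1 * T ?s g)"
    by (rule linear_on_l2D[OF assms(1) s(3,1)])
  then show ?case unfolding eq using l2_lincomb(1)[OF s(3,1), of "c i" 1] insert.hyps s(2) by simp
qed

lemma operator_norm_bound:
  assumes "linear_on_l2 H x T" "operator_norm H x T \<le> ennreal \<epsilon>" "0 \<le> \<epsilon>" "\<xi> \<in> l2 H x"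
  shows "l2_norm H x (T \<xi>) \<le> \<epsilon> * l2_norm H x \<xi>"
proof (cases "l2_norm H x \<xi> = 0")
  case True
  have "\<xi> = (\<lambda>_. 0)"
  proof
    fix g show "\<xi> g = 0"
    proof (cases "g \<in> fiber H x")
      case True then show ?thesis using l2_cmod_le[OF assms(4), of g] \<open>l2_norm H x \<xi> = 0\<close> by simp
    qed (use assms(4) in \<open>simp add: l2_def\<close>)
  qed
  then show ?thesis using linear_on_l2_zero[OF assms(1)] by simp
next
  case False
  let ?n = "l2_norm H x \<xi>"
  let ?\<eta> = "\<lambda>g. complex_of_real (1 / ?n) * \<xi> g"
  have n: "?n > 0" using False l2_norm_nonneg[of H x \<xi>] by linarith
  have \<eta>: "?\<eta> \<in> l2 H x" "l2_norm H x ?\<eta> \<le> 1"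
    using l2_scale[OF assms(4), of "complex_of_real (1 / ?n)"] n by (simp_all add: norm_divide)
  then have "ennreal (l2_norm H x (T ?\<eta>)) \<le> operator_norm H x T"
    unfolding operator_norm_def by (intro SUP_upper) simp
  then have "ennreal (l2_norm H x (T ?\<eta>)) \<le> ennreal \<epsilon>" using assms(2) by (rule order_trans)
  then have b: "l2_norm H x (T ?\<eta>) \<le> \<epsilon>" using assms(3) by simp
  have T\<eta>: "T ?\<eta> \<in> l2 H x" using assms(1) \<eta>(1) unfolding linear_on_l2_def by blast
  have "(\<lambda>g. complex_of_real ?n * ?\<eta> g) = \<xi>" using n by (simp add: fun_eq_iff)
  then have "T \<xi> = (\<lambda>g. complex_of_real ?n * T ?\<eta> g)"
    using linear_on_l2_scale[OF assms(1) \<eta>(1), of "complex_of_real ?n"] by simp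
  then have "l2_norm H x (T \<xi>) \<le> ?n * l2_norm H x (T ?\<eta>)"
    using l2_scale(2)[OF T\<eta>, of "complex_of_real ?n"] n by simp
  also have "\<dots> \<le> ?n * \<epsilon>" using b n by simp
  finally show ?thesis by (simp add: mult.commute)
qed

text \<open>Translates the supremum in the extended reals into inequalities between reals, the form
  in which norms are estimated below.\<close>

lemma reduced_norm_le_iff:
  assumes "0 \<le> \<epsilon>" "\<And>x. x \<in> topspace (objects H) \<Longrightarrow> linear_on_l2 H x (a x)"
  shows "reduced_norm H a \<le> ennreal \<epsilon> \<longleftrightarrow>
    (\<forall>x\<in>topspace (objects H). \<forall>\<xi>\<in>l2 H x. l2_norm H x (a x \<xi>) \<le> \<epsilon> * l2_norm H x \<xi>)"
proof
  assume L: "reduced_norm H a \<le> ennreal \<epsilon>"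
  then have "operator_norm H x (a x) \<le> ennreal \<epsilon>" if "x \<in> topspace (objects H)" for x
    using that unfolding reduced_norm_def by (meson SUP_le_iff)
  then show "\<forall>x\<in>topspace (objects H). \<forall>\<xi>\<in>l2 H x. l2_norm H x (a x \<xi>) \<le> \<epsilon> * l2_norm H x \<xi>"
    using operator_norm_bound[OF assms(2)] assms(1) by blast
next
  assume R: "\<forall>x\<in>topspace (objects H). \<forall>\<xi>\<in>l2 H x. l2_norm H x (a x \<xi>) \<le> \<epsilon> * l2_norm H x \<xi>"
  show "reduced_norm H a \<le> ennreal \<epsilon>"
    unfolding reduced_norm_def operator_norm_def
  proof (intro SUP_least)
    fix x \<xi> assume x: "x \<in> topspace (objects H)" and "\<xi> \<in> {\<xi> \<in> l2 H x. l2_norm H x \<xi> \<le> 1}"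
    then have "l2_norm H x (a x \<xi>) \<le> \<epsilon> * l2_norm H x \<xi>" "\<epsilon> * l2_norm H x \<xi> \<le> \<epsilon> * 1"
      using R assms(1) by (auto simp: mult_left_le)
    then show "ennreal (l2_norm H x (a x \<xi>)) \<le> ennreal \<epsilon>" by (simp add: ennreal_leI)
  qed
qed

subsection \<open>Convolution operators\<close>

context self_similar_action
begin

abbreviation fib where "fib \<equiv> fiber G"

lemma fib_iff: "\<gamma> \<in> fib x \<longleftrightarrow> \<gamma> \<in> arr \<and> src G \<gamma> = x"
  by (auto simp: fiber_def)

text \<open>Turns the infinite sum in \<open>convol\<close> into a finite one in every row, so that
  linearity in both arguments holds without any summability argument.\<close>

definition rowfin :: "('a germ \<Rightarrow> complex) \<Rightarrow> bool" where
  "rowfin f \<longleftrightarrow> (\<forall>x. \<forall>\<delta>\<in>fib x. finite {h \<in> fib x. f (gdiv \<delta> h) \<noteq> 0})"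

lemma convol_outside: "\<delta> \<notin> arr \<Longrightarrow> convol G f \<xi> \<delta> = 0"
  by (simp add: convol_def)

lemma convol_eq_sum:
  assumes "\<delta> \<in> fib x" "finite H" "H \<subseteq> fib x" "\<And>h. h \<in> fib x - H \<Longrightarrow> f (gdiv \<delta> h) = 0"
  shows "convol G f \<xi> \<delta> = (\<Sum>h\<in>H. f (gdiv \<delta> h) * \<xi> h)"
proof -
  have "convol G f \<xi> \<delta> = (\<Sum>\<^sub>\<infinity>h\<in>fib x. f (gdiv \<delta> h) * \<xi> h)"
    using assms(1) by (simp add: convol_def fib_iff gdiv_def)
  also have "\<dots> = (\<Sum>\<^sub>\<infinity>h\<in>H. f (gdiv \<delta> h) * \<xi> h)"
    by (rule infsum_cong_neutral) (use assms in auto)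
  finally show ?thesis using assms(2) by simp
qed

lemma convol_rowfin:
  assumes "rowfin f" "\<delta> \<in> fib x"
  shows "convol G f \<xi> \<delta> = (\<Sum>h\<in>{h \<in> fib x. f (gdiv \<delta> h) \<noteq> 0}. f (gdiv \<delta> h) * \<xi> h)"
  by (rule convol_eq_sum[OF assms(2)]) (use assms in \<open>auto simp: rowfin_def\<close>)

lemma rowfin_lincomb:
  assumes "\<And>i. i \<in> I \<Longrightarrow> rowfin (f i)" "finite I"
  shows "rowfin (\<lambda>g. \<Sum>i\<in>I. c i * f i g)"
  unfolding rowfin_def
proof (intro allI ballI)
  fix x \<delta> assume \<delta>: "\<delta> \<in> fib x"
  have "{h \<in> fib x. (\<Sum>i\<in>I. c i * f i (gdiv \<delta> h)) \<noteq> 0} \<subseteq> (\<Union>i\<in>I. {h \<in> fib x. f i (gdiv \<delta> h) \<noteq> 0})"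
  proof
    fix h assume "h \<in> {h \<in> fib x. (\<Sum>i\<in>I. c i * f i (gdiv \<delta> h)) \<noteq> 0}"
    then have h: "h \<in> fib x" "(\<Sum>i\<in>I. c i * f i (gdiv \<delta> h)) \<noteq> 0" by simp_all
    obtain i where "i \<in> I" "c i * f i (gdiv \<delta> h) \<noteq> 0"
      using h(2) by (rule sum.not_neutral_contains_not_neutral)
    then show "h \<in> (\<Union>i\<in>I. {h \<in> fib x. f i (gdiv \<delta> h) \<noteq> 0})" using h(1) by auto
  qed
  moreover have "finite (\<Union>i\<in>I. {h \<in> fib x. f i (gdiv \<delta> h) \<noteq> 0})"
    using assms \<delta> by (auto simp: rowfin_def)
  ultimately show "finite {h \<in> fib x. (\<Sum>i\<in>I. c i * f i (gdiv \<delta> h)) \<noteq> 0}" by (rule finite_subset)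
qed

lemma convol_sum:
  assumes "\<And>i. i \<in> I \<Longrightarrow> rowfin (f i)" "finite I"
  shows "convol G (\<lambda>g. \<Sum>i\<in>I. c i * f i g) \<xi> = (\<lambda>\<delta>. \<Sum>i\<in>I. c i * convol G (f i) \<xi> \<delta>)"
proof
  fix \<delta>
  show "convol G (\<lambda>g. \<Sum>i\<in>I. c i * f i g) \<xi> \<delta> = (\<Sum>i\<in>I. c i * convol G (f i) \<xi> \<delta>)"
  proof (cases "\<delta> \<in> arr")
    case False then show ?thesis by (simp add: convol_outside)
  next
    case True
    then have \<delta>: "\<delta> \<in> fib (src G \<delta>)" by (simp add: fib_iff)
    let ?x = "src G \<delta>"
    let ?H = "\<Union>i\<in>I. {h \<in> fib ?x. f i (gdiv \<delta> h) \<noteq> 0}"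
    have fin: "finite ?H" using assms \<delta> by (auto simp: rowfin_def)
    have "convol G (\<lambda>g. \<Sum>i\<in>I. c i * f i g) \<xi> \<delta> = (\<Sum>h\<in>?H. (\<Sum>i\<in>I. c i * f i (gdiv \<delta> h)) * \<xi> h)"
      by (rule convol_eq_sum[OF \<delta> fin]) (auto intro!: sum.neutral)
    also have "\<dots> = (\<Sum>i\<in>I. c i * (\<Sum>h\<in>?H. f i (gdiv \<delta> h) * \<xi> h))"
      by (simp add: sum_distrib_right sum_distrib_left mult.assoc) (rule sum.swap)
    also have "\<dots> = (\<Sum>i\<in>I. c i * convol G (f i) \<xi> \<delta>)"
      by (intro sum.cong refl arg_cong[of _ _ "\<lambda>x. _ * x"] convol_eq_sum[OF \<delta> fin, symmetric]) auto
    finally show ?thesis .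
  qed
qed

lemma convol_lin:
  assumes "rowfin f"
  shows "convol G f (\<lambda>g. c * \<xi> g + d * \<eta> g) = (\<lambda>g. c * convol G f \<xi> g + d * convol G f \<eta> g)"
proof
  fix \<delta>
  show "convol G f (\<lambda>g. c * \<xi> g + d * \<eta> g) \<delta> = c * convol G f \<xi> \<delta> + d * convol G f \<eta> \<delta>"
  proof (cases "\<delta> \<in> arr")
    case False then show ?thesis by (simp add: convol_outside)
  next
    case True
    then have \<delta>: "\<delta> \<in> fib (src G \<delta>)" by (simp add: fib_iff)
    show ?thesis unfolding convol_rowfin[OF assms \<delta>]
      by (simp add: distrib_left sum.distrib sum_distrib_left mult.left_commute)
  qed
qed

text \<open>Reduced norm at most \<open>B\<close>, stated without extended reals and bundled with
  row finiteness.\<close>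

definition rep_bound :: "('a germ \<Rightarrow> complex) \<Rightarrow> real \<Rightarrow> bool" where
  "rep_bound f B \<longleftrightarrow> rowfin f \<and> 0 \<le> B \<and>
    (\<forall>x. \<forall>\<xi>\<in>l2 G x. convol G f \<xi> \<in> l2 G x \<and> l2_norm G x (convol G f \<xi>) \<le> B * l2_norm G x \<xi>)"

lemma convol_off_fiber:
  assumes "rowfin f" "\<xi> \<in> l2 G x" "\<delta> \<notin> fib x"
  shows "convol G f \<xi> \<delta> = 0"
proof (cases "\<delta> \<in> arr")
  case True
  then have \<delta>: "\<delta> \<in> fib (src G \<delta>)" "src G \<delta> \<noteq> x" using assms(3) by (auto simp: fib_iff)
  have "\<xi> h = 0" if "h \<in> fib (src G \<delta>)" for h
    using assms(2) \<delta>(2) that by (auto simp: l2_def fib_iff)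
  then show ?thesis unfolding convol_rowfin[OF assms(1) \<delta>(1)] by (intro sum.neutral) auto
qed (simp add: convol_outside)

lemma rep_boundI:
  assumes "rowfin f" "0 \<le> B"
    and "\<And>x \<xi> D. \<xi> \<in> l2 G x \<Longrightarrow> finite D \<Longrightarrow> D \<subseteq> fib x \<Longrightarrow>
      (\<Sum>\<delta>\<in>D. (cmod (convol G f \<xi> \<delta>))\<^sup>2) \<le> B\<^sup>2 * (l2_norm G x \<xi>)\<^sup>2"
  shows "rep_bound f B"
  unfolding rep_bound_def
proof (intro conjI allI ballI assms(1,2))
  fix x \<xi> assume \<xi>: "\<xi> \<in> l2 G x"
  have 1: "\<And>g. g \<notin> fib x \<Longrightarrow> convol G f \<xi> g = 0" by (rule convol_off_fiber[OF assms(1) \<xi>])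
  have 2: "\<And>D. finite D \<Longrightarrow> D \<subseteq> fib x \<Longrightarrow> (\<Sum>\<delta>\<in>D. (cmod (convol G f \<xi> \<delta>))\<^sup>2) \<le> (B * l2_norm G x \<xi>)\<^sup>2"
    using assms(3)[OF \<xi>] by (simp add: power_mult_distrib)
  have 3: "0 \<le> B * l2_norm G x \<xi>" using assms(2) by simp
  show "convol G f \<xi> \<in> l2 G x" by (rule l2I(1)[OF 1 2 3])
  show "l2_norm G x (convol G f \<xi>) \<le> B * l2_norm G x \<xi>" by (rule l2I(2)[OF 1 2 3])
qed

lemma rep_bound_lincomb2:
  assumes "rep_bound f A" "rep_bound f' B"
  shows "rep_bound (\<lambda>g. c * f g + d * f' g) (cmod c * A + cmod d * B)"
proof -
  have r: "rowfin f" "rowfin f'" using assms by (auto simp: rep_bound_def)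
  let ?f = "\<lambda>b. if b then f else f'" and ?c = "\<lambda>b. if b then c else d"
  have eq: "(\<lambda>g. c * f g + d * f' g) = (\<lambda>g. \<Sum>b\<in>{True, False}. ?c b * ?f b g)" by simp
  have rf: "rowfin (\<lambda>g. c * f g + d * f' g)" unfolding eq by (rule rowfin_lincomb) (use r in auto)
  have cv: "convol G (\<lambda>g. c * f g + d * f' g) \<xi> = (\<lambda>\<delta>. c * convol G f \<xi> \<delta> + d * convol G f' \<xi> \<delta>)" for \<xi>
    unfolding eq by (subst convol_sum) (use r in auto)
  show ?thesis unfolding rep_bound_def
  proof (intro conjI allI ballI rf)
    show "0 \<le> cmod c * A + cmod d * B" using assms by (simp add: rep_bound_def)
    fix x \<xi> assume \<xi>: "\<xi> \<in> l2 G x"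
    then have b: "convol G f \<xi> \<in> l2 G x" "convol G f' \<xi> \<in> l2 G x"
      "l2_norm G x (convol G f \<xi>) \<le> A * l2_norm G x \<xi>" "l2_norm G x (convol G f' \<xi>) \<le> B * l2_norm G x \<xi>"
      using assms by (auto simp: rep_bound_def)
    show "convol G (\<lambda>g. c * f g + d * f' g) \<xi> \<in> l2 G x"
      unfolding cv by (rule l2_lincomb(1)[OF b(1,2)])
    have "l2_norm G x (convol G (\<lambda>g. c * f g + d * f' g) \<xi>) \<le>
        cmod c * l2_norm G x (convol G f \<xi>) + cmod d * l2_norm G x (convol G f' \<xi>)"
      unfolding cv by (rule l2_lincomb(2)[OF b(1,2)])
    also have "\<dots> \<le> cmod c * (A * l2_norm G x \<xi>) + cmod d * (B * l2_norm G x \<xi>)"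
      by (intro add_mono mult_left_mono b) auto
    finally show "l2_norm G x (convol G (\<lambda>g. c * f g + d * f' g) \<xi>) \<le> (cmod c * A + cmod d * B) * l2_norm G x \<xi>"
      by (simp add: algebra_simps)
  qed
qed

lemma rep_bound_zero: "rep_bound (\<lambda>_. 0) 0"
proof (rule rep_boundI)
  show "rowfin (\<lambda>_. 0)" by (simp add: rowfin_def)
  fix x \<xi> D
  show "(\<Sum>\<delta>\<in>D. (cmod (convol G (\<lambda>_. 0) \<xi> \<delta>))\<^sup>2) \<le> 0\<^sup>2 * (l2_norm G x \<xi>)\<^sup>2"
    by (simp add: convol_def cong: if_cong)
qed simp

lemma rep_bound_sum:
  assumes "finite I" "\<And>i. i \<in> I \<Longrightarrow> rep_bound (f i) (B i)"
  shows "rep_bound (\<lambda>g. \<Sum>i\<in>I. c i * f i g) (\<Sum>i\<in>I. cmod (c i) * B i)"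
  using assms
proof (induction I)
  case empty then show ?case by (simp add: rep_bound_zero)
next
  case (insert i I)
  have "rep_bound (\<lambda>g. c i * f i g + 1 * (\<Sum>i\<in>I. c i * f i g)) (cmod (c i) * B i + cmod 1 * (\<Sum>i\<in>I. cmod (c i) * B i))"
    by (rule rep_bound_lincomb2) (use insert in auto)
  then show ?case using insert.hyps by simp
qed

lemma rep_bound_mono: "rep_bound f A \<Longrightarrow> A \<le> B \<Longrightarrow> rep_bound f B"
  unfolding rep_bound_def by (meson l2_norm_nonneg mult_right_mono order_trans)

lemma regular_rep_apply: "\<xi> \<in> l2 G x \<Longrightarrow> regular_rep G f x \<xi> = convol G f \<xi>"
  by (simp add: regular_rep_def)

lemma rep_bound_linear:
  assumes "rep_bound f B"
  shows "linear_on_l2 G x (regular_rep G f x)"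
  unfolding linear_on_l2_def
proof (intro conjI ballI allI)
  fix \<xi> \<eta> c d assume "\<xi> \<in> l2 G x" "\<eta> \<in> l2 G x"
  then show "regular_rep G f x (\<lambda>g. c * \<xi> g + d * \<eta> g) =
      (\<lambda>g. c * regular_rep G f x \<xi> g + d * regular_rep G f x \<eta> g)"
    using assms by (simp only: regular_rep_apply l2_lincomb(1) rep_bound_def convol_lin)
qed (use assms in \<open>simp add: rep_bound_def regular_rep_apply\<close>)

lemma rep_bound_bounded_operators:
  assumes "rep_bound f B"
  shows "regular_rep G f \<in> (\<Pi>\<^sub>E x\<in>topspace (objects G). bounded_operators G x)"
proof -
  have "regular_rep G f x \<in> bounded_operators G x" for x
  proof -
    have "regular_rep G f x \<in> l2 G x \<rightarrow>\<^sub>E l2 G x"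
      using rep_bound_linear[OF assms, of x] by (auto simp: regular_rep_def linear_on_l2_def)
    moreover have "\<forall>\<xi>\<in>l2 G x. l2_norm G x (regular_rep G f x \<xi>) \<le> B * l2_norm G x \<xi>"
      using assms by (simp add: rep_bound_def regular_rep_apply)
    ultimately show ?thesis
      using rep_bound_linear[OF assms, of x] unfolding bounded_operators_def linear_on_l2_def by blast
  qed
  then show ?thesis by (auto simp: regular_rep_def)
qed

text \<open>A function supported on a bisection has at most one non-zero entry in each row and column.\<close>

lemma rep_bound_bisection:
  assumes U: "U \<subseteq> arr" "inj_on (rng G) U" "inj_on (src G) U"
    and f: "\<And>g. g \<notin> U \<Longrightarrow> f g = 0" "\<And>g. cmod (f g) \<le> B" and "0 \<le> B"
  shows "rep_bound f B"
proof (rule rep_boundI)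
  have uniq: "h = h'" if "\<delta> \<in> fib x" "h \<in> fib x" "h' \<in> fib x" "f (gdiv \<delta> h) \<noteq> 0" "f (gdiv \<delta> h') \<noteq> 0" for x \<delta> h h'
  proof -
    have "gdiv \<delta> h \<in> U" "gdiv \<delta> h' \<in> U" using that f by blast+
    moreover have "rng G (gdiv \<delta> h) = rng G (gdiv \<delta> h')" using that by (simp add: fib_iff gdiv_props)
    ultimately have "gdiv \<delta> h = gdiv \<delta> h'" using U(2) by (auto dest: inj_onD)
    then show ?thesis using that gdiv_inject[of \<delta> h \<delta> h'] by (simp add: fib_iff)
  qed
  have uniq': "\<delta> = \<delta>'" if "\<delta> \<in> fib x" "\<delta>' \<in> fib x" "h \<in> fib x" "f (gdiv \<delta> h) \<noteq> 0" "f (gdiv \<delta>' h) \<noteq> 0" for x \<delta> \<delta>' h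
  proof -
    have "gdiv \<delta> h \<in> U" "gdiv \<delta>' h \<in> U" using that f by blast+
    moreover have "src G (gdiv \<delta> h) = src G (gdiv \<delta>' h)" using that by (simp add: fib_iff gdiv_props)
    ultimately have "gdiv \<delta> h = gdiv \<delta>' h" using U(3) by (auto dest: inj_onD)
    then show ?thesis using that gdiv_inject[of \<delta> h \<delta>' h] by (simp add: fib_iff)
  qed
  show "rowfin f" unfolding rowfin_def
  proof (intro allI ballI)
    fix x \<delta> assume "\<delta> \<in> fib x"
    show "finite {h \<in> fib x. f (gdiv \<delta> h) \<noteq> 0}"
    proof (cases "\<exists>h\<in>fib x. f (gdiv \<delta> h) \<noteq> 0")
      case True
      then obtain k where "k \<in> fib x" "f (gdiv \<delta> k) \<noteq> 0" by auto
      then have "{h \<in> fib x. f (gdiv \<delta> h) \<noteq> 0} \<subseteq> {k}" using uniq[OF \<open>\<delta> \<in> fib x\<close>] by auto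
      then show ?thesis by (rule finite_subset) simp
    next
      case False
      then have "{h \<in> fib x. f (gdiv \<delta> h) \<noteq> 0} = {}" by blast
      then show ?thesis by (simp only: finite.emptyI)
    qed
  qed
  show "0 \<le> B" by fact
  fix x \<xi> D assume \<xi>: "\<xi> \<in> l2 G x" and D: "finite D" "D \<subseteq> fib x"
  define D' where "D' = {\<delta> \<in> D. \<exists>h\<in>fib x. f (gdiv \<delta> h) \<noteq> 0}"
  define k where "k \<delta> = (SOME h. h \<in> fib x \<and> f (gdiv \<delta> h) \<noteq> 0)" for \<delta>
  have k: "k \<delta> \<in> fib x" "f (gdiv \<delta> (k \<delta>)) \<noteq> 0" if "\<delta> \<in> D'" for \<delta>
    using that someI_ex[of "\<lambda>h. h \<in> fib x \<and> f (gdiv \<delta> h) \<noteq> 0"] unfolding D'_def k_def by blast+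
  have D'D: "D' \<subseteq> D" by (auto simp: D'_def)
  have zero: "convol G f \<xi> \<delta> = 0" if "\<delta> \<in> D - D'" for \<delta>
  proof -
    have "convol G f \<xi> \<delta> = (\<Sum>h\<in>{}. f (gdiv \<delta> h) * \<xi> h)"
      by (rule convol_eq_sum[of _ x]) (use that D D'_def in auto)
    then show ?thesis by simp
  qed
  have val: "cmod (convol G f \<xi> \<delta>) \<le> B * cmod (\<xi> (k \<delta>))" if "\<delta> \<in> D'" for \<delta>
  proof -
    have "\<delta> \<in> fib x" using that D D'D by blast
    then have "convol G f \<xi> \<delta> = (\<Sum>h\<in>{k \<delta>}. f (gdiv \<delta> h) * \<xi> h)"
    proof (rule convol_eq_sum)
      show "finite {k \<delta>}" "{k \<delta>} \<subseteq> fib x" using k(1)[OF that] by simp_all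
      fix h assume h: "h \<in> fib x - {k \<delta>}"
      then have "h \<in> fib x" "h \<noteq> k \<delta>" by auto
      then show "f (gdiv \<delta> h) = 0" using uniq[OF \<open>\<delta> \<in> fib x\<close> _ k(1)[OF that] _ k(2)[OF that]] by metis
    qed
    then show ?thesis using f(2) by (simp add: norm_mult mult_right_mono)
  qed
  have inj: "inj_on k D'"
  proof (rule inj_onI)
    fix \<delta> \<delta>' assume d: "\<delta> \<in> D'" "\<delta>' \<in> D'" "k \<delta> = k \<delta>'"
    then have "\<delta> \<in> fib x" "\<delta>' \<in> fib x" using D(2) D'D by auto
    then show "\<delta> = \<delta>'"
      by (rule uniq'[OF _ _ k(1)[OF d(1)] k(2)[OF d(1)]]) (simp add: d(3) k(2)[OF d(2)])
  qed
  have "(\<Sum>\<delta>\<in>D. (cmod (convol G f \<xi> \<delta>))\<^sup>2) = (\<Sum>\<delta>\<in>D'. (cmod (convol G f \<xi> \<delta>))\<^sup>2)"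
    by (rule sum.mono_neutral_right[OF D(1) D'D]) (use zero in auto)
  also have "\<dots> \<le> (\<Sum>\<delta>\<in>D'. B\<^sup>2 * (cmod (\<xi> (k \<delta>)))\<^sup>2)"
    using val by (intro sum_mono) (metis norm_ge_zero power_mono power_mult_distrib)
  also have "\<dots> = B\<^sup>2 * (\<Sum>h\<in>k ` D'. (cmod (\<xi> h))\<^sup>2)"
    by (simp add: sum.reindex[OF inj] sum_distrib_left)
  also have "\<dots> \<le> B\<^sup>2 * (l2_norm G x \<xi>)\<^sup>2"
    by (intro mult_left_mono l2_sum_le[OF \<xi>]) (use k finite_subset[OF D'D D(1)] in auto)
  finally show "(\<Sum>\<delta>\<in>D. (cmod (convol G f \<xi> \<delta>))\<^sup>2) \<le> B\<^sup>2 * (l2_norm G x \<xi>)\<^sup>2" .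
qed

lemma open_bisection_inj:
  assumes "open_bisection G U"
  shows "U \<subseteq> arr" "inj_on (rng G) U" "inj_on (src G) U"
proof -
  show U: "U \<subseteq> arr" using assms openin_subset unfolding open_bisection_def by blast
  show "inj_on (rng G) U" "inj_on (src G) U"
    using assms U homeomorphic_imp_injective_map unfolding open_bisection_def
    by (metis topspace_subtopology_subset)+
qed

lemma rep_bound_indicator:
  assumes "T \<in> IS"
  shows "rep_bound (indicator (bisec T)) 1"
  by (rule rep_bound_bisection[OF open_bisection_inj[OF open_bisection_bisec[OF assms]]])
    (auto simp: indicator_def)

end

text \<open>A submatrix has at most the norm of the operator: the vector \<open>z\<close> is placed
  on the columns \<open>k\<close>, the operator is applied, and only the rows \<open>r\<close> are
  kept.\<close>

lemma kernel_matrix_bound: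
  assumes T: "linear_on_l2 H x T" "\<And>\<xi>. \<xi> \<in> l2 H x \<Longrightarrow> l2_norm H x (T \<xi>) \<le> \<epsilon> * l2_norm H x \<xi>"
    and W: "finite W" "k ` W \<subseteq> fiber H x" "inj_on k W" "r ` W \<subseteq> fiber H x" "inj_on r W" and "0 \<le> \<epsilon>"
  shows "(\<Sum>v\<in>W. (cmod (\<Sum>u\<in>W. T (indicator {k u}) (r v) * z u))\<^sup>2) \<le> \<epsilon>\<^sup>2 * (\<Sum>u\<in>W. (cmod (z u))\<^sup>2)"
proof -
  define \<xi> where "\<xi> = (\<lambda>g. \<Sum>u\<in>W. z u * indicator {k u} g)"
  have ind: "indicator {k u} \<in> l2 H x" if "u \<in> W" for u
    by (rule l2_finite_support(1)[of "{k u}"]) (use W that in auto)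
  have \<xi>l2: "\<xi> \<in> l2 H x" and T\<xi>: "T \<xi> = (\<lambda>g. \<Sum>u\<in>W. z u * T (indicator {k u}) g)"
    using linear_on_l2_sum[OF T(1) W(1), of "\<lambda>u. indicator {k u}" z] ind unfolding \<xi>_def by auto
  have \<xi>k: "\<xi> (k u) = z u" if "u \<in> W" for u
  proof -
    have "\<xi> (k u) = (\<Sum>u'\<in>W. if u' = u then z u' else 0)"
      unfolding \<xi>_def using W(3) that by (intro sum.cong) (auto simp: indicator_def dest: inj_onD)
    then show ?thesis using that W(1) by simp
  qed
  have "\<xi> g = 0" if "g \<notin> k ` W" for g
    unfolding \<xi>_def using that by (intro sum.neutral) (auto simp: indicator_def)
  then have n\<xi>: "(l2_norm H x \<xi>)\<^sup>2 = (\<Sum>u\<in>W. (cmod (z u))\<^sup>2)"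
    using l2_finite_support(2)[of "k ` W" H x \<xi>] W \<xi>k by (simp add: sum.reindex)
  have T\<xi>l2: "T \<xi> \<in> l2 H x" using T(1) \<xi>l2 unfolding linear_on_l2_def by blast
  have "(\<Sum>v\<in>W. (cmod (\<Sum>u\<in>W. T (indicator {k u}) (r v) * z u))\<^sup>2) = (\<Sum>v\<in>W. (cmod (T \<xi> (r v)))\<^sup>2)"
    unfolding T\<xi> by (simp add: mult.commute)
  also have "\<dots> = (\<Sum>g\<in>r ` W. (cmod (T \<xi> g))\<^sup>2)" using W(5) by (simp add: sum.reindex)
  also have "\<dots> \<le> (l2_norm H x (T \<xi>))\<^sup>2" using l2_sum_le[OF T\<xi>l2, of "r ` W"] W by simp
  also have "\<dots> \<le> (\<epsilon> * l2_norm H x \<xi>)\<^sup>2" by (rule power_mono[OF T(2)[OF \<xi>l2]]) simp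
  finally show ?thesis by (simp add: power_mult_distrib n\<xi>)
qed

text \<open>In \<open>cspan\<close> coefficients are attached to functions, so indices with the same
  function are merged by adding their coefficients.\<close>

lemma cspan_sum:
  assumes "finite I" "\<And>i. i \<in> I \<Longrightarrow> f i \<in> S"
  shows "(\<lambda>g. \<Sum>i\<in>I. c i * f i g) \<in> cspan S"
proof -
  have "(\<lambda>g. \<Sum>i\<in>I. c i * f i g) = (\<lambda>g. \<Sum>h\<in>f ` I. (\<Sum>i\<in>{i \<in> I. f i = h}. c i) * h g)"
  proof
    fix g
    have "(\<Sum>i\<in>I. c i * f i g) = (\<Sum>h\<in>f ` I. \<Sum>i\<in>{i \<in> I. f i = h}. c i * f i g)"
      by (rule sum.image_gen[OF assms(1)])
    also have "\<dots> = (\<Sum>h\<in>f ` I. (\<Sum>i\<in>{i \<in> I. f i = h}. c i) * h g)"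
      by (rule sum.cong[OF refl]) (auto simp: sum_distrib_right intro!: sum.cong)
    finally show "(\<Sum>i\<in>I. c i * f i g) = (\<Sum>h\<in>f ` I. (\<Sum>i\<in>{i \<in> I. f i = h}. c i) * h g)" .
  qed
  moreover have "finite (f ` I)" "f ` I \<subseteq> S" using assms by auto
  ultimately show ?thesis unfolding cspan_def mem_Collect_eq
    by (intro exI[of _ "f ` I"] exI[of _ "\<lambda>h. \<Sum>i\<in>{i \<in> I. f i = h}. c i"] conjI)
qed

context self_similar_action
begin

subsection \<open>Matrix-like operators\<close>

lemma tr_cmap_Nil_props:
  assumes "g \<in> carrier \<Gamma>" "\<gamma> \<in> fib x"
  shows "tr (cmap [] g u) \<gamma> \<in> fib x" "rng G (tr (cmap [] g u) \<gamma>) = u \<frown> act g (rng G \<gamma>)"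
  using tr_props[of "cmap [] g u" \<gamma>] assms by (auto simp: fib_iff)

text \<open>The range of the translate starts with the prepended word, so words of equal length can
  be read off; then the translation is cancelled.\<close>

lemma tr_cmap_Nil_inject:
  assumes "g \<in> carrier \<Gamma>" "\<gamma> \<in> fib x" "\<gamma>' \<in> fib y" "length u = length u'"
    and "tr (cmap [] g u) \<gamma> = tr (cmap [] g u') \<gamma>'"
  shows "u = u'" "\<gamma> = \<gamma>'"
proof -
  have "u \<frown> act g (rng G \<gamma>) = u' \<frown> act g (rng G \<gamma>')"
    using tr_cmap_Nil_props(2)[OF assms(1,2)] tr_cmap_Nil_props(2)[OF assms(1,3)] assms(5) by metis
  then show "u = u'" using assms(4) by simp
  then show "\<gamma> = \<gamma>'" using tr_inject[of "cmap [] g u" \<gamma> \<gamma>'] assms by (simp add: fib_iff)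
qed

lemma tr_Some: "\<gamma> \<in> arr \<Longrightarrow> tr Some \<gamma> = \<gamma>"
  by (erule arrE) (use tr_germ[of Some] in auto)

lemma cmap_factor_Nil:
  assumes "g \<in> carrier \<Gamma>"
  shows "cmap u g v = cmap [] \<one>\<^bsub>\<Gamma>\<^esub> v \<circ>\<^sub>m cmap u g []"
    and "cmap u g v \<circ>\<^sub>m cmap [] (inv\<^bsub>\<Gamma>\<^esub> g) u = cmap [] \<one>\<^bsub>\<Gamma>\<^esub> v"
proof -
  show "cmap u g v = cmap [] \<one>\<^bsub>\<Gamma>\<^esub> v \<circ>\<^sub>m cmap u g []"
  proof
    fix \<zeta> show "cmap u g v \<zeta> = (cmap [] \<one>\<^bsub>\<Gamma>\<^esub> v \<circ>\<^sub>m cmap u g []) \<zeta>"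
      by (cases "\<zeta> \<in> cyl u") (auto simp: map_comp_def cylinder_map_def)
  qed
  show "cmap u g v \<circ>\<^sub>m cmap [] (inv\<^bsub>\<Gamma>\<^esub> g) u = cmap [] \<one>\<^bsub>\<Gamma>\<^esub> v"
    by (rule ext) (use assms in \<open>simp add: map_comp_def\<close>)
qed

text \<open>Symmetric form of the kernel: \<delta> and \<open>h\<close> arise from one arrow
  \<gamma>, by prepending \<open>v\<close>, and by applying the inverse of \<open>g\<close> and
  prepending \<open>u\<close>. This lets a matrix indexed by words act at each \<gamma>
  separately.\<close>

lemma gdiv_in_bisec_cmap:
  assumes "\<delta> \<in> fib x" "h \<in> fib x" "g \<in> carrier \<Gamma>"
  shows "gdiv \<delta> h \<in> bisec (cmap u g v) \<longleftrightarrow>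
    (\<exists>\<gamma>\<in>fib x. \<delta> = tr (cmap [] \<one>\<^bsub>\<Gamma>\<^esub> v) \<gamma> \<and> h = tr (cmap [] (inv\<^bsub>\<Gamma>\<^esub> g) u) \<gamma>)"
proof -
  have d: "gdiv \<delta> h \<in> bisec (cmap u g v) \<longleftrightarrow> rng G h \<in> cyl u \<and> \<delta> = tr (cmap u g v) h"
    using gdiv_in_bisec[of \<delta> h "cmap u g v"] assms by (simp add: fib_iff)
  show ?thesis unfolding d
  proof
    assume L: "rng G h \<in> cyl u \<and> \<delta> = tr (cmap u g v) h"
    then obtain \<eta> where \<eta>: "rng G h = u \<frown> \<eta>" by blast
    define \<gamma> where "\<gamma> = tr (cmap u g []) h"
    have \<gamma>: "\<gamma> \<in> fib x" "rng G \<gamma> = act g \<eta>"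
      using tr_props[of "cmap u g []" h "act g \<eta>"] assms \<eta> unfolding \<gamma>_def by (auto simp: fib_iff)
    have 1: "\<delta> = tr (cmap [] \<one>\<^bsub>\<Gamma>\<^esub> v) \<gamma>"
      using L tr_tr[of "cmap u g []" "cmap [] \<one>\<^bsub>\<Gamma>\<^esub> v" h "act g \<eta>"] assms \<eta> cmap_factor_Nil(1)[OF assms(3), of u v]
      unfolding \<gamma>_def by (simp add: fib_iff)
    let ?h = "tr (cmap [] (inv\<^bsub>\<Gamma>\<^esub> g) u) \<gamma>"
    have h: "?h \<in> fib x" "rng G ?h = u \<frown> \<eta>"
      using tr_cmap_Nil_props[of "inv\<^bsub>\<Gamma>\<^esub> g" \<gamma> x u] assms \<gamma> by simp_all
    have "tr (cmap u g []) ?h = tr (cmap u g [] \<circ>\<^sub>m cmap [] (inv\<^bsub>\<Gamma>\<^esub> g) u) \<gamma>"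
      using assms \<gamma> by (intro tr_tr) (auto simp: fib_iff)
    also have "\<dots> = \<gamma>"
      unfolding cmap_factor_Nil(2)[OF assms(3)] using tr_Some[of \<gamma>] \<gamma> by (simp add: fib_iff flip: Some_eq_cmap)
    also have "\<dots> = tr (cmap u g []) h" by (simp add: \<gamma>_def)
    finally have "?h = h"
      using tr_inject[of "cmap u g []" ?h h] assms h \<eta> by (simp add: fib_iff)
    then show "\<exists>\<gamma>\<in>fib x. \<delta> = tr (cmap [] \<one>\<^bsub>\<Gamma>\<^esub> v) \<gamma> \<and> h = tr (cmap [] (inv\<^bsub>\<Gamma>\<^esub> g) u) \<gamma>"
      using 1 \<gamma>(1) by blast
  next
    assume "\<exists>\<gamma>\<in>fib x. \<delta> = tr (cmap [] \<one>\<^bsub>\<Gamma>\<^esub> v) \<gamma> \<and> h = tr (cmap [] (inv\<^bsub>\<Gamma>\<^esub> g) u) \<gamma>"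
    then obtain \<gamma> where \<gamma>: "\<gamma> \<in> fib x" "\<delta> = tr (cmap [] \<one>\<^bsub>\<Gamma>\<^esub> v) \<gamma>" "h = tr (cmap [] (inv\<^bsub>\<Gamma>\<^esub> g) u) \<gamma>" by blast
    have h: "rng G h = u \<frown> act (inv\<^bsub>\<Gamma>\<^esub> g) (rng G \<gamma>)"
      using tr_cmap_Nil_props(2)[of "inv\<^bsub>\<Gamma>\<^esub> g" \<gamma> x u] assms \<gamma> by simp
    have "tr (cmap u g v) h = tr (cmap u g v \<circ>\<^sub>m cmap [] (inv\<^bsub>\<Gamma>\<^esub> g) u) \<gamma>"
      unfolding \<gamma>(3) using assms \<gamma>(1) by (intro tr_tr) (auto simp: fib_iff)
    then show "rng G h \<in> cyl u \<and> \<delta> = tr (cmap u g v) h"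
      using h \<gamma> assms by (simp add: cmap_factor_Nil(2))
  qed
qed

text \<open>At most one \<gamma> contributes, since prepending \<open>v\<close> is injective.
  Writing the value as a sum over a larger \<open>P\<close> allows the same \<open>P\<close> for all
  words of a window.\<close>

lemma convol_indicator_bisec:
  assumes "\<delta> \<in> fib x" "g \<in> carrier \<Gamma>" "finite P" "P \<subseteq> fib x"
    and "\<And>\<gamma>. \<gamma> \<in> fib x \<Longrightarrow> tr (cmap [] \<one>\<^bsub>\<Gamma>\<^esub> v) \<gamma> = \<delta> \<Longrightarrow> \<gamma> \<in> P"
  shows "convol G (indicator (bisec (cmap u g v))) \<xi> \<delta> =
    (\<Sum>\<gamma>\<in>P. if tr (cmap [] \<one>\<^bsub>\<Gamma>\<^esub> v) \<gamma> = \<delta> then \<xi> (tr (cmap [] (inv\<^bsub>\<Gamma>\<^esub> g) u) \<gamma>) else 0)"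
proof -
  let ?q = "tr (cmap [] (inv\<^bsub>\<Gamma>\<^esub> g) u)"
  let ?P = "{\<gamma> \<in> P. tr (cmap [] \<one>\<^bsub>\<Gamma>\<^esub> v) \<gamma> = \<delta>}"
  have q: "?q \<gamma> \<in> fib x" if "\<gamma> \<in> P" for \<gamma>
    using tr_cmap_Nil_props(1)[of "inv\<^bsub>\<Gamma>\<^esub> g" \<gamma> x u] assms that by auto
  have inj: "inj_on ?q ?P"
    using tr_cmap_Nil_inject(2)[of "inv\<^bsub>\<Gamma>\<^esub> g" _ x _ x u u] assms by (intro inj_onI) auto
  have "convol G (indicator (bisec (cmap u g v))) \<xi> \<delta> =
      (\<Sum>h\<in>?q ` ?P. indicator (bisec (cmap u g v)) (gdiv \<delta> h) * \<xi> h)"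
  proof (rule convol_eq_sum[OF assms(1)])
    show "finite (?q ` ?P)" "?q ` ?P \<subseteq> fib x" using assms(3) q by auto
    fix h assume h: "h \<in> fib x - ?q ` ?P"
    have "gdiv \<delta> h \<notin> bisec (cmap u g v)"
      using h gdiv_in_bisec_cmap[OF assms(1) _ assms(2), of h u v] assms(5) by auto
    then show "indicator (bisec (cmap u g v)) (gdiv \<delta> h) = (0::complex)" by simp
  qed
  also have "\<dots> = (\<Sum>\<gamma>\<in>?P. indicator (bisec (cmap u g v)) (gdiv \<delta> (?q \<gamma>)) * \<xi> (?q \<gamma>))"
    by (rule sum.reindex_cong[OF inj refl refl])
  also have "\<dots> = (\<Sum>\<gamma>\<in>?P. \<xi> (?q \<gamma>))"
  proof (rule sum.cong[OF refl])
    fix \<gamma> assume \<gamma>: "\<gamma> \<in> ?P"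
    then have "gdiv \<delta> (?q \<gamma>) \<in> bisec (cmap u g v)"
      using gdiv_in_bisec_cmap[OF assms(1) q assms(2)] assms(4) by auto
    then show "indicator (bisec (cmap u g v)) (gdiv \<delta> (?q \<gamma>)) * \<xi> (?q \<gamma>) = \<xi> (?q \<gamma>)" by simp
  qed
  also have "\<dots> = (\<Sum>\<gamma>\<in>P. if tr (cmap [] \<one>\<^bsub>\<Gamma>\<^esub> v) \<gamma> = \<delta> then \<xi> (?q \<gamma>) else 0)"
    by (rule sum.inter_filter[OF assms(3)])
  finally show ?thesis .
qed

section \<open>Scalar matrices averaged over a window of word lengths\<close>

definition window :: "nat \<Rightarrow> nat \<Rightarrow> 'a list set" where
  "window n L = {u. n \<le> length u \<and> length u < n + L}"

lemma finite_window: "finite (window n L)"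
  by (rule finite_subset[OF _ finite_lists_length_le[of "UNIV :: 'a set" "n + L"]]) (auto simp: window_def)

text \<open>For each word length the arrow \<open>h\<close> has at most one such decomposition, and
  the window contains \<open>L\<close> lengths.\<close>

lemma card_window_fiber:
  assumes "g \<in> carrier \<Gamma>" "P \<subseteq> fib x"
  shows "card {j \<in> window n L \<times> P. tr (cmap [] g (fst j)) (snd j) = h} \<le> L"
proof -
  let ?A = "{j \<in> window n L \<times> P. tr (cmap [] g (fst j)) (snd j) = h}"
  have "inj_on (length \<circ> fst) ?A"
  proof (rule inj_onI)
    fix i j assume i: "i \<in> ?A" and j: "j \<in> ?A" and l: "(length \<circ> fst) i = (length \<circ> fst) j"
    have f: "snd i \<in> fib x" "snd j \<in> fib x" using i j assms by auto
    have t: "tr (cmap [] g (fst i)) (snd i) = tr (cmap [] g (fst j)) (snd j)" using i j by simp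
    show "i = j"
      using tr_cmap_Nil_inject[OF assms(1) f _ t] l by (intro prod_eqI) simp_all
  qed
  moreover have "(length \<circ> fst) ` ?A \<subseteq> {n..<n + L}" by (auto simp: window_def)
  ultimately have "card ?A \<le> card {n..<n + L}" by (rule card_inj_on_le) simp
  then show ?thesis by simp
qed

text \<open>
  A scalar matrix indexed by words whose lengths lie in a window of size \<open>L\<close> acts on
  \<open>L\<close> copies of every fibre at once, since an arrow has one prefix of each length; averaging by
  \<open>1 / L\<close> compensates for this.
\<close>

lemma rep_bound_window:
  fixes M :: "'a list \<Rightarrow> 'a list \<Rightarrow> complex"
  assumes g: "g \<in> carrier \<Gamma>" and L: "0 < L" and \<epsilon>: "0 \<le> \<epsilon>"
    and M: "\<And>z. (\<Sum>v\<in>window n L. (cmod (\<Sum>u\<in>window n L. M v u * z u))\<^sup>2) \<le> \<epsilon>\<^sup>2 * (\<Sum>u\<in>window n L. (cmod (z u))\<^sup>2)"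
  shows "rep_bound (\<lambda>\<gamma>. \<Sum>i\<in>window n L \<times> window n L.
      (M (fst i) (snd i) / of_nat L) * indicator (bisec (cmap (snd i) g (fst i))) \<gamma>) \<epsilon>"
proof -
  let ?W = "window n L"
  let ?c = "\<lambda>i. M (fst i) (snd i) / of_nat L"
  let ?f = "\<lambda>i. indicator (bisec (cmap (snd i) g (fst i))) :: 'a germ \<Rightarrow> complex"
  let ?p = "\<lambda>v. tr (cmap [] \<one>\<^bsub>\<Gamma>\<^esub> v)"
  let ?q = "\<lambda>u. tr (cmap [] (inv\<^bsub>\<Gamma>\<^esub> g) u)"
  have rf: "rowfin (?f i)" for i
    using rep_bound_indicator[of "cmap (snd i) g (fst i)"] g by (simp add: rep_bound_def)
  have W: "finite ?W" "finite (?W \<times> ?W)" using finite_window by auto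
  show ?thesis
  proof (rule rep_boundI[OF rowfin_lincomb[OF rf W(2)] \<epsilon>])
    fix x \<xi> D assume \<xi>: "\<xi> \<in> l2 G x" and D: "finite D" "D \<subseteq> fib x"
    \<comment> \<open>The arrows that reach \<open>D\<close> after prepending some word of the
      window; finitely many, since prepending a given word is injective.\<close>
    define P where "P = (\<Union>v\<in>?W. ?p v -` D \<inter> fib x)"
    have fv: "finite (?p v -` D \<inter> fib x)" for v
      by (rule finite_vimage_IntI[OF D(1)], rule inj_onI)
        (erule (2) tr_cmap_Nil_inject(2)[OF gr.one_closed _ _ refl])
    have P: "finite P" "P \<subseteq> fib x"
      unfolding P_def by (rule finite_UN_I[OF W(1) fv]) blast
    \<comment> \<open>Row \<open>fst j\<close> of the matrix applied to the values of \<xi> at the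
      arrows obtained from \<open>snd j\<close>. The bound on \<open>M\<close> is used once for each
      arrow of \<open>P\<close>.\<close>
    define Y where "Y j = (\<Sum>u\<in>?W. M (fst j) u * \<xi> (?q u (snd j)))" for j
    define A where "A \<delta> = {j \<in> ?W \<times> P. ?p (fst j) (snd j) = \<delta>}" for \<delta>
    have finA: "finite (A \<delta>)" for \<delta>
      by (rule finite_subset[of _ "?W \<times> P"]) (use W P in \<open>auto simp: A_def\<close>)
    have conv: "convol G (\<lambda>\<gamma>. \<Sum>i\<in>?W \<times> ?W. ?c i * ?f i \<gamma>) \<xi> \<delta> = (\<Sum>j\<in>A \<delta>. Y j) / of_nat L"
      if \<delta>: "\<delta> \<in> D" for \<delta>
    proof -
      have \<delta>x: "\<delta> \<in> fib x" using \<delta> D by blast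
      have "convol G (\<lambda>\<gamma>. \<Sum>i\<in>?W \<times> ?W. ?c i * ?f i \<gamma>) \<xi> \<delta> = (\<Sum>i\<in>?W \<times> ?W. ?c i * convol G (?f i) \<xi> \<delta>)"
        using convol_sum[of "?W \<times> ?W" ?f ?c \<xi>] rf W by simp
      also have "\<dots> = (\<Sum>i\<in>?W \<times> ?W. ?c i * (\<Sum>\<gamma>\<in>P. if ?p (fst i) \<gamma> = \<delta> then \<xi> (?q (snd i) \<gamma>) else 0))"
      proof (rule sum.cong[OF refl])
        fix i assume i: "i \<in> ?W \<times> ?W"
        have "convol G (?f i) \<xi> \<delta> = (\<Sum>\<gamma>\<in>P. if ?p (fst i) \<gamma> = \<delta> then \<xi> (?q (snd i) \<gamma>) else 0)"
          by (rule convol_indicator_bisec[OF \<delta>x g P]) (use i \<delta> in \<open>auto simp: P_def\<close>)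
        then show "?c i * convol G (?f i) \<xi> \<delta> =
            ?c i * (\<Sum>\<gamma>\<in>P. if ?p (fst i) \<gamma> = \<delta> then \<xi> (?q (snd i) \<gamma>) else 0)" by simp
      qed
      also have "\<dots> = (\<Sum>v\<in>?W. \<Sum>u\<in>?W. \<Sum>\<gamma>\<in>P. if ?p v \<gamma> = \<delta> then M v u * \<xi> (?q u \<gamma>) / of_nat L else 0)"
        by (simp add: sum.cartesian_product' sum_distrib_left if_distrib[of "\<lambda>x. _ * x"] cong: if_cong)
      also have "\<dots> = (\<Sum>v\<in>?W. \<Sum>\<gamma>\<in>P. if ?p v \<gamma> = \<delta> then Y (v, \<gamma>) / of_nat L else 0)"
        by (intro sum.cong refl, subst sum.swap) (auto simp: Y_def sum_divide_distrib intro!: sum.cong)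
      also have "\<dots> = (\<Sum>j\<in>?W \<times> P. if ?p (fst j) (snd j) = \<delta> then Y j / of_nat L else 0)"
        by (simp add: sum.cartesian_product')
      also have "\<dots> = (\<Sum>j\<in>A \<delta>. Y j / of_nat L)"
        unfolding A_def by (rule sum.inter_filter[symmetric]) (use W P in auto)
      finally show ?thesis by (simp add: sum_divide_distrib)
    qed
    have est: "(cmod (convol G (\<lambda>\<gamma>. \<Sum>i\<in>?W \<times> ?W. ?c i * ?f i \<gamma>) \<xi> \<delta>))\<^sup>2 \<le> (\<Sum>j\<in>A \<delta>. (cmod (Y j))\<^sup>2) / L"
      if "\<delta> \<in> D" for \<delta>
    proof -
      \<comment> \<open>Cauchy-Schwarz over at most \<open>L\<close> summands costs a factor
        \<open>L\<close>; with the squared normalisation a single 1 / L is left.\<close>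
      have "(cmod (\<Sum>j\<in>A \<delta>. Y j))\<^sup>2 \<le> (\<Sum>j\<in>A \<delta>. cmod (Y j))\<^sup>2"
        by (rule power_mono[OF norm_sum]) simp
      also have "\<dots> \<le> (\<Sum>j\<in>A \<delta>. (cmod (Y j))\<^sup>2) * card (A \<delta>)"
        by (rule sum_squared_le_sum_of_squares)
      also have "\<dots> \<le> (\<Sum>j\<in>A \<delta>. (cmod (Y j))\<^sup>2) * L"
        using card_window_fiber[OF gr.one_closed P(2)]
        by (intro mult_left_mono) (auto simp: A_def sum_nonneg)
      finally have "(cmod (\<Sum>j\<in>A \<delta>. Y j))\<^sup>2 / (real L)\<^sup>2 \<le> (\<Sum>j\<in>A \<delta>. (cmod (Y j))\<^sup>2) * L / (real L)\<^sup>2"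
        by (rule divide_right_mono) simp
      then show ?thesis unfolding conv[OF that] using L
        by (simp add: norm_divide power_divide power2_eq_square)
    qed
    let ?S = "{j \<in> ?W \<times> P. ?p (fst j) (snd j) \<in> D}"
    have finS: "finite ?S" by (rule finite_subset[of _ "?W \<times> P"]) (use W P in auto)
    have "(\<Sum>\<delta>\<in>D. \<Sum>j\<in>A \<delta>. (cmod (Y j))\<^sup>2) = (\<Sum>\<delta>\<in>D. \<Sum>j\<in>{j \<in> ?S. ?p (fst j) (snd j) = \<delta>}. (cmod (Y j))\<^sup>2)"
      by (intro sum.cong) (auto simp: A_def)
    also have "\<dots> = (\<Sum>j\<in>?S. (cmod (Y j))\<^sup>2)"
      by (rule sum.group[OF finS D(1)]) auto
    also have "\<dots> \<le> (\<Sum>j\<in>?W \<times> P. (cmod (Y j))\<^sup>2)"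
      by (rule sum_mono2) (use W P in auto)
    also have "\<dots> = (\<Sum>\<gamma>\<in>P. \<Sum>v\<in>?W. (cmod (Y (v, \<gamma>)))\<^sup>2)"
      by (subst sum.swap) (simp add: sum.cartesian_product')
    also have "\<dots> \<le> (\<Sum>\<gamma>\<in>P. \<epsilon>\<^sup>2 * (\<Sum>u\<in>?W. (cmod (\<xi> (?q u \<gamma>)))\<^sup>2))"
      using M by (intro sum_mono) (simp add: Y_def)
    also have "\<dots> = \<epsilon>\<^sup>2 * (\<Sum>j\<in>?W \<times> P. (cmod (\<xi> (?q (fst j) (snd j))))\<^sup>2)"
      by (subst sum.cartesian_product', subst sum.swap) (simp add: sum_distrib_left)
    \<comment> \<open>The columns too meet each arrow at most \<open>L\<close> times; this factor
      cancels the remaining 1 / L.\<close>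
    also have "\<dots> \<le> \<epsilon>\<^sup>2 * (L * (l2_norm G x \<xi>)\<^sup>2)"
    proof (rule mult_left_mono)
      let ?Q = "(\<lambda>j. ?q (fst j) (snd j)) ` (?W \<times> P)"
      have finWP: "finite (?W \<times> P)" using W P by simp
      have Q: "finite ?Q" "?Q \<subseteq> fib x"
        using finWP P tr_cmap_Nil_props(1)[of "inv\<^bsub>\<Gamma>\<^esub> g" _ x] g by auto
      have "(\<Sum>j\<in>?W \<times> P. (cmod (\<xi> (?q (fst j) (snd j))))\<^sup>2) =
          (\<Sum>h\<in>?Q. \<Sum>j\<in>{j \<in> ?W \<times> P. ?q (fst j) (snd j) = h}. (cmod (\<xi> (?q (fst j) (snd j))))\<^sup>2)"
        by (rule sum.image_gen[OF finWP])
      also have "\<dots> = (\<Sum>h\<in>?Q. card {j \<in> ?W \<times> P. ?q (fst j) (snd j) = h} * (cmod (\<xi> h))\<^sup>2)"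
        by (intro sum.cong refl) simp
      also have "\<dots> \<le> (\<Sum>h\<in>?Q. L * (cmod (\<xi> h))\<^sup>2)"
        using card_window_fiber[OF gr.inv_closed[OF g] P(2)]
        by (intro sum_mono mult_right_mono) auto
      also have "\<dots> = L * (\<Sum>h\<in>?Q. (cmod (\<xi> h))\<^sup>2)" by (simp add: sum_distrib_left)
      also have "\<dots> \<le> L * (l2_norm G x \<xi>)\<^sup>2"
        by (intro mult_left_mono l2_sum_le[OF \<xi> Q]) simp
      finally show "(\<Sum>j\<in>?W \<times> P. (cmod (\<xi> (?q (fst j) (snd j))))\<^sup>2) \<le> L * (l2_norm G x \<xi>)\<^sup>2" .
    qed simp
    finally have fin: "(\<Sum>\<delta>\<in>D. \<Sum>j\<in>A \<delta>. (cmod (Y j))\<^sup>2) \<le> \<epsilon>\<^sup>2 * (L * (l2_norm G x \<xi>)\<^sup>2)" .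
    have "(\<Sum>\<delta>\<in>D. (cmod (convol G (\<lambda>\<gamma>. \<Sum>i\<in>?W \<times> ?W. ?c i * ?f i \<gamma>) \<xi> \<delta>))\<^sup>2) \<le> (\<Sum>\<delta>\<in>D. (\<Sum>j\<in>A \<delta>. (cmod (Y j))\<^sup>2) / L)"
      by (rule sum_mono[OF est])
    also have "\<dots> \<le> \<epsilon>\<^sup>2 * (L * (l2_norm G x \<xi>)\<^sup>2) / L"
      using divide_right_mono[OF fin, of "real L"] by (simp add: sum_divide_distrib)
    also have "\<dots> = \<epsilon>\<^sup>2 * (l2_norm G x \<xi>)\<^sup>2" using L by simp
    finally show "(\<Sum>\<delta>\<in>D. (cmod (convol G (\<lambda>\<gamma>. \<Sum>i\<in>?W \<times> ?W. ?c i * ?f i \<gamma>) \<xi> \<delta>))\<^sup>2) \<le> \<epsilon>\<^sup>2 * (l2_norm G x \<xi>)\<^sup>2" .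
  qed
qed


subsection \<open>Matrix entries and values\<close>

lemma indicator_l2: 
  assumes "h \<in> fib x"
  shows "indicator {h} \<in> l2 G x" "l2_norm G x (indicator {h}) = 1"
proof -
  show "indicator {h} \<in> l2 G x"
    by (rule l2_finite_support(1)[of "{h}"]) (use assms in auto)
  have "(l2_norm G x (indicator {h}))\<^sup>2 = 1"
    by (subst l2_finite_support(2)[of "{h}"]) (use assms in auto)
  then show "l2_norm G x (indicator {h}) = 1"
    using l2_norm_nonneg[of G x "indicator {h}"] by (simp add: power2_eq_1_iff)
qed

lemma convol_indicator_point:
  assumes "rowfin f" "\<delta> \<in> fib x" "h \<in> fib x"
  shows "convol G f (indicator {h}) \<delta> = f (gdiv \<delta> h)"
proof -
  let ?H = "insert h {h \<in> fib x. f (gdiv \<delta> h) \<noteq> 0}"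
  have fin: "finite ?H" using assms by (simp add: rowfin_def)
  have "convol G f (indicator {h}) \<delta> = (\<Sum>k\<in>?H. f (gdiv \<delta> k) * indicator {h} k)"
    by (rule convol_eq_sum[OF assms(2) fin]) (use assms in auto)
  also have "\<dots> = (\<Sum>k\<in>?H. if k = h then f (gdiv \<delta> k) else 0)"
    by (intro sum.cong) (auto simp: indicator_def)
  also have "\<dots> = f (gdiv \<delta> h)" using fin by (simp add: sum.delta)
  finally show ?thesis .
qed

lemma unit_arr: "gm Some x \<in> fib x"
  by (simp add: fib_iff)

lemma gdiv_unit:
  assumes "\<gamma> \<in> fib x"
  shows "gdiv \<gamma> (gm Some x) = \<gamma>"
proof -
  obtain T \<xi> \<eta> where T: "T \<in> IS" "T \<xi> = Some \<eta>" "\<gamma> = gm T \<xi>" "src G \<gamma> = \<xi>"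
    using assms arrE unfolding fib_iff by metis
  have "partial_inverse Some = (Some :: 'a word \<rightharpoonup> 'a word)"
  proof
    fix y :: "'a word" show "partial_inverse Some y = Some y" by (simp add: partial_inverse_IS)
  qed
  moreover have "\<xi> \<in> dom T" "x = \<xi>" using T assms by (auto simp: fib_iff)
  ultimately show ?thesis using gdiv_germ(1)[of T Some \<xi> \<xi>] T by simp
qed

lemma value_at_apply:
  assumes "\<gamma> \<in> fib x"
  shows "value_at G a \<gamma> = a x (indicator {gm Some x}) \<gamma>"
proof -
  have x: "src G \<gamma> = x" using assms by (simp add: fib_iff)
  have "l2_inner G x \<xi> (indicator {\<gamma>}) = (\<Sum>\<^sub>\<infinity>g\<in>{\<gamma>}. \<xi> g * cnj (indicator {\<gamma>} g))" for \<xi>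
    unfolding l2_inner_def by (rule infsum_cong_neutral) (use assms in auto)
  then have "l2_inner G x \<xi> (indicator {\<gamma>}) = \<xi> \<gamma>" for \<xi> by simp
  moreover have "unit_at G = gm Some" by (simp add: germ_groupoid_def)
  ultimately show ?thesis unfolding value_at_def Let_def x by simp
qed

lemma value_at_regular_rep:
  assumes "rowfin f" "\<gamma> \<in> arr"
  shows "value_at G (regular_rep G f) \<gamma> = f \<gamma>"
proof -
  have \<gamma>: "\<gamma> \<in> fib (src G \<gamma>)" using assms by (simp add: fib_iff)
  show ?thesis
    unfolding value_at_apply[OF \<gamma>] regular_rep_apply[OF indicator_l2(1)[OF unit_arr]]
    using convol_indicator_point[OF assms(1) \<gamma> unit_arr] gdiv_unit[OF \<gamma>] by simp
qed

lemma reduced_algebra_linear: "a \<in> reduced_algebra G \<Longrightarrow> linear_on_l2 G x (a x)"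
  by (rule bounded_operators_linear) (auto simp: reduced_algebra_def PiE_iff)

lemma reduced_norm_diff_le_iff:
  assumes "a \<in> reduced_algebra G" "rep_bound f B" "0 \<le> \<epsilon>"
  shows "reduced_norm G (a - regular_rep G f) \<le> ennreal \<epsilon> \<longleftrightarrow>
    (\<forall>x. \<forall>\<xi>\<in>l2 G x. l2_norm G x (\<lambda>g. a x \<xi> g - convol G f \<xi> g) \<le> \<epsilon> * l2_norm G x \<xi>)"
proof -
  have eq: "(a - regular_rep G f) x = (\<lambda>\<xi> g. a x \<xi> g - regular_rep G f x \<xi> g)" for x
    by (simp add: fun_eq_iff)
  have "linear_on_l2 G x ((a - regular_rep G f) x)" for x
    unfolding eq by (rule linear_on_l2_diff[OF reduced_algebra_linear[OF assms(1)] rep_bound_linear[OF assms(2)]])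
  from reduced_norm_le_iff[OF assms(3), of G "a - regular_rep G f", OF this]
  have "reduced_norm G (a - regular_rep G f) \<le> ennreal \<epsilon> \<longleftrightarrow>
    (\<forall>x. \<forall>\<xi>\<in>l2 G x. l2_norm G x (\<lambda>g. a x \<xi> g - regular_rep G f x \<xi> g) \<le> \<epsilon> * l2_norm G x \<xi>)"
    unfolding eq by simp
  then show ?thesis by (simp add: regular_rep_apply cong: ball_cong)
qed

lemma convol_diff:
  assumes "rowfin f" "rowfin s"
  shows "convol G (\<lambda>g. f g - s g) \<xi> = (\<lambda>g. convol G f \<xi> g - convol G s \<xi> g)"
proof -
  have eq: "(\<lambda>g. f g - s g) = (\<lambda>g. \<Sum>b\<in>{True, False}. (if b then 1 else -1) * (if b then f else s) g)" by simp
  show ?thesis unfolding eq by (subst convol_sum) (use assms in auto)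
qed

lemma reduced_norm_diff_trans:
  assumes "a \<in> reduced_algebra G" "rep_bound f A" "rep_bound s B" "rep_bound (\<lambda>g. f g - s g) \<epsilon>'"
    "0 \<le> \<epsilon>" "reduced_norm G (a - regular_rep G f) \<le> ennreal \<epsilon>"
  shows "reduced_norm G (a - regular_rep G s) \<le> ennreal (\<epsilon> + \<epsilon>')"
proof -
  have \<epsilon>': "0 \<le> \<epsilon>'" using assms(4) by (simp add: rep_bound_def)
  have cd: "convol G (\<lambda>g. f g - s g) \<xi> = (\<lambda>g. convol G f \<xi> g - convol G s \<xi> g)" for \<xi>
    using assms by (intro convol_diff) (auto simp: rep_bound_def)
  have "l2_norm G x (\<lambda>g. a x \<xi> g - convol G s \<xi> g) \<le> (\<epsilon> + \<epsilon>') * l2_norm G x \<xi>" if \<xi>: "\<xi> \<in> l2 G x" for x \<xi>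
  proof -
    let ?p = "\<lambda>g. a x \<xi> g - convol G f \<xi> g" and ?q = "\<lambda>g. convol G f \<xi> g - convol G s \<xi> g"
    have "a x \<xi> \<in> l2 G x" "convol G f \<xi> \<in> l2 G x"
      using reduced_algebra_linear[OF assms(1), of x] assms(2) \<xi> by (auto simp: linear_on_l2_def rep_bound_def)
    then have p: "?p \<in> l2 G x" by (rule l2_diff)
    have q: "?q \<in> l2 G x" "l2_norm G x ?q \<le> \<epsilon>' * l2_norm G x \<xi>"
      using assms(4) \<xi> unfolding rep_bound_def cd by blast+
    have "l2_norm G x ?p \<le> \<epsilon> * l2_norm G x \<xi>"
      using assms(6) reduced_norm_diff_le_iff[OF assms(1,2,5)] \<xi> by blast
    moreover have "l2_norm G x (\<lambda>g. a x \<xi> g - convol G s \<xi> g) \<le> l2_norm G x ?p + l2_norm G x ?q"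
      using l2_lincomb(2)[OF p q(1), of 1 1] by simp
    ultimately show ?thesis using q(2) by (simp add: distrib_right)
  qed
  moreover have "0 \<le> \<epsilon> + \<epsilon>'" using assms(5) \<epsilon>' by simp
  ultimately show ?thesis using reduced_norm_diff_le_iff[OF assms(1,3)] by blast
qed

lemma entry_close:
  assumes "a \<in> reduced_algebra G" "rep_bound f B" "0 \<le> \<epsilon>" "reduced_norm G (a - regular_rep G f) \<le> ennreal \<epsilon>"
    and "\<delta> \<in> fib x" "h \<in> fib x"
  shows "cmod (a x (indicator {h}) \<delta> - f (gdiv \<delta> h)) \<le> \<epsilon>"
proof -
  let ?d = "\<lambda>g. a x (indicator {h}) g - convol G f (indicator {h}) g"
  note ind = indicator_l2[OF assms(6)]
  have "l2_norm G x ?d \<le> \<epsilon>"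
    using assms(4) reduced_norm_diff_le_iff[OF assms(1-3)] ind by fastforce
  moreover have "?d \<in> l2 G x"
    using reduced_algebra_linear[OF assms(1), of x] assms(2) ind(1)
    by (intro l2_diff) (auto simp: linear_on_l2_def rep_bound_def)
  ultimately have "cmod (?d \<delta>) \<le> \<epsilon>" using l2_cmod_le[of ?d G x \<delta>] assms(5) by linarith
  then show ?thesis using convol_indicator_point[of f \<delta> x h] assms by (simp add: rep_bound_def)
qed

lemma value_close:
  assumes "a \<in> reduced_algebra G" "rep_bound f B" "0 \<le> \<epsilon>" "reduced_norm G (a - regular_rep G f) \<le> ennreal \<epsilon>"
    and "\<gamma> \<in> arr"
  shows "cmod (value_at G a \<gamma> - f \<gamma>) \<le> \<epsilon>"
proof -
  have \<gamma>: "\<gamma> \<in> fib (src G \<gamma>)" using assms by (simp add: fib_iff)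
  show ?thesis using entry_close[OF assms(1-4) \<gamma> unit_arr] gdiv_unit[OF \<gamma>] value_at_apply[OF \<gamma>, of a] by simp
qed

subsection \<open>Locally constant approximation\<close>

abbreviation triples :: "('a list \<times> 'c \<times> 'a list) set" where "triples \<equiv> UNIV \<times> carrier \<Gamma> \<times> UNIV"

definition Z :: "'a list \<times> 'c \<times> 'a list \<Rightarrow> 'a germ set" where
  "Z t = (case t of (u, g, v) \<Rightarrow> bisec (cmap u g v))"

lemma Z_simp [simp]: "Z (u, g, v) = bisec (cmap u g v)"
  by (simp add: Z_def)

text \<open>Coefficients are attached to triples, although different triples may give the same
  bisection, so that they can be multiplied by weights depending on word lengths.\<close>

definition combo :: "('a list \<times> 'c \<times> 'a list) set \<Rightarrow> ('a list \<times> 'c \<times> 'a list \<Rightarrow> complex) \<Rightarrow> 'a germ \<Rightarrow> complex" where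
  "combo I c = (\<lambda>\<gamma>. \<Sum>t\<in>I. c t * indicator (Z t) \<gamma>)"

definition simple :: "('a germ \<Rightarrow> complex) \<Rightarrow> bool" where
  "simple f \<longleftrightarrow> (\<exists>I c. finite I \<and> I \<subseteq> triples \<and> f = combo I c)"

lemma rep_bound_Z: "t \<in> triples \<Longrightarrow> rep_bound (indicator (Z t)) 1"
  by (cases t) (simp add: rep_bound_indicator)

lemma rep_bound_combo:
  assumes "finite I" "I \<subseteq> triples"
  shows "rep_bound (combo I c) (\<Sum>t\<in>I. cmod (c t))"
  using rep_bound_sum[OF assms(1), of "\<lambda>t. indicator (Z t)" "\<lambda>_. 1" c] rep_bound_Z assms(2)
  unfolding combo_def by auto

lemma simple_rep_bound: "simple f \<Longrightarrow> \<exists>B. rep_bound f B"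
  using rep_bound_combo unfolding simple_def by blast

lemma simple_Z: "t \<in> triples \<Longrightarrow> simple (indicator (Z t))"
  unfolding simple_def by (intro exI[of _ "{t}"] exI[of _ "\<lambda>_. 1"]) (auto simp: combo_def)

lemma simple_lincomb2:
  assumes "simple f" "simple f'"
  shows "simple (\<lambda>\<gamma>. a * f \<gamma> + b * f' \<gamma>)"
proof -
  obtain I c I' c' where I: "finite I" "I \<subseteq> triples" "f = combo I c" "finite I'" "I' \<subseteq> triples" "f' = combo I' c'"
    using assms unfolding simple_def by blast
  let ?d = "\<lambda>t. (if t \<in> I then a * c t else 0) + (if t \<in> I' then b * c' t else 0)"
  have "a * f \<gamma> + b * f' \<gamma> = combo (I \<union> I') ?d \<gamma>" for \<gamma>
  proof -
    have "a * f \<gamma> = (\<Sum>t\<in>I \<union> I'. (if t \<in> I then a * c t else 0) * indicator (Z t) \<gamma>)"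
      unfolding I(3) combo_def sum_distrib_left
      by (rule sum.mono_neutral_cong_left) (use I in auto)
    moreover have "b * f' \<gamma> = (\<Sum>t\<in>I \<union> I'. (if t \<in> I' then b * c' t else 0) * indicator (Z t) \<gamma>)"
      unfolding I(6) combo_def sum_distrib_left
      by (rule sum.mono_neutral_cong_left) (use I in auto)
    ultimately show ?thesis by (simp only: combo_def distrib_right sum.distrib)
  qed
  then show ?thesis unfolding simple_def using I
    by (intro exI[of _ "I \<union> I'"] exI[of _ ?d]) auto
qed

lemma simple_sum:
  assumes "finite J" "\<And>j. j \<in> J \<Longrightarrow> simple (f j)"
  shows "simple (\<lambda>\<gamma>. \<Sum>j\<in>J. a j * f j \<gamma>)"
  using assms
proof (induction J)
  case empty
  then show ?case unfolding simple_def by (intro exI[of _ "{}"] exI[of _ "\<lambda>_. 0"]) (auto simp: combo_def)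
next
  case (insert j J)
  have "simple (\<lambda>\<gamma>. a j * f j \<gamma> + 1 * (\<Sum>j\<in>J. a j * f j \<gamma>))"
    by (rule simple_lincomb2) (use insert in auto)
  then show ?case using insert.hyps by simp
qed

lemma simple_steinberg:
  assumes "simple f"
  shows "f \<in> steinberg_algebra G"
proof -
  obtain I c where I: "finite I" "I \<subseteq> triples" "f = combo I c" using assms unfolding simple_def by blast
  have "indicator (Z t) \<in> {indicator U | U. open_bisection G U \<and> compactin (arrows G) U}" if "t \<in> I" for t
  proof -
    have "t \<in> triples" using I(2) that by (rule subsetD)
    then obtain u g v where t: "t = (u, g, v)" "g \<in> carrier \<Gamma>" by auto
    then show ?thesis using open_bisection_bisec[of "cmap u g v"] compactin_bisec[of g u v] by auto
  qed
  then show ?thesis unfolding steinberg_algebra_def I(3) combo_def by (rule cspan_sum[OF I(1)])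
qed

text \<open>On its bisection the indicator is the constant 1, and its support is the whole
  bisection, which is compact.\<close>

lemma simple_connes:
  assumes "simple f"
  shows "f \<in> connes_algebra G"
proof -
  obtain I c where I: "finite I" "I \<subseteq> triples" "f = combo I c" using assms unfolding simple_def by blast
  have "indicator (Z t) \<in> {f. \<exists>U. open_bisection G U \<and> f \<in> Cc_on (subtopology (arrows G) U) \<and> (\<forall>g. g \<notin> U \<longrightarrow> f g = (0::complex))}"
    if "t \<in> I" for t
  proof -
    have "t \<in> triples" using I(2) \<open>t \<in> I\<close> by (rule subsetD)
    then obtain u g v where t: "t = (u, g, v)" "g \<in> carrier \<Gamma>" by auto
    let ?U = "bisec (cmap u g v)" and ?X = "subtopology (arrows G) (bisec (cmap u g v))"
    have U: "open_bisection G ?U" using t by (simp add: open_bisection_bisec)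
    have top: "topspace ?X = ?U" using bisec_subset[of "cmap u g v"] t by auto
    have "continuous_map ?X euclidean (\<lambda>_. 1 :: complex)" by simp
    then have c: "continuous_map ?X euclidean (indicator ?U :: 'a germ \<Rightarrow> complex)"
      by (rule continuous_map_eq) (use top in auto)
    have "{g \<in> topspace ?X. (indicator ?U g :: complex) \<noteq> 0} = ?U" using top by (auto simp: indicator_def)
    then have cl: "?X closure_of {g \<in> topspace ?X. (indicator ?U g :: complex) \<noteq> 0} = ?U"
      by (simp only: closure_of_topspace[of ?X, unfolded top])
    have "compactin ?X ?U" using compactin_bisec[OF t(2), of u v] by (simp add: compactin_subtopology)
    then have "indicator ?U \<in> Cc_on ?X"
      unfolding Cc_on_def by (intro CollectI conjI c) (simp only: cl)
    then show ?thesis using U t by auto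
  qed
  then show ?thesis unfolding connes_algebra_def I(3) combo_def by (rule cspan_sum[OF I(1)])
qed

lemma regular_rep_simple_reduced:
  assumes "simple f"
  shows "regular_rep G f \<in> reduced_algebra G"
proof -
  obtain B where B: "rep_bound f B" using simple_rep_bound[OF assms] by blast
  have "reduced_norm G (regular_rep G f - regular_rep G f) \<le> 0"
    unfolding reduced_norm_def operator_norm_def by (intro SUP_least) (simp add: fun_diff_def)
  then have "reduced_norm G (regular_rep G f - regular_rep G f) = 0" by simp
  then have "\<forall>\<epsilon>>0. \<exists>f'\<in>connes_algebra G. reduced_norm G (regular_rep G f - regular_rep G f') < ennreal \<epsilon>"
    using simple_connes[OF assms] by (auto intro!: bexI[of _ f])
  then show ?thesis unfolding reduced_algebra_def
    using rep_bound_bounded_operators[OF B] by blast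
qed

text \<open>Refining a triple that represents \<gamma> along a long prefix of its source shrinks the
  bisection into \<open>U\<close>.\<close>

lemma arrows_basis:
  assumes "openin (arrows G) U" "\<gamma> \<in> U"
  shows "\<exists>t\<in>triples. \<gamma> \<in> Z t \<and> Z t \<subseteq> U"
proof -
  have "\<gamma> \<in> arr" using assms openin_subset by blast
  then obtain u g v \<xi> where g: "g \<in> carrier \<Gamma>" and \<gamma>: "\<gamma> = gm (cmap u g v) (u \<frown> \<xi>)" by (rule arr_cmapE)
  let ?T = "cmap u g v"
  have "?T \<in> IS" using g by simp
  then have "openin word_topology {\<zeta> \<in> dom ?T. gm ?T \<zeta> \<in> U}"
    using assms(1) unfolding openin_arrows_iff by blast
  moreover have "u \<frown> \<xi> \<in> {\<zeta> \<in> dom ?T. gm ?T \<zeta> \<in> U}" using assms(2) \<gamma> by simp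
  ultimately obtain n where n: "\<And>m. m \<ge> n \<Longrightarrow> cyl (prefix m (u \<frown> \<xi>)) \<subseteq> {\<zeta> \<in> dom ?T. gm ?T \<zeta> \<in> U}"
    using openin_nonempty_cyl by blast
  define w where "w = prefix n \<xi>"
  have "prefix (length u + n) (u \<frown> \<xi>) = u @ w" by (simp add: w_def)
  then have cw: "cyl (u @ w) \<subseteq> {\<zeta> \<in> dom ?T. gm ?T \<zeta> \<in> U}" using n[of "length u + n"] by simp
  have in_cyl: "u \<frown> \<xi> \<in> cyl (u @ w)" by (simp add: in_cyl_iff w_def)
  show ?thesis
  proof (intro bexI conjI)
    show "(u @ w, sect g w, v @ \<phi> g w) \<in> triples" using g by simp
    have "\<gamma> \<in> bisec ?T" using g by (auto simp: \<gamma> bisec_def)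
    moreover have "src G \<gamma> = u \<frown> \<xi>" using g by (simp add: \<gamma>)
    ultimately show "\<gamma> \<in> Z (u @ w, sect g w, v @ \<phi> g w)" using bisec_refine[OF g] in_cyl by simp
    show "Z (u @ w, sect g w, v @ \<phi> g w) \<subseteq> U"
    proof
      fix \<gamma>' assume "\<gamma>' \<in> Z (u @ w, sect g w, v @ \<phi> g w)"
      then have *: "\<gamma>' \<in> bisec ?T" "src G \<gamma>' \<in> cyl (u @ w)" using bisec_refine[OF g] by simp_all
      then have "\<gamma>' = gm ?T (src G \<gamma>')" using in_bisec_src(2)[of ?T] g by simp
      moreover have "gm ?T (src G \<gamma>') \<in> U" using cw *(2) by blast
      ultimately show "\<gamma>' \<in> U" by simp
    qed
  qed
qed

lemma Z_src: "t \<in> triples \<Longrightarrow> src G ` Z t = cyl (fst t)"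
proof -
  assume "t \<in> triples"
  then obtain u g v where t: "t = (u, g, v)" "g \<in> carrier \<Gamma>" by auto
  have "src G (gm (cmap u g v) \<zeta>) = \<zeta>" if "\<zeta> \<in> cyl u" for \<zeta> using t(2) that by simp
  then show ?thesis unfolding t by (simp add: bisec_def image_image)
qed

text \<open>On a bisection the operator norm is at most the supremum norm, so uniform approximation
  by a step function is enough. The pieces of a cover may overlap; refined to one domain length,
  their source cylinders are equal or disjoint, and one piece is kept for each cylinder.\<close>

lemma Cc_on_approx:
  assumes U: "open_bisection G U" and f: "f \<in> Cc_on (subtopology (arrows G) U)" "\<And>g. g \<notin> U \<Longrightarrow> f g = 0"
    and \<epsilon>: "0 < \<epsilon>"
  shows "\<exists>s. simple s \<and> rep_bound (\<lambda>g. f g - s g) \<epsilon>"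
proof -
  let ?X = "subtopology (arrows G) U"
  note Uinj = open_bisection_inj[OF U]
  have Uopen: "openin (arrows G) U" using U by (simp add: open_bisection_def)
  have top: "topspace ?X = U" using Uinj(1) by auto
  define K where "K = ?X closure_of {g \<in> topspace ?X. f g \<noteq> 0}"
  have cont: "continuous_map ?X euclidean f" and K: "compactin ?X K" using f(1) by (auto simp: Cc_on_def K_def)
  have KU: "K \<subseteq> U" using compactin_subset_topspace[OF K] top by simp
  have fK: "f g = 0" if "g \<notin> K" for g
  proof (rule ccontr)
    assume "f g \<noteq> 0"
    then have "g \<in> {g \<in> topspace ?X. f g \<noteq> 0}" using f(2) top by auto
    then show False using that closure_of_subset[of "{g \<in> topspace ?X. f g \<noteq> 0}" ?X] unfolding K_def by auto
  qed
  define T0 where "T0 = {t \<in> triples. Z t \<subseteq> U \<and> (\<forall>\<gamma>\<in>Z t. \<forall>\<gamma>'\<in>Z t. cmod (f \<gamma> - f \<gamma>') \<le> \<epsilon>)}"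
  have cover: "\<exists>t\<in>T0. \<gamma> \<in> Z t" if "\<gamma> \<in> U" for \<gamma>
  proof -
    let ?O = "{\<gamma>' \<in> topspace ?X. f \<gamma>' \<in> ball (f \<gamma>) (\<epsilon> / 2)}"
    have "openin ?X ?O" by (rule openin_continuous_map_preimage[OF cont]) simp
    then have "openin (arrows G) ?O" using Uopen by (simp add: openin_open_subtopology)
    moreover have "\<gamma> \<in> ?O" using that top \<epsilon> by simp
    ultimately obtain t where t: "t \<in> triples" "\<gamma> \<in> Z t" "Z t \<subseteq> ?O" using arrows_basis by blast
    have "cmod (f \<alpha> - f \<beta>) \<le> \<epsilon>" if "\<alpha> \<in> Z t" "\<beta> \<in> Z t" for \<alpha> \<beta>
    proof -
      have "\<alpha> \<in> ?O" "\<beta> \<in> ?O" using that t(3) by blast+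
      then have "dist (f \<gamma>) (f \<alpha>) < \<epsilon> / 2" "dist (f \<gamma>) (f \<beta>) < \<epsilon> / 2" by simp_all
      then have "dist (f \<alpha>) (f \<beta>) < \<epsilon>" using dist_triangle_half_r by blast
      then show ?thesis by (simp add: dist_norm)
    qed
    then have "t \<in> T0" using t top unfolding T0_def by blast
    then show ?thesis using t(2) by blast
  qed
  have "\<exists>\<F>. finite \<F> \<and> \<F> \<subseteq> Z ` T0 \<and> K \<subseteq> \<Union>\<F>"
  proof (rule compactinD[OF K])
    fix V assume "V \<in> Z ` T0"
    then obtain u g v where "V = Z (u, g, v)" "g \<in> carrier \<Gamma>" "V \<subseteq> U" unfolding T0_def by auto
    then show "openin ?X V" using Uopen openin_bisec[of "cmap u g v"] by (simp add: openin_open_subtopology)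
  next
    show "K \<subseteq> \<Union> (Z ` T0)" using cover KU by blast
  qed
  then obtain I0 where I0: "finite I0" "I0 \<subseteq> T0" "K \<subseteq> \<Union> (Z ` I0)"
    by (metis finite_subset_image)
  \<comment> \<open>A common domain length: each piece is cut along all words that complete its
    domain word to this length.\<close>
  define l where "l = (\<Sum>t\<in>I0. length (fst t))"
  have l: "length (fst t) \<le> l" if "t \<in> I0" for t
    unfolding l_def by (rule member_le_sum[OF that]) (use I0 in auto)
  define ref where "ref = (\<lambda>(t, w). case t of (u, g, v) \<Rightarrow> (u @ w, sect g w, v @ \<phi> g w))"
  define S where "S = ref ` {(t, w). t \<in> I0 \<and> length (fst t) + length w = l}"
  have finW: "finite {w :: 'a list. length w \<le> l}"
    using finite_lists_length_le[of "UNIV :: 'a set" l] by simp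
  have "finite S" unfolding S_def
    by (rule finite_imageI, rule finite_subset[of _ "I0 \<times> {w. length w \<le> l}"]) (use I0(1) finW in auto)
  have S: "t \<in> triples \<and> length (fst t) = l \<and> Z t \<subseteq> U \<and> (\<forall>\<gamma>\<in>Z t. \<forall>\<gamma>'\<in>Z t. cmod (f \<gamma> - f \<gamma>') \<le> \<epsilon>)" if "t \<in> S" for t
  proof -
    obtain u g v w where w: "(u, g, v) \<in> I0" "length u + length w = l" "t = (u @ w, sect g w, v @ \<phi> g w)"
      using \<open>t \<in> S\<close> unfolding S_def ref_def by auto
    then have T0: "(u, g, v) \<in> T0" using I0(2) by blast
    then have g: "g \<in> carrier \<Gamma>" by (simp add: T0_def)
    have "Z t \<subseteq> Z (u, g, v)" using bisec_refine[OF g, of _ u w v] unfolding w(3) by auto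
    then show ?thesis using T0 g w(2,3) unfolding T0_def by auto
  qed
  have KS: "\<exists>t\<in>S. \<gamma> \<in> Z t" if \<gamma>K: "\<gamma> \<in> K" for \<gamma>
  proof -
    obtain t where "t \<in> I0" "\<gamma> \<in> Z t" using \<gamma>K I0(3) by blast
    then obtain u g v where t: "(u, g, v) \<in> I0" "\<gamma> \<in> Z (u, g, v)" by (cases t) auto
    then have g: "g \<in> carrier \<Gamma>" using I0(2) by (auto simp: T0_def)
    have ul: "length u \<le> l" using l[OF t(1)] by simp
    have "src G \<gamma> \<in> cyl u" using in_bisec_src(1)[of "cmap u g v" \<gamma>] t g by simp
    then obtain w where len: "length u + length w = l" and "src G \<gamma> \<in> cyl (u @ w)"
      using ul by (rule cyl_extend)
    then have "\<gamma> \<in> Z (u @ w, sect g w, v @ \<phi> g w)" using t(2) bisec_refine[OF g, of \<gamma> u w v] by simp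
    moreover have "(u @ w, sect g w, v @ \<phi> g w) \<in> S"
      unfolding S_def ref_def using t(1) len by (intro image_eqI[of _ _ "((u, g, v), w)"]) auto
    ultimately show ?thesis by blast
  qed
  define \<tau> where "\<tau> d = (SOME t. t \<in> S \<and> fst t = d)" for d
  have \<tau>: "\<tau> d \<in> S" "fst (\<tau> d) = d" if "d \<in> fst ` S" for d
    using that someI_ex[of "\<lambda>t. t \<in> S \<and> fst t = d"] unfolding \<tau>_def by blast+
  define S' where "S' = \<tau> ` fst ` S"
  have S': "finite S'" "S' \<subseteq> S" 
    unfolding S'_def using \<open>finite S\<close> by simp (use \<tau>(1) in blast)
  have S'fst: "t = t'" if "t \<in> S'" "t' \<in> S'" "fst t = fst t'" for t t'
  proof -
    obtain d d' where "d \<in> fst ` S" "t = \<tau> d" "d' \<in> fst ` S" "t' = \<tau> d'"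
      using \<open>t \<in> S'\<close> \<open>t' \<in> S'\<close> unfolding S'_def by (elim imageE) blast
    then show ?thesis using \<tau>(2) \<open>fst t = fst t'\<close> by metis
  qed
  define p where "p t = (SOME \<gamma>. \<gamma> \<in> Z t)" for t
  define s where "s = combo S' (\<lambda>t. f (p t))"
  have "simple s" unfolding simple_def s_def using S' S by blast
  moreover have "rep_bound (\<lambda>g. f g - s g) \<epsilon>"
  proof (rule rep_bound_bisection[OF Uinj])
    have ZU: "Z t \<subseteq> U" if "t \<in> S'" for t using that S S'(2) by blast
    have s_in: "s \<gamma> = f (p t)" if "t \<in> S'" "\<gamma> \<in> Z t" for \<gamma> t
    proof -
      have "\<gamma> \<notin> Z t'" if "t' \<in> S' - {t}" for t'
      proof
        assume "\<gamma> \<in> Z t'"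
        then have "src G \<gamma> \<in> cyl (fst t')" "src G \<gamma> \<in> cyl (fst t)"
          using Z_src S S'(2) \<open>t \<in> S'\<close> \<open>\<gamma> \<in> Z t\<close> that by blast+
        moreover have "length (fst t') = length (fst t)" 
          using S[of t] S[of t'] S'(2) \<open>t \<in> S'\<close> that by blast
        ultimately have "fst t' = fst t" by (metis in_cyl_iff)
        then show False using S'fst \<open>t \<in> S'\<close> that by blast
      qed
      then have "s \<gamma> = (\<Sum>t'\<in>{t}. f (p t') * indicator (Z t') \<gamma>)"
        unfolding s_def combo_def by (intro sum.mono_neutral_right S'(1)) (use \<open>t \<in> S'\<close> in auto)
      then show ?thesis using \<open>\<gamma> \<in> Z t\<close> by simp
    qed
    have s_out: "s \<gamma> = 0" if "\<And>t. t \<in> S' \<Longrightarrow> \<gamma> \<notin> Z t" for \<gamma>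
      unfolding s_def combo_def by (rule sum.neutral) (use that in auto)
    show "f g - s g = 0" if "g \<notin> U" for g
      using that f(2) s_out ZU by force
    show "0 \<le> \<epsilon>" using \<epsilon> by simp
    show "cmod (f \<gamma> - s \<gamma>) \<le> \<epsilon>" for \<gamma>
    proof (cases "\<exists>t\<in>S'. \<gamma> \<in> Z t")
      case True
      then obtain t where t: "t \<in> S'" "\<gamma> \<in> Z t" by blast
      then have "p t \<in> Z t" unfolding p_def by (metis someI)
      then show ?thesis using s_in[OF t] S[of t] S'(2) t by auto
    next
      case False
      have "\<gamma> \<notin> K"
      proof
        assume "\<gamma> \<in> K"
        then obtain t where t: "t \<in> S" "\<gamma> \<in> Z t" using KS by blast
        \<comment> \<open>The piece kept for this cylinder also contains \<gamma>: it has an arrow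
          with the same source, and the source map is injective on \<open>U\<close>.\<close>
        let ?t = "\<tau> (fst t)"
        have t': "?t \<in> S'" "fst ?t = fst t" "?t \<in> S" using t(1) \<tau> by (auto simp: S'_def)
        have "src G \<gamma> \<in> src G ` Z ?t" using Z_src[of t] Z_src[of ?t] S[OF t(1)] S[OF t'(3)] t'(2) t(2) by auto
        then obtain \<gamma>' where "\<gamma>' \<in> Z ?t" "src G \<gamma>' = src G \<gamma>" by auto
        moreover have "\<gamma>' \<in> U" "\<gamma> \<in> U" using calculation ZU[OF t'(1)] S[OF t(1)] t(2) by auto
        ultimately have "\<gamma> \<in> Z ?t" using Uinj(3) by (auto dest: inj_onD)
        then show False using False t'(1) by blast
      qed
      then have "f \<gamma> = 0" "s \<gamma> = 0" using fK s_out False by auto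
      then show ?thesis using \<epsilon> by simp
    qed
  qed
  ultimately show ?thesis by blast
qed

lemma connes_approx:
  assumes "f \<in> connes_algebra G" "0 < \<epsilon>"
  shows "\<exists>s. simple s \<and> rep_bound (\<lambda>g. f g - s g) \<epsilon>"
proof -
  obtain F c where F: "finite F" "f = (\<lambda>g. \<Sum>h\<in>F. c h * h g)"
    and FS: "F \<subseteq> {f. \<exists>U. open_bisection G U \<and> f \<in> Cc_on (subtopology (arrows G) U) \<and> (\<forall>g. g \<notin> U \<longrightarrow> f g = 0)}"
    using assms(1) unfolding connes_algebra_def cspan_def by blast
  \<comment> \<open>The summand 1 keeps the denominator positive when all coefficients
    vanish.\<close>
  define \<epsilon>' where "\<epsilon>' = \<epsilon> / (1 + (\<Sum>h\<in>F. cmod (c h)))"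
  have C: "0 \<le> (\<Sum>h\<in>F. cmod (c h))" by (simp add: sum_nonneg)
  then have \<epsilon>': "0 < \<epsilon>'" using assms(2) by (simp add: \<epsilon>'_def)
  have "\<exists>s. simple s \<and> rep_bound (\<lambda>g. h g - s g) \<epsilon>'" if "h \<in> F" for h
    using FS that Cc_on_approx[OF _ _ _ \<epsilon>'] by blast
  then obtain s where s: "\<And>h. h \<in> F \<Longrightarrow> simple (s h)" "\<And>h. h \<in> F \<Longrightarrow> rep_bound (\<lambda>g. h g - s h g) \<epsilon>'" by metis
  let ?s = "\<lambda>g. \<Sum>h\<in>F. c h * s h g"
  have "simple ?s" by (rule simple_sum[OF F(1) s(1)])
  moreover have "rep_bound (\<lambda>g. \<Sum>h\<in>F. c h * (h g - s h g)) (\<Sum>h\<in>F. cmod (c h) * \<epsilon>')"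
    by (rule rep_bound_sum[OF F(1) s(2)])
  then have "rep_bound (\<lambda>g. f g - ?s g) (\<Sum>h\<in>F. cmod (c h) * \<epsilon>')"
    by (simp add: F(2) right_diff_distrib sum_subtractf)
  moreover have "(\<Sum>h\<in>F. cmod (c h) * \<epsilon>') \<le> \<epsilon>"
  proof -
    have "(\<Sum>h\<in>F. cmod (c h) * \<epsilon>') = (\<Sum>h\<in>F. cmod (c h)) * \<epsilon>'" by (simp add: sum_distrib_right)
    also have "\<dots> \<le> \<epsilon>"
    proof -
      have "x * (\<epsilon> / (1 + x)) \<le> \<epsilon>" if "0 \<le> x" for x :: real using that assms(2) by (simp add: field_simps)
      then show ?thesis unfolding \<epsilon>'_def using C by blast
    qed
    finally show ?thesis .
  qed
  ultimately show ?thesis using rep_bound_mono by blast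
qed

lemma reduced_algebra_approx:
  assumes "a \<in> reduced_algebra G" "0 < \<epsilon>"
  shows "\<exists>s. simple s \<and> reduced_norm G (a - regular_rep G s) \<le> ennreal \<epsilon>"
proof -
  have "0 < \<epsilon> / 2" using assms(2) by simp
  then obtain f where f: "f \<in> connes_algebra G" "reduced_norm G (a - regular_rep G f) < ennreal (\<epsilon> / 2)"
    using assms(1) unfolding reduced_algebra_def by blast
  obtain s where s: "simple s" "rep_bound (\<lambda>g. f g - s g) (\<epsilon> / 2)"
    using connes_approx[OF f(1) \<open>0 < \<epsilon> / 2\<close>] by blast
  obtain B where B: "rep_bound s B" using simple_rep_bound[OF s(1)] by blast
  have "rep_bound (\<lambda>g. 1 * (f g - s g) + 1 * s g) (cmod 1 * (\<epsilon> / 2) + cmod 1 * B)"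
    by (rule rep_bound_lincomb2[OF s(2) B])
  then have fB: "rep_bound f (\<epsilon> / 2 + B)" by simp
  have "reduced_norm G (a - regular_rep G s) \<le> ennreal (\<epsilon> / 2 + \<epsilon> / 2)"
    by (rule reduced_norm_diff_trans[OF assms(1) fB B s(2)]) (use f(2) assms(2) in auto)
  then show ?thesis using s(1) by auto
qed

text \<open>For a convolution operator the entry depends only on the quotient. Entries and values
  are both continuous in the reduced norm, so the identity passes from the approximants to
  \<open>a\<close>.\<close>

lemma entry_value:
  assumes "a \<in> reduced_algebra G" "\<delta> \<in> fib x" "h \<in> fib x"
  shows "a x (indicator {h}) \<delta> = value_at G a (gdiv \<delta> h)"
proof -
  have "cmod (a x (indicator {h}) \<delta> - value_at G a (gdiv \<delta> h)) \<le> 2 * \<epsilon>" if \<epsilon>: "0 < \<epsilon>" for \<epsilon>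
  proof -
    obtain s where s: "simple s" "reduced_norm G (a - regular_rep G s) \<le> ennreal \<epsilon>"
      using reduced_algebra_approx[OF assms(1) \<epsilon>] by blast
    obtain B where B: "rep_bound s B" using simple_rep_bound[OF s(1)] by blast
    have "gdiv \<delta> h \<in> arr" using assms gdiv_props(1) by (simp add: fib_iff)
    then have "cmod (value_at G a (gdiv \<delta> h) - s (gdiv \<delta> h)) \<le> \<epsilon>"
      using value_close[OF assms(1) B _ s(2)] that by simp
    moreover have "cmod (a x (indicator {h}) \<delta> - s (gdiv \<delta> h)) \<le> \<epsilon>"
      using entry_close[OF assms(1) B _ s(2) assms(2,3)] that by simp
    ultimately have "cmod ((a x (indicator {h}) \<delta> - s (gdiv \<delta> h)) - (value_at G a (gdiv \<delta> h) - s (gdiv \<delta> h))) \<le> \<epsilon> + \<epsilon>"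
      by (rule order_trans[OF norm_triangle_ineq4 add_mono, rotated])
    then show ?thesis by simp
  qed
  note * = this
  have "cmod (a x (indicator {h}) \<delta> - value_at G a (gdiv \<delta> h)) \<le> 0"
  proof (rule field_le_epsilon)
    fix e :: real assume "0 < e"
    then show "cmod (a x (indicator {h}) \<delta> - value_at G a (gdiv \<delta> h)) \<le> 0 + e" using *[of "e / 2"] by simp
  qed
  then show ?thesis by simp
qed

subsection \<open>Singular elements\<close>

text \<open>An approximant within a third of the value at \<gamma> is constant near \<gamma>,
  because the source is regular. A nonzero value of \<open>a\<close> would therefore persist on an
  open set.\<close>

lemma singular_value_regular:
  assumes "a \<in> singular_ideal G" "\<gamma> \<in> arr" "regular (src G \<gamma>)"
  shows "value_at G a \<gamma> = 0"
proof (rule ccontr)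
  assume nz: "value_at G a \<gamma> \<noteq> 0"
  define \<epsilon> where "\<epsilon> = cmod (value_at G a \<gamma>) / 3"
  have \<epsilon>: "0 < \<epsilon>" using nz by (simp add: \<epsilon>_def)
  have a: "a \<in> reduced_algebra G" using assms(1) by (simp add: singular_ideal_def)
  obtain s where s: "simple s" "reduced_norm G (a - regular_rep G s) \<le> ennreal \<epsilon>"
    using reduced_algebra_approx[OF a \<epsilon>] by blast
  obtain B where B: "rep_bound s B" using simple_rep_bound[OF s(1)] by blast
  obtain I c where I: "finite I" "I \<subseteq> triples" "s = combo I c" using s(1) unfolding simple_def by blast
  let ?F = "(\<lambda>(u, g, v). cmap u g v) ` I"
  have "finite ?F" "?F \<subseteq> IS" using I by auto
  then obtain U where U: "openin (arrows G) U" "\<gamma> \<in> U"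
      "\<And>S \<gamma>'. S \<in> ?F \<Longrightarrow> \<gamma>' \<in> U \<Longrightarrow> \<gamma>' \<in> bisec S \<longleftrightarrow> \<gamma> \<in> bisec S"
    using bisec_locally_constant_finite[OF assms(2,3), of ?F] by blast
  have sU: "s \<gamma>' = s \<gamma>" if "\<gamma>' \<in> U" for \<gamma>'
  proof -
    have "\<gamma>' \<in> Z t \<longleftrightarrow> \<gamma> \<in> Z t" if "t \<in> I" for t
      using U(3)[OF imageI[OF that] \<open>\<gamma>' \<in> U\<close>] by (cases t) simp
    then show ?thesis unfolding I(3) combo_def by (intro sum.cong refl) (simp add: indicator_def)
  qed
  have "value_at G a \<gamma>' \<noteq> 0" if "\<gamma>' \<in> U" for \<gamma>'
  proof
    assume 0: "value_at G a \<gamma>' = 0"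
    have "\<gamma>' \<in> arr" using that U(1) openin_subset by blast
    then have "cmod (value_at G a \<gamma>' - s \<gamma>') \<le> \<epsilon>" by (intro value_close[OF a B _ s(2)]) (use \<epsilon> in auto)
    then have "cmod (s \<gamma>) \<le> \<epsilon>" using 0 sU[OF that] by simp
    moreover have "cmod (value_at G a \<gamma> - s \<gamma>) \<le> \<epsilon>" by (rule value_close[OF a B _ s(2) assms(2)]) (use \<epsilon> in simp)
    ultimately have "cmod (value_at G a \<gamma>) \<le> \<epsilon> + \<epsilon>"
      using norm_triangle_ineq[of "value_at G a \<gamma> - s \<gamma>" "s \<gamma>"] by simp
    then show False using \<epsilon> by (simp add: \<epsilon>_def)
  qed
  then have "U \<subseteq> {g \<in> arr. value_at G a g \<noteq> 0}" using U(1) openin_subset by blast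
  then have "U \<subseteq> arrows G interior_of {g \<in> arr. value_at G a g \<noteq> 0}" using U(1) by (rule interior_of_maximal)
  then show False using assms(1) U(2) by (auto simp: singular_ideal_def)
qed

text \<open>The source map is open and regular words are dense, so every nonempty open set of arrows
  contains one with regular source, where \<open>f\<close> vanishes.\<close>

lemma simple_singular:
  assumes "simple f" "countable (carrier \<Gamma>)"
    and "\<And>\<gamma>. \<gamma> \<in> arr \<Longrightarrow> regular (src G \<gamma>) \<Longrightarrow> f \<gamma> = 0"
  shows "regular_rep G f \<in> algebraic_singular_ideal G"
proof -
  obtain B where B: "rep_bound f B" using simple_rep_bound[OF assms(1)] by blast
  then have r: "rowfin f" by (simp add: rep_bound_def)
  have "arrows G interior_of {g \<in> arr. value_at G (regular_rep G f) g \<noteq> 0} = {}"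
  proof (rule ccontr)
    assume "arrows G interior_of {g \<in> arr. value_at G (regular_rep G f) g \<noteq> 0} \<noteq> {}"
    then obtain \<gamma> where \<gamma>: "\<gamma> \<in> arrows G interior_of {g \<in> arr. value_at G (regular_rep G f) g \<noteq> 0}" by blast
    define U where "U = arrows G interior_of {g \<in> arr. value_at G (regular_rep G f) g \<noteq> 0}"
    have U: "openin (arrows G) U" "U \<subseteq> {g \<in> arr. value_at G (regular_rep G f) g \<noteq> 0}" "U \<noteq> {}"
      unfolding U_def by (rule openin_interior_of, rule interior_of_subset, use \<gamma> in blast)
    have "openin word_topology (src G ` U)" "src G ` U \<noteq> {}" using U open_src by auto
    then obtain \<xi> where "\<xi> \<in> src G ` U" "regular \<xi>" using regular_dense[OF assms(2)] by blast
    then obtain \<gamma>' where "\<gamma>' \<in> U" "regular (src G \<gamma>')" by blast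
    then have "\<gamma>' \<in> arr" "value_at G (regular_rep G f) \<gamma>' \<noteq> 0" "f \<gamma>' = 0" using U(2) assms(3) by blast+
    then show False using value_at_regular_rep[OF r] by simp
  qed
  then show ?thesis
    using regular_rep_simple_reduced[OF assms(1)] simple_steinberg[OF assms(1)]
    unfolding algebraic_singular_ideal_def singular_ideal_def by blast
qed

end

lemma sum_rearrange:
  fixes b :: "'p \<Rightarrow> 'n \<Rightarrow> complex"
  shows "(\<Sum>p\<in>P. \<Sum>g\<in>N. b p g * (\<Sum>i\<in>J. A p i * X i g)) = (\<Sum>i\<in>J. \<Sum>p\<in>P. A p i * (\<Sum>g\<in>N. b p g * X i g))"
proof -
  have "(\<Sum>p\<in>P. \<Sum>g\<in>N. b p g * (\<Sum>i\<in>J. A p i * X i g)) = (\<Sum>p\<in>P. \<Sum>g\<in>N. \<Sum>i\<in>J. A p i * (b p g * X i g))"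
    by (simp add: sum_distrib_left mult.left_commute)
  also have "\<dots> = (\<Sum>p\<in>P. \<Sum>i\<in>J. \<Sum>g\<in>N. A p i * (b p g * X i g))"
    by (intro sum.cong refl sum.swap)
  also have "\<dots> = (\<Sum>i\<in>J. \<Sum>p\<in>P. \<Sum>g\<in>N. A p i * (b p g * X i g))" by (rule sum.swap)
  finally show ?thesis by (simp add: sum_distrib_left)
qed

context self_similar_action
begin

subsection \<open>Correcting an approximant\<close>

lemma germ_cmap_Nil_inject:
  assumes "2 \<le> CARD('a)" "g \<in> carrier \<Gamma>" "gm (cmap [] g u) x = gm (cmap [] g u') x"
  shows "u = u'"
proof -
  have "near x (cmap [] g u) (cmap [] g u')"
    using assms germ_eq_iff[of "cmap [] g u" x "cmap [] g u'" x] by simp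
  then show ?thesis using near_cmap_iff[OF assms(1,2,2), of "[]" x u u'] by simp
qed

text \<open>Over the same word \<open>x\<close>, the quotient of the arrows given by
  \<open>v g\<close> and by \<open>u\<close> is the germ of the triple \<open>u\<close>,
  \<open>g\<close>, \<open>v\<close>. Values of \<open>f\<close> at such germs are thus entries of
  its operator on the fibre of \<open>x\<close>.\<close>

lemma gdiv_germ_cmap:
  assumes "g \<in> carrier \<Gamma>"
  shows "gdiv (gm (cmap [] g v) x) (gm (cmap [] \<one>\<^bsub>\<Gamma>\<^esub> u) x) = gm (cmap u g v) (u \<frown> x)"
proof -
  have "cmap [] g v \<circ>\<^sub>m cmap u \<one>\<^bsub>\<Gamma>\<^esub> [] = cmap u g v"
  proof
    fix \<zeta> show "(cmap [] g v \<circ>\<^sub>m cmap u \<one>\<^bsub>\<Gamma>\<^esub> []) \<zeta> = cmap u g v \<zeta>"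
      by (cases "\<zeta> \<in> cyl u") (auto simp: map_comp_def cylinder_map_def)
  qed
  then show ?thesis
    using gdiv_germ(1)[of "cmap [] g v" "cmap [] \<one>\<^bsub>\<Gamma>\<^esub> u" x "u \<frown> x"] assms
    by (simp add: partial_inverse_cmap)
qed

text \<open>For \<open>u\<close> at least as long as the domain word of \<open>t\<close>: on the
  cylinder of \<open>u\<close> the map of \<open>t\<close> is given by a triple with range word
  \<open>v\<close> and group element \<open>restriction t u\<close>.\<close>

definition restricts_to :: "'a list \<times> 'c \<times> 'a list \<Rightarrow> 'a list \<Rightarrow> 'a list \<Rightarrow> bool" where
  "restricts_to t u v \<longleftrightarrow> (case t of (u', g, v') \<Rightarrow>
     take (length u') u = u' \<and> v = v' @ \<phi> g (drop (length u') u))"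

definition restriction :: "'a list \<times> 'c \<times> 'a list \<Rightarrow> 'a list \<Rightarrow> 'c" where
  "restriction t u = (case t of (u', g, v') \<Rightarrow> sect g (drop (length u') u))"

lemma germ_in_Z_iff:
  assumes "2 \<le> CARD('a)" "t \<in> triples" "length (fst t) \<le> length u" "h \<in> carrier \<Gamma>"
  shows "gm (cmap u h v) (u \<frown> y) \<in> Z t \<longleftrightarrow>
    restricts_to t u v \<and> near y (cmap [] h []) (cmap [] (restriction t u) [])"
proof -
  obtain u' g v' where t: "t = (u', g, v')" "g \<in> carrier \<Gamma>" using assms(2) by auto
  have len: "length u' \<le> length u" using assms(3) t by simp
  let ?\<gamma> = "gm (cmap u h v) (u \<frown> y)"
  have src: "src G ?\<gamma> = u \<frown> y" using assms(4) by simp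
  show ?thesis
  proof (cases "take (length u') u = u'")
    case True
    define w where "w = drop (length u') u"
    have u: "u = u' @ w" unfolding w_def by (metis True append_take_drop_id)
    have "?\<gamma> \<in> Z t \<longleftrightarrow> ?\<gamma> \<in> bisec (cmap u (sect g w) (v' @ \<phi> g w))"
      using bisec_refine[OF t(2), of ?\<gamma> u' w v'] src unfolding t u by simp
    also have "\<dots> \<longleftrightarrow> v = v' @ \<phi> g w \<and> near y (cmap [] h []) (cmap [] (sect g w) [])"
      using germ_cmap_eq_iff[OF assms(1,4) sect_closed[OF t(2)]] .
    finally show ?thesis using True by (simp add: restricts_to_def restriction_def t w_def)
  next
    case False
    have "u \<frown> y \<notin> cyl u'" using False len by (simp add: in_cyl_iff)
    then have "?\<gamma> \<notin> Z t" using in_bisec_src(1)[of "cmap u' g v'" ?\<gamma>] src t by auto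
    then show ?thesis using False by (simp add: restricts_to_def t)
  qed
qed

section \<open>Sampling over regular words and Fejer weights\<close>

text \<open>The indicator of the bisection of the group element \<open>g'\<close>, evaluated at the
  germ of \<open>fst q\<close> over the word \<open>snd q\<close>. This is the family to which
  \<open>interpolation\<close> is applied.\<close>

definition same_germ :: "'c \<Rightarrow> 'c \<times> 'a word \<Rightarrow> complex" where
  "same_germ g' q = of_bool (near (snd q) (cmap [] (fst q) []) (cmap [] g' []))"

text \<open>The share of domain lengths in the window whose shift by the degree \<open>k\<close> of
  the triple stays in the window. For positive \<open>L\<close> this is the Fejer weight max 0 (1 -
  |k| / L); the inequalities use sums because subtraction of naturals truncates.\<close>

definition weight :: "nat \<Rightarrow> nat \<Rightarrow> 'a list \<times> 'c \<times> 'a list \<Rightarrow> real" where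
  "weight n L t = real (card {l \<in> {n..<n + L}. n + length (fst t) \<le> l + length (snd (snd t)) \<and>
     l + length (snd (snd t)) < n + L + length (fst t)}) / real L"

lemma weight_le_1: "0 < L \<Longrightarrow> weight n L t \<le> 1"
proof -
  assume L: "0 < L"
  have "card {l \<in> {n..<n + L}. n + length (fst t) \<le> l + length (snd (snd t)) \<and>
     l + length (snd (snd t)) < n + L + length (fst t)} \<le> card {n..<n + L}"
    by (rule card_mono) auto
  then show ?thesis using L by (simp add: weight_def)
qed

text \<open>Estimating the degree by \<open>length u + length v\<close> is crude but avoids absolute
  values, and the bound still tends to 0 for large \<open>L\<close>.\<close>

lemma weight_ge: 
  assumes "0 < L"
  shows "1 - weight n L (u, g, v) \<le> real (length u + length v) / real L"
proof -
  let ?A = "{l \<in> {n..<n + L}. n + length u \<le> l + length v \<and> l + length v < n + L + length u}"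
  have "{n + length u..<n + L - length v} \<subseteq> ?A" by auto
  then have "card {n + length u..<n + L - length v} \<le> card ?A" by (rule card_mono[rotated]) auto
  then have "L \<le> card ?A + (length u + length v)" by simp
  then have "real L - real (card ?A) \<le> real (length u + length v)" by linarith
  then have "(real L - real (card ?A)) / real L \<le> real (length u + length v) / real L"
    by (rule divide_right_mono) simp
  then show ?thesis using assms by (simp add: weight_def diff_divide_distrib)
qed

text \<open>
  An arrow of a given degree is of the form \<open>(u, g, v)\<close> for one pair \<open>u, v\<close> of each admissible length,
  so the number of such pairs with lengths in the window depends on the degree only.
\<close>

lemma card_window_pairs:
  assumes card: "2 \<le> CARD('a)" and t: "t \<in> triples" "length (fst t) \<le> n" and L: "0 < L"
    and \<gamma>: "\<gamma> \<in> Z t"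
  shows "real (card {i \<in> window n L \<times> window n L. \<exists>g\<in>carrier \<Gamma>. \<gamma> \<in> bisec (cmap (snd i) g (fst i))}) =
    real L * weight n L t"
proof -
  obtain u g v where tt: "t = (u, g, v)" and g: "g \<in> carrier \<Gamma>" using t(1) by auto
  have \<gamma>b: "\<gamma> \<in> bisec (cmap u g v)" using \<gamma> tt by simp
  have un: "length u \<le> n" using t(2) tt by simp
  let ?E = "{i \<in> window n L \<times> window n L. \<exists>g\<in>carrier \<Gamma>. \<gamma> \<in> bisec (cmap (snd i) g (fst i))}"
  let ?A = "{l \<in> {n..<n + L}. n + length u \<le> l + length v \<and> l + length v < n + L + length u}"
  have "bij_betw (length \<circ> snd) ?E ?A"
    unfolding bij_betw_def
  proof (intro conjI inj_onI subset_antisym subsetI)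
    fix i j assume i: "i \<in> ?E" and j: "j \<in> ?E" and ij: "(length \<circ> snd) i = (length \<circ> snd) j"
    obtain h where h: "h \<in> carrier \<Gamma>" "\<gamma> \<in> bisec (cmap (snd i) h (fst i))" using i by blast
    obtain k where k: "k \<in> carrier \<Gamma>" "\<gamma> \<in> bisec (cmap (snd j) k (fst j))" using j by blast
    have s: "src G \<gamma> \<in> cyl (snd i)" "src G \<gamma> \<in> cyl (snd j)"
      using in_bisec_src(1)[OF _ h(2)] in_bisec_src(1)[OF _ k(2)] h k by simp_all
    have "length (snd i) = length (snd j)" using ij by simp
    then have ieq: "snd i = snd j" using s unfolding in_cyl_iff by metis
    obtain x where x: "src G \<gamma> = snd i \<frown> x" using s(1) by blast
    have "\<gamma> = gm (cmap (snd i) h (fst i)) (snd i \<frown> x)" using in_bisec_src(2)[OF _ h(2)] h(1) x by simp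
    then have "fst i = fst j" using germ_cmap_eq_iff[OF card h(1) k(1)] k(2) ieq by metis
    then show "i = j" using ieq by (simp add: prod_eq_iff)
  next
    fix l assume "l \<in> (length \<circ> snd) ` ?E"
    then obtain i h where i: "i \<in> window n L \<times> window n L" "l = length (snd i)"
      and h: "h \<in> carrier \<Gamma>" "\<gamma> \<in> bisec (cmap (snd i) h (fst i))" by auto
    have "length v + length (snd i) = length (fst i) + length u" by (rule bisec_degree[OF card g h(1) \<gamma>b h(2)])
    then show "l \<in> ?A" using i by (auto simp: window_def)
  next
    fix l assume l: "l \<in> ?A"
    \<comment> \<open>Every admissible length is reached by lengthening \<open>u\<close>, because
      \<open>length u\<close> is at most the lower end \<open>n\<close> of the window.\<close>
    have ul: "length u \<le> l" using un l by simp
    have "src G \<gamma> \<in> cyl u" using in_bisec_src(1)[OF _ \<gamma>b] g by simp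
    then obtain w where len: "length u + length w = l" and "src G \<gamma> \<in> cyl (u @ w)"
      using ul by (rule cyl_extend)
    then have "\<gamma> \<in> bisec (cmap (u @ w) (sect g w) (v @ \<phi> g w))" using \<gamma>b bisec_refine[OF g] by simp
    then have "(v @ \<phi> g w, u @ w) \<in> ?E" using g l len by (auto simp: window_def)
    then show "l \<in> (length \<circ> snd) ` ?E" using len by (intro image_eqI[of _ _ "(v @ \<phi> g w, u @ w)"]) auto
  qed
  then have "card ?E = card ?A" by (rule bij_betw_same_card)
  then show ?thesis using L by (simp add: weight_def tt)
qed

definition window_matrix :: "('a germ \<Rightarrow> complex) \<Rightarrow> 'c \<times> 'a word \<Rightarrow> 'a list \<Rightarrow> 'a list \<Rightarrow> complex" where
  "window_matrix f p v u = f (gm (cmap u (fst p) v) (u \<frown> snd p))"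

text \<open>Index pairs list the range word before the domain word, as row and column of a matrix,
  whereas triples begin with the domain word.\<close>

definition window_fun :: "nat \<Rightarrow> nat \<Rightarrow> ('a list \<Rightarrow> 'a list \<Rightarrow> complex) \<Rightarrow> 'c \<Rightarrow> 'a germ \<Rightarrow> complex" where
  "window_fun n L M g = (\<lambda>\<gamma>. \<Sum>i\<in>window n L \<times> window n L.
     (M (fst i) (snd i) / of_nat L) * indicator (bisec (cmap (snd i) g (fst i))) \<gamma>)"

text \<open>For fixed words \<open>u\<close> and \<open>v\<close> with \<open>u\<close> long,
  \<open>f\<close> on germs from \<open>u\<close> to \<open>v\<close> is a combination of the
  functions \<open>same_germ g\<close> with \<open>g\<close> in \<open>N\<close>, so interpolation
  returns \<open>f \<gamma>\<close> exactly. The window repeats this once for each pair of words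
  representing \<gamma>; their number divided by \<open>L\<close> is the weight.\<close>

lemma window_interpolation:
  assumes card: "2 \<le> CARD('a)" and I: "finite I" "I \<subseteq> triples" and N: "finite N" "N \<subseteq> carrier \<Gamma>" and L: "0 < L"
    and n: "\<And>t. t \<in> I \<Longrightarrow> length (fst t) \<le> n" "\<And>t u. t \<in> I \<Longrightarrow> n \<le> length u \<Longrightarrow> restriction t u \<in> N"
    and P: "P \<subseteq> carrier \<Gamma> \<times> Collect regular"
      "\<And>g q. g \<in> N \<Longrightarrow> q \<in> carrier \<Gamma> \<times> Collect regular \<Longrightarrow>
        same_germ g q = (\<Sum>p\<in>P. same_germ g p * (\<Sum>g'\<in>N. b p g' * same_germ g' q))"
    and \<gamma>: "\<gamma> \<in> arr" "regular (src G \<gamma>)"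
  shows "(\<Sum>p\<in>P. \<Sum>g\<in>N. b p g * window_fun n L (window_matrix (combo I c) p) g \<gamma>) =
    (\<Sum>t\<in>I. of_real (weight n L t) * c t * indicator (Z t) \<gamma>)"
proof -
  let ?W = "window n L" and ?f = "combo I c"
  let ?E = "{i \<in> ?W \<times> ?W. \<exists>g\<in>carrier \<Gamma>. \<gamma> \<in> bisec (cmap (snd i) g (fst i))}"
  have finW: "finite (?W \<times> ?W)" using finite_window by simp
  have expand: "?f (gm (cmap u h v) (u \<frown> y)) =
      (\<Sum>g\<in>N. (\<Sum>t\<in>{t \<in> I. restricts_to t u v \<and> restriction t u = g}. c t) * same_germ g (h, y))"
    if u: "n \<le> length u" and h: "h \<in> carrier \<Gamma>" for u v h y
  proof -
    let ?I = "{t \<in> I. restricts_to t u v}"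
    have finI: "finite ?I" using I(1) by simp
    have "?f (gm (cmap u h v) (u \<frown> y)) = (\<Sum>t\<in>I. if restricts_to t u v then c t * same_germ (restriction t u) (h, y) else 0)"
      unfolding combo_def
    proof (rule sum.cong[OF refl])
      fix t assume t: "t \<in> I"
      have "length (fst t) \<le> length u" using n(1)[OF t] u by simp
      then show "c t * indicator (Z t) (gm (cmap u h v) (u \<frown> y)) =
          (if restricts_to t u v then c t * same_germ (restriction t u) (h, y) else 0)"
        using germ_in_Z_iff[OF card subsetD[OF I(2) t] _ h, of u v y] by (simp add: same_germ_def indicator_def)
    qed
    also have "\<dots> = (\<Sum>t\<in>?I. c t * same_germ (restriction t u) (h, y))"
      by (rule sum.inter_filter[OF I(1), symmetric])
    also have "\<dots> = (\<Sum>g\<in>N. \<Sum>t\<in>{t \<in> ?I. restriction t u = g}. c t * same_germ (restriction t u) (h, y))"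
      by (rule sum.group[OF finI N(1), symmetric]) (use n(2) u in auto)
    also have "\<dots> = (\<Sum>g\<in>N. (\<Sum>t\<in>{t \<in> I. restricts_to t u v \<and> restriction t u = g}. c t) * same_germ g (h, y))"
      unfolding sum_distrib_right by (intro sum.cong) auto
    finally show ?thesis .
  qed
  have interp: "(\<Sum>p\<in>P. window_matrix ?f p v u * (\<Sum>g\<in>N. b p g * indicator (bisec (cmap u g v)) \<gamma>)) =
      (if \<exists>g\<in>carrier \<Gamma>. \<gamma> \<in> bisec (cmap u g v) then ?f \<gamma> else 0)"
    if u: "n \<le> length u" for u v
  proof (cases "\<exists>g\<in>carrier \<Gamma>. \<gamma> \<in> bisec (cmap u g v)")
    case False
    then have "indicator (bisec (cmap u g v)) \<gamma> = (0 :: complex)" if "g \<in> N" for g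
      using N(2) that by (auto simp: indicator_def)
    then show ?thesis using False by simp
  next
    case True
    then obtain h where h: "h \<in> carrier \<Gamma>" "\<gamma> \<in> bisec (cmap u h v)" by blast
    obtain x where x: "src G \<gamma> = u \<frown> x" using in_bisec_src(1)[OF _ h(2)] h(1) by auto
    have \<gamma>x: "\<gamma> = gm (cmap u h v) (u \<frown> x)" using in_bisec_src(2)[OF _ h(2)] h(1) x by simp
    \<comment> \<open>Interpolation is available over regular words only. Dropping the prefix
      \<open>u\<close> is a map of the inverse semigroup, so it keeps regularity.\<close>
    have "regular x" using regular_IS[OF \<gamma>(2), of "cmap u \<one>\<^bsub>\<Gamma>\<^esub> []" x] x by simp
    then have q: "(h, x) \<in> carrier \<Gamma> \<times> Collect regular" using h by simp
    define d where "d g = (\<Sum>t\<in>{t \<in> I. restricts_to t u v \<and> restriction t u = g}. c t)" for g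
    have M: "window_matrix ?f p v u = (\<Sum>g\<in>N. d g * same_germ g p)" if "p \<in> P" for p
      using expand[OF u, of "fst p" v "snd p"] P(1) that by (auto simp: window_matrix_def d_def)
    have ind: "indicator (bisec (cmap u g v)) \<gamma> = same_germ g (h, x)" if "g \<in> N" for g
      using germ_cmap_eq_iff[OF card h(1), of g u v x v] N(2) that unfolding \<gamma>x
      by (auto simp: same_germ_def indicator_def)
    have "(\<Sum>p\<in>P. window_matrix ?f p v u * (\<Sum>g\<in>N. b p g * indicator (bisec (cmap u g v)) \<gamma>)) =
        (\<Sum>p\<in>P. (\<Sum>g\<in>N. d g * same_germ g p) * (\<Sum>g'\<in>N. b p g' * same_germ g' (h, x)))"
      using M ind by simp
    also have "\<dots> = (\<Sum>g\<in>N. d g * (\<Sum>p\<in>P. same_germ g p * (\<Sum>g'\<in>N. b p g' * same_germ g' (h, x))))"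
      by (simp only: sum_distrib_right sum_distrib_left[of _ _ P] mult.assoc) (rule sum.swap)
    also have "\<dots> = (\<Sum>g\<in>N. d g * same_germ g (h, x))"
      using P(2)[OF _ q] by simp
    also have "\<dots> = ?f \<gamma>" unfolding \<gamma>x expand[OF u h(1)] d_def ..
    finally show ?thesis using True by simp
  qed
  have "(\<Sum>p\<in>P. \<Sum>g\<in>N. b p g * window_fun n L (window_matrix ?f p) g \<gamma>) =
      (\<Sum>i\<in>?W \<times> ?W. \<Sum>p\<in>P. window_matrix ?f p (fst i) (snd i) / of_nat L *
        (\<Sum>g\<in>N. b p g * indicator (bisec (cmap (snd i) g (fst i))) \<gamma>))"
    unfolding window_fun_def by (rule sum_rearrange)
  also have "\<dots> = (\<Sum>i\<in>?W \<times> ?W. (if \<exists>g\<in>carrier \<Gamma>. \<gamma> \<in> bisec (cmap (snd i) g (fst i)) then ?f \<gamma> else 0) / of_nat L)"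
  proof (rule sum.cong[OF refl])
    fix i assume "i \<in> ?W \<times> ?W"
    then have "n \<le> length (snd i)" by (auto simp: window_def)
    from interp[OF this, of "fst i"]
    show "(\<Sum>p\<in>P. window_matrix ?f p (fst i) (snd i) / of_nat L *
        (\<Sum>g\<in>N. b p g * indicator (bisec (cmap (snd i) g (fst i))) \<gamma>)) =
      (if \<exists>g\<in>carrier \<Gamma>. \<gamma> \<in> bisec (cmap (snd i) g (fst i)) then ?f \<gamma> else 0) / of_nat L"
      by (simp only: times_divide_eq_left sum_divide_distrib[symmetric])
  qed
  also have "\<dots> = (\<Sum>i\<in>?E. ?f \<gamma> / of_nat L)"
    unfolding sum.inter_filter[OF finW] by (intro sum.cong) auto
  also have "\<dots> = of_nat (card ?E) / of_nat L * ?f \<gamma>" by simp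
  also have "\<dots> = (\<Sum>t\<in>I. of_real (weight n L t) * c t * indicator (Z t) \<gamma>)"
    unfolding combo_def sum_distrib_left
  proof (rule sum.cong[OF refl])
    fix t assume t: "t \<in> I"
    show "of_nat (card ?E) / of_nat L * (c t * indicator (Z t) \<gamma>) = of_real (weight n L t) * c t * indicator (Z t) \<gamma>"
    proof (cases "\<gamma> \<in> Z t")
      case True
      \<comment> \<open>The count depends on \<gamma> alone, so all triples of \<open>I\<close>
        whose bisection contains \<gamma> have the same weight and the factor can enter the
        sum.\<close>
      have "real (card ?E) / real L = weight n L t"
        using card_window_pairs[OF card subsetD[OF I(2) t] n(1)[OF t] L True] L by simp
      moreover have "of_nat (card ?E) / of_nat L = (of_real (real (card ?E) / real L) :: complex)"
        by (simp only: of_real_divide of_real_of_nat_eq)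
      ultimately show ?thesis by (simp only: mult.assoc)
    qed simp
  qed
  finally show ?thesis .
qed

text \<open>Up to sign the matrix is a submatrix of the operator of \<open>a - f\<close>. Being
  scalar, it keeps its bound when it is combined with any \<open>g\<close>, not only with the group
  element of the sample point.\<close>

lemma rep_bound_window_matrix:
  assumes card: "2 \<le> CARD('a)" and a: "a \<in> singular_ideal G"
    and f: "rep_bound f B" "0 \<le> \<epsilon>" "reduced_norm G (a - regular_rep G f) \<le> ennreal \<epsilon>"
    and p: "fst p \<in> carrier \<Gamma>" "regular (snd p)" and g: "g \<in> carrier \<Gamma>" and L: "0 < L"
  shows "rep_bound (window_fun n L (window_matrix f p) g) \<epsilon>"
  unfolding window_fun_def
proof (rule rep_bound_window[OF g L f(2)])
  fix z :: "'a list \<Rightarrow> complex"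
  let ?W = "window n L" and ?x = "snd p"
  have ra: "a \<in> reduced_algebra G" using a by (simp add: singular_ideal_def)
  define T where "T = (\<lambda>\<xi> g. a ?x \<xi> g - regular_rep G f ?x \<xi> g)"
  define k where "k u = gm (cmap [] \<one>\<^bsub>\<Gamma>\<^esub> u) ?x" for u
  define r where "r v = gm (cmap [] (fst p) v) ?x" for v
  have lin: "linear_on_l2 G ?x T"
    unfolding T_def by (rule linear_on_l2_diff[OF reduced_algebra_linear[OF ra] rep_bound_linear[OF f(1)]])
  have bnd: "l2_norm G ?x (T \<xi>) \<le> \<epsilon> * l2_norm G ?x \<xi>" if "\<xi> \<in> l2 G ?x" for \<xi>
    using f(3) reduced_norm_diff_le_iff[OF ra f(1,2)] that unfolding T_def by (simp add: regular_rep_apply)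
  have kf: "k u \<in> fib ?x" and rf: "r u \<in> fib ?x" for u using p by (simp_all add: k_def r_def fib_iff)
  have kinj: "inj_on k ?W"
    by (rule inj_onI, rule germ_cmap_Nil_inject[OF card gr.one_closed]) (simp add: k_def)
  have rinj: "inj_on r ?W"
    by (rule inj_onI, rule germ_cmap_Nil_inject[OF card p(1)]) (simp add: r_def)
  have entry: "T (indicator {k u}) (r v) = - window_matrix f p v u" for u v
  proof -
    have d: "gdiv (r v) (k u) = gm (cmap u (fst p) v) (u \<frown> ?x)"
      unfolding r_def k_def by (rule gdiv_germ_cmap[OF p(1)])
    have "regular (u \<frown> ?x)" using regular_IS[OF p(2), of "cmap [] \<one>\<^bsub>\<Gamma>\<^esub> u" "u \<frown> ?x"] by simp
    then have "value_at G a (gdiv (r v) (k u)) = 0"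
      unfolding d using p(1) by (intro singular_value_regular[OF a]) simp_all
    then have "a ?x (indicator {k u}) (r v) = 0" using entry_value[OF ra rf kf] by simp
    moreover have "regular_rep G f ?x (indicator {k u}) (r v) = window_matrix f p v u"
      using convol_indicator_point[OF _ rf kf, of f] f(1) indicator_l2(1)[OF kf] d
      by (simp add: regular_rep_apply rep_bound_def window_matrix_def)
    ultimately show ?thesis by (simp add: T_def)
  qed
  have "(\<Sum>v\<in>?W. (cmod (\<Sum>u\<in>?W. T (indicator {k u}) (r v) * z u))\<^sup>2) \<le> \<epsilon>\<^sup>2 * (\<Sum>u\<in>?W. (cmod (z u))\<^sup>2)"
    by (rule kernel_matrix_bound[OF lin bnd finite_window _ kinj _ rinj f(2)]) (use kf rf in auto)
  then show "(\<Sum>v\<in>?W. (cmod (\<Sum>u\<in>?W. window_matrix f p v u * z u))\<^sup>2) \<le> \<epsilon>\<^sup>2 * (\<Sum>u\<in>?W. (cmod (z u))\<^sup>2)"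
    unfolding entry by (simp add: sum_negf)
qed

lemma simple_window_fun: "g \<in> carrier \<Gamma> \<Longrightarrow> simple (window_fun n L M g)"
  unfolding window_fun_def
  by (rule simple_sum) (use finite_window simple_Z[of "(_, g, _)"] in auto)

section \<open>Approximation of singular elements\<close>

lemma singular_approximation:
  assumes card: "2 \<le> CARD('a)" and N: "finite N" "N \<subseteq> carrier \<Gamma>"
    and contr: "\<And>g. g \<in> carrier \<Gamma> \<Longrightarrow> \<exists>m. \<forall>v. m \<le> length v \<longrightarrow> sect g v \<in> N"
    and count: "countable (carrier \<Gamma>)" and a: "a \<in> singular_ideal G" and \<epsilon>: "0 < \<epsilon>"
  shows "\<exists>s\<in>algebraic_singular_ideal G. reduced_norm G (a - s) < ennreal \<epsilon>"
proof -
  have ra: "a \<in> reduced_algebra G" using a by (simp add: singular_ideal_def)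
  obtain P b where P: "finite P" "P \<subseteq> carrier \<Gamma> \<times> Collect regular" and
    interp: "\<forall>g\<in>N. \<forall>q\<in>carrier \<Gamma> \<times> Collect regular.
      same_germ g q = (\<Sum>p\<in>P. same_germ g p * (\<Sum>g'\<in>N. b p g' * same_germ g' q))"
    using interpolation[OF N(1), of "carrier \<Gamma> \<times> Collect regular" same_germ] by blast
  \<comment> \<open>Depends on \<open>N\<close> and the interpolation data only; the accuracy of
    \<open>f\<close>, chosen afterwards, may therefore depend on it.\<close>
  define C where "C = (\<Sum>q\<in>P \<times> N. cmod (b (fst q) (snd q)))"
  have C: "0 \<le> C" by (simp add: C_def sum_nonneg)
  \<comment> \<open>The errors add up to \<open>(2 + C) * \<eta>\<close>: \<eta> for replacing
    \<open>a\<close> by \<open>f\<close>, \<eta> for the weights, \<open>C * \<eta>\<close> for the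
    interpolant. The 3 makes the total smaller than \<epsilon>.\<close>
  define \<eta> where "\<eta> = \<epsilon> / (3 + C)"
  have \<eta>: "0 < \<eta>" using C \<epsilon> by (simp add: \<eta>_def)
  obtain f where f: "simple f" "reduced_norm G (a - regular_rep G f) \<le> ennreal \<eta>"
    using reduced_algebra_approx[OF ra \<eta>] by blast
  obtain B where B: "rep_bound f B" using simple_rep_bound[OF f(1)] by blast
  obtain I c where I: "finite I" "I \<subseteq> triples" and fI: "f = combo I c" using f(1) unfolding simple_def by blast
  have "\<exists>m. \<forall>v. m \<le> length v \<longrightarrow> sect (fst (snd t)) v \<in> N" if "t \<in> I" for t
    using contr[of "fst (snd t)"] subsetD[OF I(2) that] by auto
  then obtain m where m: "\<And>t v. t \<in> I \<Longrightarrow> m t \<le> length v \<Longrightarrow> sect (fst (snd t)) v \<in> N" by metis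
  \<comment> \<open>A word of this length has enough letters left after the domain word of any
    \<open>t\<close> for the section to fall into \<open>N\<close>. The sum serves as a common upper
    bound.\<close>
  define n where "n = (\<Sum>t\<in>I. length (fst t) + m t)"
  have n: "length (fst t) + m t \<le> n" if "t \<in> I" for t
    unfolding n_def by (rule member_le_sum[OF that]) (use I(1) in auto)
  have nlen: "length (fst t) \<le> n" if "t \<in> I" for t using n[OF that] by simp
  have nN: "restriction t u \<in> N" if "t \<in> I" "n \<le> length u" for t u
    using m[OF that(1), of "drop (length (fst t)) u"] n[OF that(1)] that(2)
    by (cases t) (simp add: restriction_def)
  \<comment> \<open>\<open>D / L\<close> bounds the change of norm caused by the weights;
    \<open>L\<close> is chosen to make it at most \<eta>.\<close>
  define D where "D = (\<Sum>t\<in>I. cmod (c t) * real (length (fst t) + length (snd (snd t))))"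
  obtain L where L: "D / \<eta> < real L" using reals_Archimedean2 by blast
  have "0 \<le> D" unfolding D_def by (intro sum_nonneg) simp
  then have "0 \<le> D / \<eta>" using \<eta> by simp
  then have L0: "0 < L" using L by linarith
  have DL: "D / real L \<le> \<eta>" using L L0 \<eta> by (simp add: field_simps)
  define f' where "f' = combo I (\<lambda>t. of_real (weight n L t) * c t)"
  define R where "R q = window_fun n L (window_matrix f (fst q)) (snd q)" for q
  \<comment> \<open>At arrows with regular source the interpolant equals the reweighted function
    \<open>f'\<close>, so \<open>j\<close> vanishes there and is singular.\<close>
  define j where "j \<gamma> = f' \<gamma> - (\<Sum>q\<in>P \<times> N. b (fst q) (snd q) * R q \<gamma>)" for \<gamma>
  have finPN: "finite (P \<times> N)" using P N by simp
  have sR: "simple (R q)" if "q \<in> P \<times> N" for q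
    unfolding R_def by (rule simple_window_fun) (use N that in auto)
  have bR: "rep_bound (R q) \<eta>" if q: "q \<in> P \<times> N" for q
    unfolding R_def using q P(2) N(2) \<eta>
    by (intro rep_bound_window_matrix[OF card a B _ f(2) _ _ _ L0]) auto
  have "simple f'" unfolding f'_def simple_def using I by blast
  then have "simple (\<lambda>\<gamma>. 1 * f' \<gamma> + (-1) * (\<Sum>q\<in>P \<times> N. b (fst q) (snd q) * R q \<gamma>))"
    by (intro simple_lincomb2 simple_sum finPN sR)
  then have sj: "simple j" by (simp add: j_def[abs_def])
  obtain B' where B': "rep_bound j B'" using simple_rep_bound[OF sj] by blast
  have "j \<gamma> = 0" if "\<gamma> \<in> arr" "regular (src G \<gamma>)" for \<gamma>
  proof -
    have "(\<Sum>q\<in>P \<times> N. b (fst q) (snd q) * R q \<gamma>) =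
        (\<Sum>p\<in>P. \<Sum>g\<in>N. b p g * window_fun n L (window_matrix (combo I c) p) g \<gamma>)"
      by (simp add: sum.cartesian_product' R_def fI)
    also have "\<dots> = f' \<gamma>"
      unfolding f'_def combo_def[of I "\<lambda>t. of_real (weight n L t) * c t"]
      by (rule window_interpolation[OF card I N L0 nlen nN P(2) _ that]) (use interp in auto)
    finally show ?thesis by (simp add: j_def)
  qed
  then have sing: "regular_rep G j \<in> algebraic_singular_ideal G" by (rule simple_singular[OF sj count])
  have "rep_bound (combo I (\<lambda>t. (1 - of_real (weight n L t)) * c t)) \<eta>"
  proof (rule rep_bound_mono[OF rep_bound_combo[OF I]])
    have "(\<Sum>t\<in>I. cmod ((1 - of_real (weight n L t)) * c t)) \<le>
        (\<Sum>t\<in>I. cmod (c t) * real (length (fst t) + length (snd (snd t))) / real L)"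
    proof (rule sum_mono)
      fix t
      have "cmod (1 - of_real (weight n L t)) = 1 - weight n L t"
        using weight_le_1[OF L0, of n t] by (metis abs_of_nonneg diff_ge_0_iff_ge norm_of_real of_real_1 of_real_diff)
      also have "\<dots> \<le> real (length (fst t) + length (snd (snd t))) / real L"
        using weight_ge[OF L0, of n "fst t" "fst (snd t)" "snd (snd t)"] by simp
      finally show "cmod ((1 - of_real (weight n L t)) * c t) \<le>
          cmod (c t) * real (length (fst t) + length (snd (snd t))) / real L"
        by (simp add: norm_mult mult_left_mono mult.commute flip: times_divide_eq_right)
    qed
    also have "\<dots> = D / real L" by (simp add: D_def sum_divide_distrib)
    finally show "(\<Sum>t\<in>I. cmod ((1 - of_real (weight n L t)) * c t)) \<le> \<eta>" using DL by linarith
  qed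
  moreover have "combo I (\<lambda>t. (1 - of_real (weight n L t)) * c t) = (\<lambda>\<gamma>. f \<gamma> - f' \<gamma>)"
    unfolding fI f'_def combo_def by (simp add: sum_subtractf left_diff_distrib)
  ultimately have b1: "rep_bound (\<lambda>\<gamma>. f \<gamma> - f' \<gamma>) \<eta>" by simp
  have b2: "rep_bound (\<lambda>\<gamma>. \<Sum>q\<in>P \<times> N. b (fst q) (snd q) * R q \<gamma>) (C * \<eta>)"
    using rep_bound_sum[OF finPN bR, where c = "\<lambda>q. b (fst q) (snd q)"] by (simp add: C_def sum_distrib_right)
  have "rep_bound (\<lambda>\<gamma>. f \<gamma> - j \<gamma>) (\<eta> + C * \<eta>)"
    using rep_bound_lincomb2[OF b1 b2, of 1 1] by (simp add: j_def algebra_simps)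
  then have "reduced_norm G (a - regular_rep G j) \<le> ennreal (\<eta> + (\<eta> + C * \<eta>))"
    by (rule reduced_norm_diff_trans[OF ra B B' _ _ f(2)]) (use \<eta> in simp)
  also have "\<eta> + (\<eta> + C * \<eta>) = (2 + C) * \<eta>" by (simp add: algebra_simps)
  also have "ennreal ((2 + C) * \<eta>) < ennreal \<epsilon>"
    using C \<epsilon> by (simp add: \<eta>_def ennreal_lessI field_simps)
  finally show ?thesis using sing by blast
qed

text \<open>
  Over a one-letter alphabet germs have no well-defined degree; there the groupoid is trivial and
  \<open>0\<close> is the required approximant.
\<close>

lemma singular_approximation_one_letter:
  assumes card: "CARD('a) = 1" and count: "countable (carrier \<Gamma>)" and a: "a \<in> singular_ideal G" and \<epsilon>: "0 < \<epsilon>"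
  shows "\<exists>s\<in>algebraic_singular_ideal G. reduced_norm G (a - s) < ennreal \<epsilon>"
proof -
  have ra: "a \<in> reduced_algebra G" using a by (simp add: singular_ideal_def)
  have letters: "x = y" for x y :: 'a
    using card by (metis (full_types) UNIV_I card_1_singletonE singletonD)
  have words: "\<xi> = \<eta>" for \<xi> \<eta> :: "'a word" using letters by blast
  have cyl: "\<xi> \<in> cyl u" for \<xi> and u :: "'a list" using words by (metis rangeI)
  \<comment> \<open>There is only one infinite word, so nonempty maps of the semigroup coincide and
    every bisection \<open>Z t\<close> is the whole arrow space.\<close>
  have near: "near \<xi> T S" if TS: "T \<in> IS" "S \<in> IS" "\<xi> \<in> dom T" "\<xi> \<in> dom S" for \<xi> T S
  proof -
    have "T \<eta> = S \<eta>" for \<eta>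
      using TS(3,4) words[of \<eta> \<xi>] words by (metis domD)
    then have "T = S" by (rule ext)
    then show ?thesis by simp
  qed
  have reg: "regular \<xi>" for \<xi>
    unfolding regular_def by (metis near domIff)
  have Zarr: "Z t = arr" if t: "t \<in> triples" for t
  proof
    obtain u g v where tt: "t = (u, g, v)" "g \<in> carrier \<Gamma>" using t by auto
    then show "Z t \<subseteq> arr" using bisec_subset[of "cmap u g v"] by simp
    show "arr \<subseteq> Z t"
    proof
      fix \<gamma> assume "\<gamma> \<in> arr"
      then obtain T \<xi> \<eta> where T: "T \<in> IS" "T \<xi> = Some \<eta>" "\<gamma> = gm T \<xi>" by (rule arrE)
      have "\<xi> \<in> dom T" using T(2) by blast
      moreover have "\<xi> \<in> dom (cmap u g v)" using cyl by simp
      ultimately have "gm T \<xi> \<in> bisec (cmap u g v)"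
        using germ_in_bisec[of T \<xi> "cmap u g v"] near[of T "cmap u g v" \<xi>] T(1) tt(2) by simp
      then show "\<gamma> \<in> Z t" using T(3) tt(1) by simp
    qed
  qed
  define \<eta> where "\<eta> = \<epsilon> / 3"
  have \<eta>: "0 < \<eta>" using \<epsilon> by (simp add: \<eta>_def)
  obtain f where f: "simple f" "reduced_norm G (a - regular_rep G f) \<le> ennreal \<eta>"
    using reduced_algebra_approx[OF ra \<eta>] by blast
  obtain B where B: "rep_bound f B" using simple_rep_bound[OF f(1)] by blast
  obtain I c where I: "finite I" "I \<subseteq> triples" "f = combo I c" using f(1) unfolding simple_def by blast
  define k where "k = (\<Sum>t\<in>I. c t)"
  define e where "e = ([] :: 'a list, \<one>\<^bsub>\<Gamma>\<^esub>, [] :: 'a list)"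
  have e: "e \<in> triples" by (simp add: e_def)
  have fk: "f = (\<lambda>\<gamma>. \<Sum>t\<in>{e}. k * indicator (Z e) \<gamma>)"
  proof
    fix \<gamma>
    have "f \<gamma> = (\<Sum>t\<in>I. c t * indicator arr \<gamma>)"
      unfolding I(3) combo_def by (rule sum.cong[OF refl]) (use Zarr I(2) in auto)
    then show "f \<gamma> = (\<Sum>t\<in>{e}. k * indicator (Z e) \<gamma>)" by (simp add: k_def sum_distrib_right Zarr[OF e])
  qed
  \<comment> \<open>On arrows \<open>f\<close> is the constant \<open>k\<close>. Comparing it at one
    arrow with \<open>a\<close>, which vanishes there, bounds \<open>k\<close> and hence the norm of
    \<open>f\<close>.\<close>
  let ?\<gamma> = "gm Some undefined"
  have \<gamma>: "?\<gamma> \<in> arr" by simp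
  have "value_at G a ?\<gamma> = 0" by (rule singular_value_regular[OF a \<gamma> reg])
  then have "cmod k \<le> \<eta>"
    using value_close[OF ra B _ f(2) \<gamma>] \<eta> \<gamma> Zarr[OF e] by (simp add: fk)
  moreover have "rep_bound f (\<Sum>t\<in>{e}. cmod k * 1)"
    unfolding fk by (rule rep_bound_sum) (use rep_bound_Z[OF e] in auto)
  ultimately have "rep_bound f \<eta>" using rep_bound_mono by simp
  moreover have "simple (\<lambda>_. 0)" using simple_sum[of "{}"] by simp
  ultimately have "reduced_norm G (a - regular_rep G (\<lambda>_. 0)) \<le> ennreal (\<eta> + \<eta>)"
    by (intro reduced_norm_diff_trans[OF ra B rep_bound_zero _ _ f(2)]) (use \<eta> in auto)
  also have "\<dots> < ennreal \<epsilon>" using \<epsilon> by (intro ennreal_lessI) (simp_all add: \<eta>_def)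
  finally show ?thesis using simple_singular[OF \<open>simple (\<lambda>_. 0)\<close> count] by blast
qed

end

theorem corollary8:
  fixes \<Gamma> :: "('c, 'm) monoid_scheme" and \<phi> :: "'c \<Rightarrow> 'a::finite list \<Rightarrow> 'a list"
  assumes "contracting_self_similar_action \<Gamma> \<phi>"
  shows "norm_dense_in (germ_groupoid \<Gamma> \<phi>)
           (algebraic_singular_ideal (germ_groupoid \<Gamma> \<phi>))
           (singular_ideal (germ_groupoid \<Gamma> \<phi>))"
proof -
  interpret contracting_self_similar_action \<Gamma> \<phi> by (rule assms)
  obtain N where N: "finite N" "N \<subseteq> carrier \<Gamma>"
    "\<And>g. g \<in> carrier \<Gamma> \<Longrightarrow> \<exists>m. \<forall>v. m \<le> length v \<longrightarrow> word_section \<Gamma> \<phi> g v \<in> N"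
    using contracting by blast
  show ?thesis
    unfolding norm_dense_in_def
  proof (intro conjI ballI allI impI)
    show "algebraic_singular_ideal (germ_groupoid \<Gamma> \<phi>) \<subseteq> singular_ideal (germ_groupoid \<Gamma> \<phi>)"
      by (simp add: algebraic_singular_ideal_def)
    fix a and \<epsilon> :: real
    assume a: "a \<in> singular_ideal (germ_groupoid \<Gamma> \<phi>)" "0 < \<epsilon>"
    show "\<exists>b\<in>algebraic_singular_ideal (germ_groupoid \<Gamma> \<phi>). reduced_norm (germ_groupoid \<Gamma> \<phi>) (a - b) < ennreal \<epsilon>"
    proof (cases "2 \<le> CARD('a)")
      case True
      then show ?thesis by (rule singular_approximation[OF _ N countable_carrier a])
    next
      case False
      then have "CARD('a) = 1" using zero_less_card_finite[where 'a = 'a] by linarith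
      then show ?thesis by (rule singular_approximation_one_letter[OF _ countable_carrier a])
    qed
  qed
qed

end
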